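(* Consider the noncooperative scenario, let $A_m$ and $A_s$ be the events that the typical user is associated with an MBS and with an SBS, respectively, and let $\mathcal T>0$ be the SINR threshold. The downlink coverage probability $P_{c,A_m}$ of the typical user when it is associated with a base station of the MBS tier is $$P_{c,A_m}=\int_{r>0}\sum_{k=0}^{\Delta_m-1}\frac{1}{k!}(-s)^k\,\frac{d^k}{ds^k}\Big(e^{-sN}\mathcal L_{\mathcal I}(s)\Big)\,f_{R_m}(r)\,dr,\qquad s=p_m^{-1}\mathcal T r^\alpha,$$ and the downlink coverage probability $P_{c,A_s}$ when it is associated with an SBS is $$P_{c,A_s}=\int_{r>0}\sum_{k=0}^{\Delta_s-1}\frac{1}{k!}(-s)^k\,\frac{d^k}{ds^k}\Big(e^{-sN}\mathcal L_{\mathcal I}(s)\Big)\,f_{R_s}(r)\,dr,\qquad s=p_s^{-1}\mathcal T r^\alpha.$$ (i) The densities of the distance to the serving MBS and to the serving SBS are, with $\beta=(\hat p_s\hat\Delta_s\hat B_s)^{-1}$, $$f_{R_m}(r)=\frac{2\pi\lambda_m r\,e^{-\pi r^2(\lambda_m+\lambda_s\beta^{2/\alpha})}}{1-\mathcal A_{\mathrm{SBS}}},\qquad f_{R_s}(r)=\frac{2\pi\lambda_s r\,e^{-\pi r^2(\lambda_s+\lambda_m\beta^{-2/\alpha})}}{\mathcal A_{\mathrm{SBS}}},\qquad \mathcal A_{\mathrm{SBS}}=\frac{1}{1+\frac{\lambda_m}{\lambda_s}\,\frac{1}{(\hat p_s\hat\Delta_s\hat B_s)^{2/\alpha}}}.$$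 (ii) The Laplace transform of the interference is $$\mathcal L_{\mathcal I}(s)=\exp\Big\{-s^{2/\alpha}\sum_{j\in\{s,m\}}\lambda_jp_j^{2/\alpha}\,\frac{2\pi}{\alpha}\sum_{i=1}^{\Psi_j}\binom{\Psi_j}{i}\mathrm B'\Big(\Psi_j+i-\tfrac2\alpha,\;i+\tfrac2\alpha,\;w_j\Big)\Big\},$$ where, with $\eta=1/(\hat p_s\hat\Delta_s\hat B_s r^\alpha)$: in $P_{c,A_m}$, $w_m=\frac{1}{1+(sp_m)^{-\alpha}r}$ and $w_s=\frac{1}{1+(sp_s)^{-\alpha}\eta^{-1}}$; in $P_{c,A_s}$, $w_m=\frac{1}{1+(sp_m)^{-\alpha}\eta}$ and $w_s=\frac{1}{1+(sp_s)^{-\alpha}r}$. (iii) For $k\ge1$ the derivative is given by $$\frac{d^k}{ds^k}\Big(e^{-sN}\mathcal L_{\mathcal I}(s)\Big)=e^{-sN}\mathcal L_{\mathcal I}(s)\sum_{n=1}^{k}\;\sum_{\substack{i_1+\cdots+i_k=n\\ i_1+2i_2+\cdots+ki_k=k}}\frac{k!}{\prod_{j=1}^k (j!)^{i_j}\,i_j!}\prod_{j=1}^{k}\Big(-N\mathbf 1_{j=1}+2\pi\sum_{t\in\{m,s\}}(-1)^jD_t(j)\,p_t^{\,j}(sp_t)^{\frac2\alpha-j}\Big)^{i_j},$$ $$D_t(j)=\frac{\lambda_t}{\alpha}(-1)^j\frac{(\Psi_t+j-1)!}{(\Psi_t-1)!}\,\mathrm B'\Big(\Psi_t+\tfrac2\alpha,\;j-\tfrac2\alpha,\;w_t\Big),$$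 the inner sum being over nonnegative integers $i_1,\dots,i_k$ and $w_t$ being as in (ii). The overall coverage probability of the noncooperative scenario is $$P_{c,nc}=(1-\mathcal A_{\mathrm{SBS}})\,P_{c,A_m}+\mathcal A_{\mathrm{SBS}}\,P_{c,A_s}.$$
   Context: Macro base stations (MBSs) and small base stations (SBSs) form independent homogeneous Poisson point processes $\Phi_m,\Phi_s$ on $\mathbb R^2$ with densities $\lambda_m,\lambda_s>0$; the typical user is at the origin. For $j\in\{m,s\}$ let $p_j>0$ be the transmit power, $M_j\ge\Psi_j\ge1$ integers (numbers of antennas and of served users), $\Delta_j=M_j-\Psi_j+1$, and $B_j>0$ the bias. Both tiers have path-loss exponent $\alpha>2$; $N=\sigma^2$ is the noise power, identical in both tiers. Put $\hat p_s=p_s/p_m$, $\hat\Delta_s=\Delta_s/\Delta_m$, $\hat B_s=B_s/B_m$. Let $r_m,r_s$ be the distances from the origin to the nearest MBS and nearest SBS. In the noncooperative scenario the user is associated with the nearest SBS (event $A_s$) if $B_sp_s\Delta_s r_s^{-\alpha}>B_mp_m\Delta_m r_m^{-\alpha}$, and with the nearest MBS (event $A_m$) otherwise; $\mathcal A_{\mathrm{SBS}}$ is the probability of association with the SBS. If the serving base station is in tier $l$ at distance $r$, the SINR is $\gamma=p_l\,h\,r^{-\alpha}/(\mathcal I+N)$, where $h\sim\Gamma(\Delta_l,1)$ and $\mathcal I=\sum_{j\in\{m,s\}}\sum_y p_j g_{y,j}\|y\|^{-\alpha}$, the inner sum being over all tier-$j$ base stations $y$ other than the serving one, with $g_{y,j}\sim\Gamma(\Psi_j,1)$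 (Gamma law, shape and scale); channel powers are independent of each other and of the point processes. Coverage means $\gamma>\mathcal T$; $P_{c,A_m}$ and $P_{c,A_s}$ are the probabilities of coverage given $A_m$ and given $A_s$. $\mathcal L_{\mathcal I}(s)$ is the Laplace transform of $\mathcal I$ given the association and the serving distance $r$. The complementary incomplete Beta function is $\mathrm B'(p,q,x)=\int_x^1 t^{p-1}(1-t)^{q-1}\,dt$.
   Formalization: Misprints corrected: β=p̂Δ̂B̂ (no inverse) in (i); B'(Ψ_j−i+2/α, i−2/α, w_j) in (ii); w_j=1/(1+s p_j d_j^{−α}), with d_j=r for the serving tier, (p̂Δ̂B̂)^{1/α}r for SBSs given A_m, (p̂Δ̂B̂)^{−1/α}r for MBSs given A_s; in (iii) the sign (−1)^j occurs only once. *)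

theory Defs
  imports "HOL-Probability.Probability"
begin

section \<open>Network parameters\<close>

datatype tier = MBS | SBS

record hetnet =
  dens :: "tier \<Rightarrow> real"
  tx_power :: "tier \<Rightarrow> real"
  antennas :: "tier \<Rightarrow> nat"
  users :: "tier \<Rightarrow> nat"
  bias :: "tier \<Rightarrow> real"
  pathloss :: real
  noise :: real

definition valid_hetnet :: "hetnet \<Rightarrow> bool" where
  "valid_hetnet H \<longleftrightarrow>
     (\<forall>j. 0 < dens H j \<and> 0 < tx_power H j \<and> 0 < bias H j \<and>
          1 \<le> users H j \<and> users H j \<le> antennas H j) \<and>
     2 < pathloss H \<and> 0 \<le> noise H"

text \<open>The number \<open>\<Delta>\<^sub>j = M\<^sub>j - \<Psi>\<^sub>j + 1\<close>; the truncated subtraction is harmless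
  because \<open>\<Psi>\<^sub>j \<le> M\<^sub>j\<close> in every valid network.\<close>

definition dof :: "hetnet \<Rightarrow> tier \<Rightarrow> nat" where
  "dof H j = antennas H j - users H j + 1"

definition sbs_mbs_ratio :: "(tier \<Rightarrow> real) \<Rightarrow> real" where
  "sbs_mbs_ratio f = f SBS / f MBS"

text \<open>The product of the SBS-to-MBS ratios of power, \<open>\<Delta>\<close> and bias. (Not its inverse: an MBS at
  distance \<open>r\<close> and an SBS at distance \<open>bias_ratio H powr (1/\<alpha>) * r\<close> have equal biased received power.)\<close>

definition bias_ratio :: "hetnet \<Rightarrow> real" where
  "bias_ratio H = sbs_mbs_ratio (tx_power H) * sbs_mbs_ratio (\<lambda>j. real (dof H j)) * sbs_mbs_ratio (bias H)"


section \<open>Marked Poisson point processes\<close>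

text \<open>A homogeneous Poisson point process of density \<open>rate\<close> on a Euclidean space, given by a
  measurable enumeration \<open>X 0, X 1, \<dots>\<close> of its points. (The process has infinitely many points
  almost surely, and no point is repeated, almost surely, because the intensity has no atoms.)\<close>

definition count_in :: "(nat \<Rightarrow> 'w \<Rightarrow> 'a) \<Rightarrow> 'a set \<Rightarrow> 'w \<Rightarrow> nat" where
  "count_in X B \<omega> = card {n. X n \<omega> \<in> B}"

definition homogeneous_ppp ::
    "'w measure \<Rightarrow> (nat \<Rightarrow> 'w \<Rightarrow> 'a::euclidean_space) \<Rightarrow> real \<Rightarrow> bool" where
  "homogeneous_ppp M X rate \<longleftrightarrow>
     (\<forall>n. X n \<in> borel_measurable M) \<and>
     (\<forall>B\<in>sets borel. bounded B \<longrightarrow>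
        (AE \<omega> in M. finite {n. X n \<omega> \<in> B}) \<and>
        (\<forall>k. \<P>(\<omega> in M. count_in X B \<omega> = k) =
              (rate * measure lborel B) ^ k / fact k * exp (- (rate * measure lborel B)))) \<and>
     (\<forall>(I :: nat set) B.
        finite I \<and> (\<forall>i\<in>I. B i \<in> sets borel \<and> bounded (B i)) \<and> disjoint_family_on B I \<longrightarrow>
        prob_space.indep_vars M (\<lambda>_. count_space UNIV) (\<lambda>i. count_in X (B i)) I)"

text \<open>The independent sources of randomness: the point process of a tier, the interfering channel
  power of a base station, and the channel power of the serving link when served by a tier.\<close>

datatype source = Points tier | Interf tier nat | Signal tier

definition source_events ::
    "'w measure \<Rightarrow> (tier \<Rightarrow> nat \<Rightarrow> 'w \<Rightarrow> real^2) \<Rightarrow> (tier \<Rightarrow> nat \<Rightarrow> 'w \<Rightarrow> real) \<Rightarrow>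
     (tier \<Rightarrow> 'w \<Rightarrow> real) \<Rightarrow> source \<Rightarrow> 'w set set" where
  "source_events M X g h src = (case src of
       Points j \<Rightarrow> sets (vimage_algebra (space M) (\<lambda>\<omega> n. X j n \<omega>) (PiM UNIV (\<lambda>_. borel)))
     | Interf j n \<Rightarrow> sets (vimage_algebra (space M) (g j n) borel)
     | Signal j \<Rightarrow> sets (vimage_algebra (space M) (h j) borel))"

text \<open>\<open>erlang_density k 1\<close> is the density of the Gamma law with shape \<open>k + 1\<close> and scale \<open>1\<close>.\<close>

definition hetnet_model ::
    "'w measure \<Rightarrow> hetnet \<Rightarrow> (tier \<Rightarrow> nat \<Rightarrow> 'w \<Rightarrow> real^2) \<Rightarrow> (tier \<Rightarrow> nat \<Rightarrow> 'w \<Rightarrow> real) \<Rightarrow>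
     (tier \<Rightarrow> 'w \<Rightarrow> real) \<Rightarrow> bool" where
  "hetnet_model M H X g h \<longleftrightarrow>
     prob_space M \<and>
     (\<forall>j. homogeneous_ppp M (X j) (dens H j)) \<and>
     (\<forall>j n. distributed M lborel (g j n) (\<lambda>x. ennreal (erlang_density (users H j - 1) 1 x))) \<and>
     (\<forall>j. distributed M lborel (h j) (\<lambda>x. ennreal (erlang_density (dof H j - 1) 1 x))) \<and>
     prob_space.indep_sets M (source_events M X g h) UNIV"


section \<open>Association, interference and SINR\<close>

definition nearest_dist :: "(tier \<Rightarrow> nat \<Rightarrow> 'w \<Rightarrow> real^2) \<Rightarrow> tier \<Rightarrow> 'w \<Rightarrow> real" where
  "nearest_dist X j \<omega> = (INF n. norm (X j n \<omega>))"

definition nearest_index :: "(tier \<Rightarrow> nat \<Rightarrow> 'w \<Rightarrow> real^2) \<Rightarrow> tier \<Rightarrow> 'w \<Rightarrow> nat" where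
  "nearest_index X j \<omega> = (LEAST n. norm (X j n \<omega>) = nearest_dist X j \<omega>)"

definition biased_power ::
    "hetnet \<Rightarrow> (tier \<Rightarrow> nat \<Rightarrow> 'w \<Rightarrow> real^2) \<Rightarrow> tier \<Rightarrow> 'w \<Rightarrow> real" where
  "biased_power H X j \<omega> =
     bias H j * tx_power H j * real (dof H j) * nearest_dist X j \<omega> powr (- pathloss H)"

definition serving_tier ::
    "hetnet \<Rightarrow> (tier \<Rightarrow> nat \<Rightarrow> 'w \<Rightarrow> real^2) \<Rightarrow> 'w \<Rightarrow> tier" where
  "serving_tier H X \<omega> = (if biased_power H X SBS \<omega> > biased_power H X MBS \<omega> then SBS else MBS)"

definition assoc_event ::
    "'w measure \<Rightarrow> hetnet \<Rightarrow> (tier \<Rightarrow> nat \<Rightarrow> 'w \<Rightarrow> real^2) \<Rightarrow> tier \<Rightarrow> 'w set" where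
  "assoc_event M H X l = {\<omega>\<in>space M. serving_tier H X \<omega> = l}"

definition sbs_assoc_prob ::
    "'w measure \<Rightarrow> hetnet \<Rightarrow> (tier \<Rightarrow> nat \<Rightarrow> 'w \<Rightarrow> real^2) \<Rightarrow> real" where
  "sbs_assoc_prob M H X = measure M (assoc_event M H X SBS)"

definition serving_dist ::
    "hetnet \<Rightarrow> (tier \<Rightarrow> nat \<Rightarrow> 'w \<Rightarrow> real^2) \<Rightarrow> 'w \<Rightarrow> real" where
  "serving_dist H X \<omega> = nearest_dist X (serving_tier H X \<omega>) \<omega>"

definition interferers ::
    "hetnet \<Rightarrow> (tier \<Rightarrow> nat \<Rightarrow> 'w \<Rightarrow> real^2) \<Rightarrow> tier \<Rightarrow> 'w \<Rightarrow> nat set" where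
  "interferers H X j \<omega> =
     UNIV - (if j = serving_tier H X \<omega> then {nearest_index X j \<omega>} else {})"

definition interference ::
    "hetnet \<Rightarrow> (tier \<Rightarrow> nat \<Rightarrow> 'w \<Rightarrow> real^2) \<Rightarrow> (tier \<Rightarrow> nat \<Rightarrow> 'w \<Rightarrow> real) \<Rightarrow> 'w \<Rightarrow> real" where
  "interference H X g \<omega> =
     (\<Sum>j\<in>{MBS, SBS}. \<Sum>\<^sub>\<infinity>n\<in>interferers H X j \<omega>.
        tx_power H j * g j n \<omega> * norm (X j n \<omega>) powr (- pathloss H))"

definition sinr ::
    "hetnet \<Rightarrow> (tier \<Rightarrow> nat \<Rightarrow> 'w \<Rightarrow> real^2) \<Rightarrow> (tier \<Rightarrow> nat \<Rightarrow> 'w \<Rightarrow> real) \<Rightarrow>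
     (tier \<Rightarrow> 'w \<Rightarrow> real) \<Rightarrow> 'w \<Rightarrow> real" where
  "sinr H X g h \<omega> =
     tx_power H (serving_tier H X \<omega>) * h (serving_tier H X \<omega>) \<omega> * serving_dist H X \<omega> powr (- pathloss H) /
     (interference H X g \<omega> + noise H)"

definition coverage_prob ::
    "'w measure \<Rightarrow> hetnet \<Rightarrow> (tier \<Rightarrow> nat \<Rightarrow> 'w \<Rightarrow> real^2) \<Rightarrow> (tier \<Rightarrow> nat \<Rightarrow> 'w \<Rightarrow> real) \<Rightarrow>
     (tier \<Rightarrow> 'w \<Rightarrow> real) \<Rightarrow> real \<Rightarrow> real" where
  "coverage_prob M H X g h T = \<P>(\<omega> in M. sinr H X g h \<omega> > T)"

definition coverage_prob_given ::
    "'w measure \<Rightarrow> hetnet \<Rightarrow> (tier \<Rightarrow> nat \<Rightarrow> 'w \<Rightarrow> real^2) \<Rightarrow> (tier \<Rightarrow> nat \<Rightarrow> 'w \<Rightarrow> real) \<Rightarrow>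
     (tier \<Rightarrow> 'w \<Rightarrow> real) \<Rightarrow> real \<Rightarrow> tier \<Rightarrow> real" where
  "coverage_prob_given M H X g h T l =
     \<P>(\<omega> in M. sinr H X g h \<omega> > T \<bar> \<omega> \<in> assoc_event M H X l)"

text \<open>\<open>L s r\<close> is (a version of) the Laplace transform at \<open>s\<close> of the interference, given that the
  user is served by tier \<open>l\<close> at distance \<open>r\<close>.\<close>

definition conditional_laplace ::
    "'w measure \<Rightarrow> hetnet \<Rightarrow> (tier \<Rightarrow> nat \<Rightarrow> 'w \<Rightarrow> real^2) \<Rightarrow> (tier \<Rightarrow> nat \<Rightarrow> 'w \<Rightarrow> real) \<Rightarrow>
     tier \<Rightarrow> (real \<Rightarrow> real \<Rightarrow> real) \<Rightarrow> bool" where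
  "conditional_laplace M H X g l L \<longleftrightarrow>
     (let Ml = uniform_measure M (assoc_event M H X l) in
      \<forall>s>0. AE \<omega> in Ml.
        real_cond_exp Ml (vimage_algebra (space M) (serving_dist H X) borel)
          (\<lambda>\<omega>. exp (- s * interference H X g \<omega>)) \<omega>
        = L s (serving_dist H X \<omega>))"


section \<open>Closed-form expressions\<close>

text \<open>The complementary incomplete Beta function.\<close>

definition cinc_beta :: "real \<Rightarrow> real \<Rightarrow> real \<Rightarrow> real" where
  "cinc_beta p q x = (LBINT t:{x..1}. t powr (p - 1) * (1 - t) powr (q - 1))"

definition serving_dist_density ::
    "'w measure \<Rightarrow> hetnet \<Rightarrow> (tier \<Rightarrow> nat \<Rightarrow> 'w \<Rightarrow> real^2) \<Rightarrow> tier \<Rightarrow> real \<Rightarrow> real" where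
  "serving_dist_density M H X l r = (case l of
       MBS \<Rightarrow> 2 * pi * dens H MBS * r *
              exp (- pi * r^2 * (dens H MBS + dens H SBS * bias_ratio H powr (2 / pathloss H))) /
              (1 - sbs_assoc_prob M H X)
     | SBS \<Rightarrow> 2 * pi * dens H SBS * r *
              exp (- pi * r^2 * (dens H SBS + dens H MBS * bias_ratio H powr (- (2 / pathloss H)))) /
              sbs_assoc_prob M H X)"

text \<open>The radius around the user within which tier \<open>j\<close> has no interferer when the serving base
  station is in tier \<open>l\<close> at distance \<open>r\<close>.\<close>

definition guard_dist :: "hetnet \<Rightarrow> tier \<Rightarrow> tier \<Rightarrow> real \<Rightarrow> real" where
  "guard_dist H l j r =
     (if j = l then r
      else if l = MBS then bias_ratio H powr (1 / pathloss H) * r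
      else bias_ratio H powr (- (1 / pathloss H)) * r)"

text \<open>The lower limit of the Beta integrals: the image of \<open>x = guard_dist H l j r\<close> under the
  substitution \<open>t = 1 / (1 + s p\<^sub>j x powr (- \<alpha>))\<close> in the integral of
  \<open>1 - 1 / (1 + s p\<^sub>j x powr (- \<alpha>)) ^ \<Psi>\<^sub>j\<close> over all tier-\<open>j\<close> interferers.\<close>

definition beta_arg :: "hetnet \<Rightarrow> tier \<Rightarrow> tier \<Rightarrow> real \<Rightarrow> real \<Rightarrow> real" where
  "beta_arg H l j s r = 1 / (1 + s * tx_power H j * guard_dist H l j r powr (- pathloss H))"

definition interference_laplace :: "hetnet \<Rightarrow> tier \<Rightarrow> real \<Rightarrow> real \<Rightarrow> real" where
  "interference_laplace H l s r =
     exp (- (s powr (2 / pathloss H)) *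
       (\<Sum>j\<in>{SBS, MBS}. dens H j * tx_power H j powr (2 / pathloss H) * (2 * pi / pathloss H) *
          (\<Sum>i=1..users H j. real (users H j choose i) *
             cinc_beta (real (users H j) - real i + 2 / pathloss H) (real i - 2 / pathloss H)
               (beta_arg H l j s r))))"

definition noisy_laplace :: "hetnet \<Rightarrow> tier \<Rightarrow> real \<Rightarrow> real \<Rightarrow> real" where
  "noisy_laplace H l r s = exp (- s * noise H) * interference_laplace H l s r"

text \<open>The factor \<open>(-1) ^ j\<close> of the \<open>j\<close>-th derivative is contained in \<open>fdb_coeff\<close>.\<close>

definition fdb_coeff :: "hetnet \<Rightarrow> tier \<Rightarrow> tier \<Rightarrow> nat \<Rightarrow> real \<Rightarrow> real \<Rightarrow> real" where
  "fdb_coeff H l t j s r =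
     dens H t / pathloss H * (-1) ^ j * (fact (users H t + j - 1) / fact (users H t - 1)) *
     cinc_beta (real (users H t) + 2 / pathloss H) (real j - 2 / pathloss H) (beta_arg H l t s r)"

text \<open>The multi-indices \<open>(i\<^sub>1, \<dots>, i\<^sub>k)\<close> with \<open>n\<close> blocks in Faa di Bruno's formula.\<close>

definition bell_indices :: "nat \<Rightarrow> nat \<Rightarrow> (nat \<Rightarrow> nat) set" where
  "bell_indices k n =
     {i \<in> {1..k} \<rightarrow>\<^sub>E UNIV. (\<Sum>j=1..k. i j) = n \<and> (\<Sum>j=1..k. j * i j) = k}"

definition noisy_laplace_deriv :: "hetnet \<Rightarrow> tier \<Rightarrow> nat \<Rightarrow> real \<Rightarrow> real \<Rightarrow> real" where
  "noisy_laplace_deriv H l k r s =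
     noisy_laplace H l r s *
     (\<Sum>n=1..k. \<Sum>i\<in>bell_indices k n.
        fact k / (\<Prod>j=1..k. fact j ^ i j * fact (i j)) *
        (\<Prod>j=1..k.
           (- noise H * (if j = 1 then 1 else 0) +
            2 * pi * (\<Sum>t\<in>{MBS, SBS}. fdb_coeff H l t j s r * tx_power H t ^ j *
                        (s * tx_power H t) powr (2 / pathloss H - real j))) ^ i j))"

definition coverage_integrand :: "'w measure \<Rightarrow> hetnet \<Rightarrow> (tier \<Rightarrow> nat \<Rightarrow> 'w \<Rightarrow> real^2) \<Rightarrow>
     real \<Rightarrow> tier \<Rightarrow> real \<Rightarrow> real" where
  "coverage_integrand M H X T l r =
     (let s = T * r powr pathloss H / tx_power H l in
      (\<Sum>k<dof H l. 1 / fact k * (- s) ^ k * (deriv ^^ k) (noisy_laplace H l r) s) *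
      serving_dist_density M H X l r)"

end

theory Submission
  imports Defs
begin

text \<open>Up to probability \<open>O((b - a)\<^sup>2)\<close>, tier \<open>l\<close> serves at a distance in \<open>(a, b]\<close> exactly if its only
  point within distance \<open>b\<close> of the user lies in that annulus and the other tier has no point within
  its guard distance; then the interference is the shot noise of the points beyond the guard
  distances, which is independent of that event. Hence
  \<open>a \<mapsto> E (exp (- \<sigma>(R) I); tier l serves, R > a)\<close> is differentiable with an explicit derivative,
  and integrating it gives the joint law of the serving distance \<open>R\<close> and the Laplace transform of
  the interference \<open>I\<close>. The latter is computed by integrating out the Gamma marks one by one and
  applying the Laplace functional of the Poisson process; polar coordinates and the substitution
  \<open>t = 1 / (1 + s p x powr - \<alpha>)\<close> turn its exponent into incomplete Beta integrals.

  The coverage event is \<open>h > s (I + N)\<close> with \<open>s = T * R powr \<alpha> / p\<^sub>l\<close>, whose conditional probability is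
  the sum over \<open>k < \<Delta>\<^sub>l\<close> of \<open>Y ^ k * exp (- Y) / k!\<close> at \<open>Y = s (I + N)\<close>. Each summand is a
  derivative at \<open>\<theta> = 1\<close> of the Laplace transform \<open>\<theta> \<mapsto> E exp (- \<theta> Y)\<close>, so it is enough to know that
  transform, and the derivatives with respect to \<open>s\<close> in the formula are those of an honest Laplace
  transform for each fixed distance. Their closed form is Faa di Bruno's formula for \<open>exp \<circ> V\<close>.\<close>

section \<open>Integrals depending on a parameter and radial integrals\<close>

text \<open>A given serving distance is a null event, and the model offers only counts in bounded
  sets and an arbitrary enumeration of the points, so conditioning has to be produced by hand. Thin
  annuli do this: when the serving distance lies in \<open>(a, b]\<close>, failure of the cell event
  forces two points into regions of area O(b - a), an error that vanishes after division by b - a.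
  Guard distances are taken at the outer radius \<open>b\<close>; the cut-off is then deterministic
  and disjoint regions carry all the independence. The argument \<open>\<sigma>\<close> must vary
  with the distance because the coverage threshold does; its monotonicity confines it between its
  values at \<open>a\<close> and \<open>b\<close>. In the network, distance and interference are
  dependent, whereas in the formula they live on separate factors of a product space. Only the
  Laplace transforms of the two thresholds are compared, as functions of a scaling
  \<open>\<theta>\<close>; differentiating both at 1 gives equal coverage, and no uniqueness theorem
  for Laplace transforms enters. The noise may be zero, so positivity of the SINR denominator has to
  come from the interference of the non-serving tier.\<close>

lemma has_real_derivative_integral_dominated:
  fixes f f' :: "real \<Rightarrow> 'a \<Rightarrow> real"
  assumes s: "s \<in> {a<..<b}"
    and f: "\<And>t. t \<in> {a<..<b} \<Longrightarrow> integrable M (f t)"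
    and f': "f' s \<in> borel_measurable M"
    and deriv: "\<And>t x. t \<in> {a<..<b} \<Longrightarrow> x \<in> space M \<Longrightarrow>
      ((\<lambda>t. f t x) has_real_derivative f' t x) (at t)"
    and w: "integrable M w"
    and bound: "\<And>t x. t \<in> {a<..<b} \<Longrightarrow> x \<in> space M \<Longrightarrow> \<bar>f' t x\<bar> \<le> w x"
  shows "((\<lambda>t. \<integral>x. f t x \<partial>M) has_real_derivative (\<integral>x. f' s x \<partial>M)) (at s)"
  unfolding has_field_derivative_iff tendsto_at_iff_sequentially
proof (intro allI impI)
  fix Y :: "nat \<Rightarrow> real"
  assume Y: "\<forall>i. Y i \<in> UNIV - {s}" "Y \<longlonglongrightarrow> s"
  have ev: "eventually (\<lambda>n. Y n \<in> {a<..<b}) sequentially"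
    using topological_tendstoD[OF Y(2), of "{a<..<b}"] s by simp
  then obtain N where N: "\<And>n. n \<ge> N \<Longrightarrow> Y n \<in> {a<..<b}"
    unfolding eventually_sequentially by auto
  \<comment> \<open>Only terms of \<open>Y\<close> inside the interval are controlled, so finitely
    many are dropped; \<open>LIMSEQ_offset\<close> restores them at the end.\<close>
  define Z where "Z n = Y (n + N)" for n
  have Z: "Z n \<in> {a<..<b}" "Z n \<noteq> s" for n
    using N[of "n+N"] Y(1) by (auto simp: Z_def)
  have Zlim: "Z \<longlonglongrightarrow> s" unfolding Z_def using Y(2) by (rule LIMSEQ_ignore_initial_segment)
  have "(\<lambda>n. \<integral>x. (f (Z n) x - f s x) / (Z n - s) \<partial>M) \<longlonglongrightarrow> (\<integral>x. f' s x \<partial>M)"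
  proof (rule integral_dominated_convergence[where w=w])
    show "AE x in M. (\<lambda>n. (f (Z n) x - f s x) / (Z n - s)) \<longlonglongrightarrow> f' s x"
    proof (rule AE_I2)
      fix x assume x: "x \<in> space M"
      have "((\<lambda>y. (f y x - f s x) / (y - s)) \<longlongrightarrow> f' s x) (at s)"
        using deriv[OF s x] unfolding has_field_derivative_iff .
      moreover have "filterlim Z (at s) sequentially"
        using Zlim Z(2) by (simp add: filterlim_at)
      ultimately show "(\<lambda>n. (f (Z n) x - f s x) / (Z n - s)) \<longlonglongrightarrow> f' s x"
        by (rule filterlim_compose)
    qed
    show "AE x in M. norm ((f (Z n) x - f s x) / (Z n - s)) \<le> w x" for n
    proof (rule AE_I2)
      fix x assume x: "x \<in> space M"
      \<comment> \<open>Mean value inequality: the bound on the derivative over the interval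
        dominates every difference quotient.\<close>
      have "norm (f (Z n) x - f s x) \<le> w x * norm (Z n - s)"
        by (rule field_differentiable_bound[of "{a<..<b}" "\<lambda>t. f t x" "\<lambda>t. f' t x"])
           (use deriv x bound s Z in \<open>auto intro: has_field_derivative_at_within\<close>)
      then show "norm ((f (Z n) x - f s x) / (Z n - s)) \<le> w x"
        using Z(2)[of n] by (simp add: field_simps)
    qed
    show "(\<lambda>x. (f (Z n) x - f s x) / (Z n - s)) \<in> borel_measurable M" for n
      using f[OF Z(1)[of n]] f[OF s] by measurable
  qed (use f' w in auto)
  moreover have "(\<integral>x. (f (Z n) x - f s x) / (Z n - s) \<partial>M) =
      ((\<lambda>y. ((\<integral>x. f y x \<partial>M) - (\<integral>x. f s x \<partial>M)) / (y - s)) \<circ> Y) (n + N)" for n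
    using f[OF Z(1)[of n]] f[OF s] by (simp add: Z_def)
  ultimately have "(\<lambda>n. ((\<lambda>y. ((\<integral>x. f y x \<partial>M) - (\<integral>x. f s x \<partial>M)) / (y - s)) \<circ> Y) (n + N))
      \<longlonglongrightarrow> (\<integral>x. f' s x \<partial>M)" by simp
  then show "((\<lambda>y. ((\<integral>x. f y x \<partial>M) - (\<integral>x. f s x \<partial>M)) / (y - s)) \<circ> Y) \<longlonglongrightarrow> (\<integral>x. f' s x \<partial>M)"
    by (rule LIMSEQ_offset)
qed

section \<open>Polar coordinates in the plane and the substitution leading to incomplete Beta
  integrals\<close>

lemma emeasure_cball_real2: "0 \<le> r \<Longrightarrow> emeasure lborel (cball (c::real^2) r) = ennreal (pi * r\<^sup>2)"
  using emeasure_cball[of r c] by (simp add: unit_ball_vol_2)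

text \<open>Half-lines \<open>{..a}\<close> generate the Borel sets, and the disc area pi a^2 is the
  integral of 2 pi r up to \<open>a\<close>; no angular variable is needed.\<close>

lemma distr_norm_real2:
  "distr lborel borel (norm :: real^2 \<Rightarrow> real) = density lborel (\<lambda>r. ennreal (2 * pi * r * indicator {0..} r))"
    (is "?A = ?B")
proof (rule measure_eqI_generator_eq[where E="range (\<lambda>a::real. {..a})" and \<Omega>=UNIV and A="\<lambda>n. {..real n}"])
  show "Int_stable (range (\<lambda>a::real. {..a}))" by (auto simp: Int_stable_def)
  have *: "emeasure ?A {..a} = emeasure ?B {..a}" for a
  proof (cases "a \<ge> 0")
    case True
    have 1: "norm -` {..a} = cball (0::real^2) a" by auto
    have "emeasure ?B {..a} = (\<integral>\<^sup>+r. ennreal (2 * pi * r) * indicator {0..a} r \<partial>lborel)"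
      by (subst emeasure_density) (auto intro!: nn_integral_cong simp: indicator_def)
    also have "\<dots> = ennreal (pi * a\<^sup>2 - pi * 0\<^sup>2)"
      by (rule nn_integral_FTC_Icc) (use True in \<open>auto intro!: derivative_eq_intros\<close>)
    finally have "emeasure ?B {..a} = ennreal (pi * a\<^sup>2)" by simp
    moreover have "emeasure ?A {..a} = emeasure lborel (cball (0::real^2) a)"
      by (subst emeasure_distr) (simp_all add: 1)
    ultimately show ?thesis using True by (simp add: emeasure_cball_real2)
  next
    case False
    have "\<not> norm x \<le> a" for x :: "real^2"
      using False norm_ge_zero[of x] by linarith
    then have "norm -` {..a} = ({}::(real^2) set)" by auto
    moreover have "emeasure ?B {..a} = 0"
      using False by (auto simp: emeasure_density nn_integral_0_iff_AE indicator_def)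
    ultimately show ?thesis by (simp add: emeasure_distr)
  qed
  then show "\<And>X. X \<in> range (\<lambda>a. {..a}) \<Longrightarrow> emeasure ?A X = emeasure ?B X" by blast
  show "emeasure ?A {..real i} \<noteq> \<infinity>" for i
  proof -
    have "norm -` {..real i} = cball (0::real^2) (real i)" by auto
    then show ?thesis by (simp add: emeasure_distr emeasure_cball_real2)
  qed
  show "(\<Union>i. {..real i}) = UNIV" by (auto simp: real_arch_simple)
qed (auto simp: borel_eq_atMost image_def)

lemma set_integrable_powr_at_top:
  fixes e c :: real
  assumes "e < -1" "0 < c"
  shows "set_integrable lborel {c<..} (\<lambda>x. x powr e)"
proof -
  have "(\<lambda>x. x powr e) integrable_on {c..}"
    using has_integral_powr_to_inf[OF assms] by blast
  then have "(\<lambda>x. x powr e) absolutely_integrable_on {c..}"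
    by (rule nonnegative_absolutely_integrable_1) auto
  then have "set_integrable lborel {c..} (\<lambda>x. x powr e)"
    unfolding set_integrable_def by (subst (asm) integrable_completion) auto
  then show ?thesis by (rule set_integrable_subset) auto
qed

text \<open>With \<open>t = 1 / (1 + y)\<close> one has \<open>1 - t = y / (1 + y)\<close>, and
  \<open>y powr (- (2 / \<alpha>))\<close> equals \<open>u powr (- (2 / \<alpha>))\<close> times the
  square of \<open>x\<close>. This produces the weight \<open>x\<close> of polar coordinates and the
  shifts by \<open>2 / \<alpha>\<close>. The choice \<open>a = i\<close>, \<open>b = \<psi>\<close>
  serves the Laplace exponent, \<open>a = j\<close>, \<open>b = \<psi> + j\<close> its
  derivatives.\<close>

lemma beta_substitution:
  fixes \<alpha> u c :: real and a b :: nat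
  assumes \<alpha>: "2 < \<alpha>" and u: "0 < u" and c: "0 < c" and ab: "1 \<le> a" "a \<le> b"
  defines "y \<equiv> \<lambda>x. u * x powr - \<alpha>"
  shows "set_integrable lborel {c<..} (\<lambda>x. x * (y x ^ a / (1 + y x) ^ b))"
    and "(LBINT x:{c<..}. x * (y x ^ a / (1 + y x) ^ b)) =
      1 / \<alpha> * u powr (2 / \<alpha>) * cinc_beta (real b - real a + 2 / \<alpha>) (real a - 2 / \<alpha>) (1 / (1 + y c))"
proof -
  define p where "p = real b - real a + 2 / \<alpha>"
  define q where "q = real a - 2 / \<alpha>"
  define g where "g x = 1 / (1 + y x)" for x
  define g' where "g' x = \<alpha> * y x / x / (1 + y x)\<^sup>2" for x
  define f where "f t = t powr (p - 1) * (1 - t) powr (q - 1)" for t :: real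
  have ypos: "y x > 0" if "x > 0" for x using u that by (simp add: y_def)
  have yc: "y x \<le> y c" if "x > c" for x
    unfolding y_def using u c \<alpha> that by (intro mult_left_mono powr_mono2') auto
  have ynn: "y x \<ge> 0" for x using u by (simp add: y_def)
  have key: "f (g x) * g' x = \<alpha> * u powr (- (2/\<alpha>)) * (x * (y x ^ a / (1 + y x) ^ b))" if x: "x > 0" for x
  proof -
    note yp = ypos[OF x]
    have 1: "1 - g x = y x / (1 + y x)" using yp by (simp add: g_def field_simps)
    have 2: "f (g x) = (1 + y x) powr (1 - p) * (y x powr (q - 1) * (1 + y x) powr (1 - q))"
    proof -
      have "(1 + y x) powr (1 - p) = 1 / (1 + y x) powr (p - 1)"
        "(1 + y x) powr (1 - q) = 1 / (1 + y x) powr (q - 1)"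
        by (simp_all add: powr_minus_divide[symmetric])
      then show ?thesis using yp unfolding f_def 1 by (simp add: g_def powr_divide)
    qed
    have 3: "(1 + y x)\<^sup>2 = (1 + y x) powr 2" using yp by simp
    \<comment> \<open>The exponent \<open>q = a - 2 / \<alpha>\<close> splits into an integer power
      of \<open>y\<close> and a factor that yields \<open>x\<^sup>2\<close>; the division by
      \<open>x\<close> in \<open>g'\<close> cancels one of the two.\<close>
    have 4: "y x powr q = y x ^ a * (u powr (- (2/\<alpha>)) * x\<^sup>2)"
    proof -
      have "y x powr q = y x powr real a * y x powr (- (2/\<alpha>))"
        by (simp add: q_def powr_add[symmetric])
      also have "y x powr (- (2/\<alpha>)) = u powr (- (2/\<alpha>)) * x powr 2"
        unfolding y_def using u x \<alpha> by (simp add: powr_mult powr_powr)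
      finally show ?thesis using yp x by (simp add: powr_realpow)
    qed
    have "f (g x) * g' x = \<alpha> / x * (y x powr (q - 1) * y x powr 1) *
        ((1 + y x) powr (1 - p) * (1 + y x) powr (1 - q) * (1 + y x) powr (- 2))"
      using yp unfolding 2 g'_def 3 by (simp add: powr_minus_divide)
    also have "y x powr (q - 1) * y x powr 1 = y x powr q"
      by (simp only: powr_add[symmetric]) simp
    also have "(1 + y x) powr (1 - p) * (1 + y x) powr (1 - q) * (1 + y x) powr (- 2) =
        (1 + y x) powr (- real b)"
      by (simp add: powr_add[symmetric] p_def q_def)
    also have "(1 + y x) powr (- real b) = 1 / (1 + y x) ^ b"
      using yp by (simp add: powr_minus_divide powr_realpow)
    finally show ?thesis using x unfolding 4 by (simp add: power2_eq_square)
  qed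
  have int1: "set_integrable lborel {c<..} (\<lambda>x. x * (y x ^ a / (1 + y x) ^ b))"
  proof (rule set_integrable_bound)
    show "set_integrable lborel {c<..} (\<lambda>x. (y c ^ (a - 1) * u) * x powr (1 - \<alpha>))"
      by (intro set_integrable_mult_right set_integrable_powr_at_top) (use \<alpha> c in auto)
    show "set_borel_measurable lborel {c<..} (\<lambda>x. x * (y x ^ a / (1 + y x) ^ b))"
      unfolding set_borel_measurable_def y_def by measurable
    show "AE x in lborel. x \<in> {c<..} \<longrightarrow>
        norm (x * (y x ^ a / (1 + y x) ^ b)) \<le> norm ((y c ^ (a - 1) * u) * x powr (1 - \<alpha>))"
    proof (intro AE_I2 impI)
      fix x assume "x \<in> {c<..}"
      then have x: "x > 0" "x > c" using c by auto
      \<comment> \<open>Beyond \<open>c\<close> all but one of the powers of \<open>y\<close> are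
        bounded by powers of \<open>y c\<close>; the remaining one leaves
        \<open>x powr (1 - \<alpha>)\<close>, integrable at infinity since \<open>\<alpha>\<close>
        exceeds 2.\<close>
      have "y x ^ a / (1 + y x) ^ b \<le> y x ^ a"
        using ynn[of x] by (simp add: divide_le_eq mult_le_cancel_left1)
      also have "y x ^ a = y x ^ (a - 1) * y x"
        using ab by (cases a) auto
      also have "\<dots> \<le> y c ^ (a - 1) * y x"
        using yc[OF x(2)] ynn by (intro mult_right_mono power_mono) auto
      finally have "x * (y x ^ a / (1 + y x) ^ b) \<le> x * (y c ^ (a - 1) * y x)"
        using x by (intro mult_left_mono) auto
      also have "\<dots> = (y c ^ (a - 1) * u) * x powr (1 - \<alpha>)"
        using x by (simp add: y_def powr_diff powr_minus_divide field_simps)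
      finally show "norm (x * (y x ^ a / (1 + y x) ^ b)) \<le> norm ((y c ^ (a - 1) * u) * x powr (1 - \<alpha>))"
        using x ynn[of x] by simp
    qed
  qed
  then show "set_integrable lborel {c<..} (\<lambda>x. x * (y x ^ a / (1 + y x) ^ b))" .
  have ei: "einterval (ereal c) \<infinity> = {c<..}" by (auto simp: einterval_def)
  have gpos: "0 < g x" "g x < 1" if "x > 0" for x using ypos[OF that] by (auto simp: g_def)
  \<comment> \<open>As \<open>x\<close> runs from \<open>c\<close> to infinity, \<open>g\<close>
    increases from \<open>g c\<close> to 1, so an unbounded range becomes a bounded one with the
    same orientation.\<close>
  have sub: "interval_lebesgue_integral lborel (ereal (g c)) 1 f = (LBINT x=ereal c..\<infinity>. f (g x) * g' x)"
  proof (rule interval_integral_substitution_nonneg(2))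
    show "ereal c < \<infinity>" by simp
    fix x
    show "(g has_real_derivative g' x) (at x)" if "ereal c < ereal x" "ereal x < \<infinity>"
    proof -
      have x: "x > 0" using that c by simp
      have nz: "1 + u * x powr - \<alpha> \<noteq> 0" using ypos[OF x] unfolding y_def by linarith
      then show ?thesis using x u \<alpha> unfolding g_def[abs_def] g'_def y_def
        by (auto intro!: derivative_eq_intros simp: powr_diff power2_eq_square field_simps)
    qed
    show "isCont f (g x)" if "ereal c < ereal x" "ereal x < \<infinity>"
      unfolding f_def using gpos[of x] that c by (auto intro!: continuous_intros)
    show "isCont g' x" if "ereal c < ereal x" "ereal x < \<infinity>"
    proof -
      have x: "x > 0" using that c by simp
      have "1 + u * x powr - \<alpha> \<noteq> 0" using ypos[OF x] unfolding y_def by linarith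
      then show ?thesis using x u unfolding g'_def y_def by (auto intro!: continuous_intros)
    qed
    show "0 \<le> f (g x)" if "ereal c < ereal x" "ereal x < \<infinity>"
      by (simp add: f_def)
    show "0 \<le> g' x" if "ereal c \<le> ereal x" "ereal x \<le> \<infinity>"
      using that c \<alpha> ynn[of x] by (simp add: g'_def)
  next
    have "isCont g c" unfolding g_def y_def using c ypos[OF c] by (auto intro!: continuous_intros simp: y_def)
    then have "(g \<longlongrightarrow> g c) (at_right c)"
      using isCont_def tendsto_within_subset by blast
    then show "((ereal \<circ> g \<circ> real_of_ereal) \<longlongrightarrow> ereal (g c)) (at_right (ereal c))"
      by (simp add: ereal_tendsto_simps)
    have "((\<lambda>x. x powr - \<alpha>) \<longlongrightarrow> 0) at_top" using \<alpha> by (intro tendsto_neg_powr filterlim_ident) auto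
    then have "(g \<longlongrightarrow> 1 / (1 + u * 0)) at_top"
      unfolding g_def y_def by (intro tendsto_intros) auto
    then show "((ereal \<circ> g \<circ> real_of_ereal) \<longlongrightarrow> 1) (at_left \<infinity>)"
      by (simp add: ereal_tendsto_simps one_ereal_def)
    have "set_integrable lborel {c<..} (\<lambda>x. \<alpha> * u powr (- (2/\<alpha>)) * (x * (y x ^ a / (1 + y x) ^ b)))"
      using int1 by (rule set_integrable_mult_right)
    then show "set_integrable lborel (einterval (ereal c) \<infinity>) (\<lambda>x. f (g x) * g' x)"
      unfolding ei by (rule set_integrable_cong[THEN iffD1, rotated -1]) (use key c in auto)
  qed
  have "cinc_beta p q (g c) = (LBINT t:{g c..1}. f t)"
    by (simp add: cinc_beta_def f_def)
  also have "\<dots> = (LBINT t=ereal (g c)..1. f t)"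
    using gpos[OF c] by (subst one_ereal_def, subst interval_integral_Icc) auto
  also have "\<dots> = (LBINT x:{c<..}. f (g x) * g' x)"
    unfolding sub by (simp add: interval_lebesgue_integral_def ei)
  also have "\<dots> = (LBINT x:{c<..}. \<alpha> * u powr (- (2/\<alpha>)) * (x * (y x ^ a / (1 + y x) ^ b)))"
    by (rule set_lebesgue_integral_cong) (use key c in auto)
  also have "\<dots> = \<alpha> * u powr (- (2/\<alpha>)) * (LBINT x:{c<..}. x * (y x ^ a / (1 + y x) ^ b))"
    by (rule set_integral_mult_right)
  finally show "(LBINT x:{c<..}. x * (y x ^ a / (1 + y x) ^ b)) =
      1 / \<alpha> * u powr (2 / \<alpha>) * cinc_beta (real b - real a + 2 / \<alpha>) (real a - 2 / \<alpha>) (1 / (1 + y c))"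
    using \<alpha> u by (simp add: p_def q_def g_def powr_minus_divide)
qed

section \<open>Bell polynomials and derivatives of exponentials\<close>

text \<open>The complete Bell polynomials, by the recursion that Leibniz' rule gives for the derivatives
  of \<open>exp \<circ> V\<close>.\<close>

fun bell :: "(nat \<Rightarrow> real) \<Rightarrow> nat \<Rightarrow> real" where
  "bell v 0 = 1"
| "bell v (Suc k) = (\<Sum>m\<le>k. real (k choose m) * v (Suc m) * bell v (k - m))"

declare bell.simps(2) [simp del]

text \<open>The subtracted term is what an exponential factor \<open>F\<close> with logarithmic
  derivative \<open>v 1\<close> contributes, so that \<open>F\<close> times the \<open>k\<close>-th
  polynomial differentiates to \<open>F\<close> times the next one. The induction is strong because
  the recursion reaches back to all smaller indices; Pascal's rule merges the two sums that the
  product rule creates.\<close>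

lemma bell_has_derivative:
  fixes v :: "nat \<Rightarrow> real \<Rightarrow> real"
  assumes "\<And>j. 1 \<le> j \<Longrightarrow> (v j has_real_derivative v (Suc j) s) (at s)"
  shows "((\<lambda>s. bell (\<lambda>j. v j s) k) has_real_derivative
    bell (\<lambda>j. v j s) (Suc k) - v 1 s * bell (\<lambda>j. v j s) k) (at s)"
proof (induction k rule: less_induct)
  case (less k)
  let ?Y = "bell (\<lambda>j. v j s)"
  show ?case
  proof (cases k)
    case 0
    then show ?thesis by (simp add: bell.simps)
  next
    case (Suc n)
    have "((\<lambda>s. \<Sum>m\<le>n. real (n choose m) * v (Suc m) s * bell (\<lambda>j. v j s) (n - m)) has_real_derivative
        (\<Sum>m\<le>n. real (n choose m) * v (Suc m) s * (?Y (Suc (n - m)) - v 1 s * ?Y (n - m)) +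
           real (n choose m) * v (Suc (Suc m)) s * ?Y (n - m))) (at s)"
    proof (rule DERIV_sum)
      fix m assume "m \<in> {..n}"
      then have "n - m < k" using Suc by simp
      from DERIV_mult[OF DERIV_cmult[OF assms, of "Suc m" "real (n choose m)"] less.IH[OF this]]
      show "((\<lambda>s. real (n choose m) * v (Suc m) s * bell (\<lambda>j. v j s) (n - m)) has_real_derivative
        real (n choose m) * v (Suc m) s * (?Y (Suc (n - m)) - v 1 s * ?Y (n - m)) +
           real (n choose m) * v (Suc (Suc m)) s * ?Y (n - m)) (at s)"
        by (simp add: algebra_simps)
    qed
    moreover have "(\<Sum>m\<le>n. real (n choose m) * v (Suc m) s * (?Y (Suc (n - m)) - v 1 s * ?Y (n - m)) +
           real (n choose m) * v (Suc (Suc m)) s * ?Y (n - m)) =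
        ((\<Sum>m\<le>n. real (n choose m) * v (Suc m) s * ?Y (Suc n - m)) +
         (\<Sum>m\<le>n. real (n choose m) * v (Suc (Suc m)) s * ?Y (n - m))) - v 1 s * ?Y (Suc n)"
      by (simp add: bell.simps(2) sum.distrib sum_distrib_left sum_subtractf algebra_simps Suc_diff_le)
    moreover have "(\<Sum>m\<le>n. real (n choose m) * v (Suc m) s * ?Y (Suc n - m)) +
         (\<Sum>m\<le>n. real (n choose m) * v (Suc (Suc m)) s * ?Y (n - m)) = ?Y (Suc (Suc n))"
    proof -
      have "?Y (Suc (Suc n)) = v 1 s * ?Y (Suc n) +
          (\<Sum>m\<le>n. real (Suc n choose Suc m) * v (Suc (Suc m)) s * ?Y (n - m))"
        unfolding bell.simps(2)[of _ "Suc n"] by (subst sum.atMost_Suc_shift) simp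
      also have "(\<Sum>m\<le>n. real (Suc n choose Suc m) * v (Suc (Suc m)) s * ?Y (n - m)) =
          (\<Sum>m\<le>n. real (n choose m) * v (Suc (Suc m)) s * ?Y (n - m)) +
          (\<Sum>m\<le>n. real (n choose Suc m) * v (Suc (Suc m)) s * ?Y (n - m))"
        by (simp add: sum.distrib[symmetric] algebra_simps)
      also have "v 1 s * ?Y (Suc n) + (\<dots>) = (v 1 s * ?Y (Suc n) +
          (\<Sum>m\<le>n. real (n choose Suc m) * v (Suc (Suc m)) s * ?Y (n - m))) +
          (\<Sum>m\<le>n. real (n choose m) * v (Suc (Suc m)) s * ?Y (n - m))" by simp
      also have "v 1 s * ?Y (Suc n) + (\<Sum>m\<le>n. real (n choose Suc m) * v (Suc (Suc m)) s * ?Y (n - m)) =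
          (\<Sum>m\<le>Suc n. real (n choose m) * v (Suc m) s * ?Y (Suc n - m))"
        by (subst sum.atMost_Suc_shift) simp
      finally show ?thesis by simp
    qed
    ultimately show ?thesis
      unfolding Suc bell.simps(2)[of _ n] by simp
  qed
qed

text \<open>Formula and differentiability are proved together and on the whole open set:
  differentiating once more needs the formula in a neighbourhood of \<open>s\<close>. Only the
  logarithmic derivative of \<open>F\<close> enters.\<close>

lemma deriv_pow_exp_eq_bell:
  fixes F :: "real \<Rightarrow> real" and v :: "nat \<Rightarrow> real \<Rightarrow> real"
  assumes S: "open S" and s: "s \<in> S"
    and F: "\<And>s. s \<in> S \<Longrightarrow> (F has_real_derivative v 1 s * F s) (at s)"
    and v: "\<And>j s. 1 \<le> j \<Longrightarrow> s \<in> S \<Longrightarrow> (v j has_real_derivative v (Suc j) s) (at s)"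
  shows "(deriv ^^ k) F s = F s * bell (\<lambda>j. v j s) k"
    and "((deriv ^^ k) F has_real_derivative (deriv ^^ Suc k) F s) (at s)"
proof -
  have *: "\<forall>s\<in>S. (deriv ^^ k) F s = F s * bell (\<lambda>j. v j s) k \<and>
    ((deriv ^^ k) F has_real_derivative F s * bell (\<lambda>j. v j s) (Suc k)) (at s)" for k
  proof (induction k)
    case 0
    have [simp]: "bell (\<lambda>j. v j s) (Suc 0) = v 1 s" for s by (simp add: bell.simps)
    show ?case using F by (auto simp: mult.commute)
  next
    case (Suc k)
    have 1: "(deriv ^^ Suc k) F s = F s * bell (\<lambda>j. v j s) (Suc k)" if "s \<in> S" for s
      using Suc that by (auto intro: DERIV_imp_deriv)
    have "((deriv ^^ Suc k) F has_real_derivative F s * bell (\<lambda>j. v j s) (Suc (Suc k))) (at s)"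
      if s: "s \<in> S" for s
    proof (rule has_field_derivative_transform_within_open[OF _ S s])
      show "((\<lambda>s. F s * bell (\<lambda>j. v j s) (Suc k)) has_real_derivative
          F s * bell (\<lambda>j. v j s) (Suc (Suc k))) (at s)"
        by (rule DERIV_cong[OF DERIV_mult[OF F[OF s] bell_has_derivative]])
           (use v s in \<open>auto simp: algebra_simps\<close>)
    qed (use 1 in auto)
    with 1 show ?case by blast
  qed
  show "(deriv ^^ k) F s = F s * bell (\<lambda>j. v j s) k" using * s by blast
  show "((deriv ^^ k) F has_real_derivative (deriv ^^ Suc k) F s) (at s)"
    using *[of k] *[of "Suc k"] s by auto
qed

section \<open>The Bell polynomials as explicit sums over multi-indices\<close>

definition bell_term :: "(nat \<Rightarrow> real) \<Rightarrow> nat \<Rightarrow> (nat \<Rightarrow> nat) \<Rightarrow> real" where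
  "bell_term v K i = (\<Prod>j=1..K. (v j / fact j) ^ i j / fact (i j))"

text \<open>The largest block size \<open>K\<close> is kept apart from the weight \<open>k\<close>:
  removing a block lowers the weight, while the domain of the multi-indices has to stay
  fixed.\<close>

definition weight_indices :: "nat \<Rightarrow> nat \<Rightarrow> (nat \<Rightarrow> nat) set" where
  "weight_indices K k = {i \<in> {1..K} \<rightarrow>\<^sub>E UNIV. (\<Sum>j=1..K. j * i j) = k}"

lemma finite_weight_indices: "finite (weight_indices K k)"
proof (rule finite_subset)
  show "weight_indices K k \<subseteq> {1..K} \<rightarrow>\<^sub>E {..k}"
  proof
    fix i assume i: "i \<in> weight_indices K k"
    have "i j \<le> k" if "j \<in> {1..K}" for j
    proof -
      have "i j \<le> j * i j" using that by simp
      also have "\<dots> \<le> (\<Sum>j=1..K. j * i j)" by (rule member_le_sum) (use that in auto)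
      finally show ?thesis using i by (simp add: weight_indices_def)
    qed
    then show "i \<in> {1..K} \<rightarrow>\<^sub>E {..k}" using i by (auto simp: weight_indices_def PiE_iff)
  qed
qed (simp add: finite_PiE)

text \<open>Lowering \<open>i j\<close> by one is a bijection from the multi-indices with
  \<open>i j \<noteq> 0\<close> onto those of weight \<open>k - j\<close>; the factor
  \<open>i j\<close> cancels against the factorial of \<open>i j\<close>, and one factor
  \<open>v j / fact j\<close> comes out.\<close>

lemma sum_bell_term_remove:
  assumes j: "j \<in> {1..K}" and jk: "j \<le> k"
  shows "(\<Sum>i\<in>weight_indices K k. real (i j) * bell_term v K i) =
    v j / fact j * (\<Sum>i\<in>weight_indices K (k - j). bell_term v K i)"
proof -
  have fin: "finite {1..K}" by simp
  have w: "(\<Sum>l=1..K. l * i l) = j * i j + (\<Sum>l\<in>{1..K}-{j}. l * i l)" for i :: "nat \<Rightarrow> nat"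
    by (rule sum.remove[OF fin j])
  have t: "bell_term v K i = (v j / fact j) ^ i j / fact (i j) *
      (\<Prod>l\<in>{1..K}-{j}. (v l / fact l) ^ i l / fact (i l))" for i
    unfolding bell_term_def by (rule prod.remove[OF fin j])
  have "(\<Sum>i\<in>weight_indices K k. real (i j) * bell_term v K i) =
      (\<Sum>i\<in>{i\<in>weight_indices K k. i j \<noteq> 0}. real (i j) * bell_term v K i)"
    by (rule sum.mono_neutral_right) (auto simp: finite_weight_indices)
  also have "\<dots> = (\<Sum>i\<in>weight_indices K (k - j). v j / fact j * bell_term v K i)"
  proof (rule sum.reindex_bij_witness[where i="\<lambda>i. i(j := Suc (i j))" and j="\<lambda>i. i(j := i j - 1)"])
    fix i assume i: "i \<in> {i\<in>weight_indices K k. i j \<noteq> 0}"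
    then obtain m where m: "i j = Suc m" by (cases "i j") auto
    show "(i(j := i j - 1))(j := Suc ((i(j := i j - 1)) j)) = i" using m by auto
    have "(\<Sum>l\<in>{1..K}-{j}. l * (if l = j then m else i l)) = (\<Sum>l\<in>{1..K}-{j}. l * i l)"
      by (rule sum.cong) auto
    then have "(\<Sum>l=1..K. l * (i(j := i j - 1)) l) = k - j"
      using i m w[of i] w[of "i(j := i j - 1)"] by (simp add: weight_indices_def)
    then show "i(j := i j - 1) \<in> weight_indices K (k - j)"
      using i j by (auto simp: weight_indices_def PiE_iff extensional_def)
    have "(\<Prod>l\<in>{1..K}-{j}. (v l / fact l) ^ (if l = j then m else i l) / fact (if l = j then m else i l)) =
      (\<Prod>l\<in>{1..K}-{j}. (v l / fact l) ^ i l / fact (i l))"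
      by (rule prod.cong) auto
    then show "v j / fact j * bell_term v K (i(j := i j - 1)) = real (i j) * bell_term v K i"
      unfolding t using m by (simp del: of_nat_Suc)
  next
    fix i assume i: "i \<in> weight_indices K (k - j)"
    show "(i(j := Suc (i j)))(j := (i(j := Suc (i j))) j - 1) = i" by auto
    have "(\<Sum>l\<in>{1..K}-{j}. l * (if l = j then Suc (i j) else i l)) = (\<Sum>l\<in>{1..K}-{j}. l * i l)"
      by (rule sum.cong) auto
    then have "(\<Sum>l=1..K. l * (i(j := Suc (i j))) l) = k"
      using i jk w[of i] w[of "i(j := Suc (i j))"] by (simp add: weight_indices_def)
    then show "i(j := Suc (i j)) \<in> {i\<in>weight_indices K k. i j \<noteq> 0}"
      using i j by (auto simp: weight_indices_def PiE_iff extensional_def)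
  qed
  finally show ?thesis by (simp add: sum_distrib_left)
qed

text \<open>Multiplying the sum by its weight and expanding the weight as the sum of all
  \<open>j * i j\<close> allows one block to be removed for each \<open>j\<close>. The result is the
  recursion of \<open>bell\<close>, divided by a factorial.\<close>

lemma bell_eq_sum_weight_indices:
  "k \<le> K \<Longrightarrow> bell v k = fact k * (\<Sum>i\<in>weight_indices K k. bell_term v K i)"
proof (induction k rule: less_induct)
  case (less k)
  show ?case
  proof (cases k)
    case 0
    have "weight_indices K 0 = {\<lambda>j\<in>{1..K}. 0}"
      by (auto simp: weight_indices_def PiE_iff extensional_def fun_eq_iff)
    then show ?thesis by (simp add: 0 bell_term_def)
  next
    case (Suc n)
    let ?S = "\<lambda>k. \<Sum>i\<in>weight_indices K k. bell_term v K i"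
    \<comment> \<open>A block larger than the weight cannot occur, so the sum over \<open>j\<close>
      up to \<open>K\<close> stops at \<open>k\<close>.\<close>
    have z: "(\<Sum>i\<in>weight_indices K k. real (i j) * bell_term v K i) = 0" if "j \<in> {1..K} - {1..k}" for j
    proof (rule sum.neutral, rule ballI)
      fix i assume "i \<in> weight_indices K k"
      then have "j * i j \<le> k" using that member_le_sum[of j "{1..K}" "\<lambda>j. j * i j"]
        by (auto simp: weight_indices_def)
      then have "i j = 0" using that by (cases "i j") auto
      then show "real (i j) * bell_term v K i = 0" by simp
    qed
    have "real k * ?S k = (\<Sum>i\<in>weight_indices K k. (\<Sum>j=1..K. real j * real (i j)) * bell_term v K i)"
      unfolding sum_distrib_left by (rule sum.cong) (auto simp: weight_indices_def simp flip: of_nat_mult of_nat_sum)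
    also have "\<dots> = (\<Sum>j=1..K. real j * (\<Sum>i\<in>weight_indices K k. real (i j) * bell_term v K i))"
      unfolding sum_distrib_left sum_distrib_right by (subst sum.swap) (simp add: mult.assoc)
    also have "\<dots> = (\<Sum>j=1..k. real j * (\<Sum>i\<in>weight_indices K k. real (i j) * bell_term v K i))"
      by (rule sum.mono_neutral_right) (use less.prems z in auto)
    also have "\<dots> = (\<Sum>j=1..k. real j * (v j / fact j * ?S (k - j)))"
      by (rule sum.cong) (use less.prems in \<open>auto simp: sum_bell_term_remove\<close>)
    also have "\<dots> = (\<Sum>m\<le>n. v (Suc m) / fact m * ?S (n - m))"
      by (rule sum.reindex_bij_witness[of _ Suc "\<lambda>j. j - 1"]) (auto simp: Suc fact_reduce field_simps)
    also have "\<dots> = (\<Sum>m\<le>n. v (Suc m) / fact m * (bell v (n - m) / fact (n - m)))"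
      by (rule sum.cong) (use less Suc in auto)
    also have "\<dots> = bell v k / fact n"
      unfolding Suc bell.simps(2) sum_divide_distrib
      by (rule sum.cong) (auto simp: binomial_fact field_simps)
    finally show ?thesis by (simp add: Suc field_simps)
  qed
qed

lemma bell_eq_sum_bell_indices:
  assumes "1 \<le> k"
  shows "bell v k = (\<Sum>n=1..k. \<Sum>i\<in>bell_indices k n.
    fact k / (\<Prod>j=1..k. fact j ^ i j * fact (i j)) * (\<Prod>j=1..k. v j ^ i j))"
proof -
  let ?t = "\<lambda>i. fact k / (\<Prod>j=1..k. fact j ^ i j * fact (i j)) * (\<Prod>j=1..k. v j ^ i j)"
  have t: "fact k * bell_term v k i = ?t i" for i
    by (simp add: bell_term_def prod_dividef power_divide prod.distrib)
  have U: "weight_indices k k = (\<Union>n\<in>{1..k}. bell_indices k n)"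
  proof -
    \<comment> \<open>The number of blocks is at most the weight, since every block has size at
      least 1, and it is nonzero because the weight \<open>k\<close> is; hence grouping by
      \<open>n\<close> from 1 to \<open>k\<close> misses nothing.\<close>
    have "(\<Sum>j=1..k. i j) \<in> {1..k}" if "(\<Sum>j=1..k. j * i j) = k" for i :: "nat \<Rightarrow> nat"
    proof -
      have "(\<Sum>j=1..k. i j) \<le> (\<Sum>j=1..k. j * i j)" by (rule sum_mono) auto
      moreover have "(\<Sum>j=1..k. i j) \<noteq> 0"
      proof
        assume "(\<Sum>j=1..k. i j) = 0"
        then have "(\<Sum>j=1..k. j * i j) = 0" by simp
        then show False using that assms by simp
      qed
      ultimately show ?thesis unfolding atLeastAtMost_iff that by arith
    qed
    then show ?thesis by (auto simp: weight_indices_def bell_indices_def)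
  qed
  have "bell v k = (\<Sum>i\<in>weight_indices k k. ?t i)"
    by (subst bell_eq_sum_weight_indices[OF order_refl]) (simp add: sum_distrib_left t)
  also have "\<dots> = (\<Sum>n=1..k. \<Sum>i\<in>bell_indices k n. ?t i)"
    unfolding U
  proof (rule sum.UNION_disjoint)
    show "\<forall>n\<in>{1..k}. finite (bell_indices k n)"
      using finite_weight_indices[of k k] unfolding U by (auto intro: finite_subset)
  qed (auto simp: bell_indices_def)
  finally show ?thesis .
qed

section \<open>The Laplace exponent of the interference\<close>

text \<open>Since \<open>1 / (1 + u) ^ \<psi>\<close> is the Laplace transform of a Gamma mark of
  shape \<open>\<psi>\<close>, this is, up to the factor 2 pi times the density, the Laplace
  exponent of the shot noise of a planar Poisson process restricted to distances beyond
  \<open>c\<close>.\<close>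

definition shot_exponent :: "real \<Rightarrow> nat \<Rightarrow> real \<Rightarrow> real \<Rightarrow> real \<Rightarrow> real" where
  "shot_exponent \<alpha> \<psi> p c s = (LBINT x:{c<..}. x * (1 - 1 / (1 + s * p * x powr - \<alpha>) ^ \<psi>))"

text \<open>Up to sign and the rising factorial of \<open>\<psi>\<close>, this is the
  \<open>j\<close>-th derivative of \<open>shot_exponent\<close> in \<open>s\<close>.\<close>

definition shot_moment :: "real \<Rightarrow> nat \<Rightarrow> real \<Rightarrow> real \<Rightarrow> nat \<Rightarrow> real \<Rightarrow> real" where
  "shot_moment \<alpha> \<psi> p c j s =
    (LBINT x:{c<..}. x * ((p * x powr - \<alpha>) ^ j / (1 + s * p * x powr - \<alpha>) ^ (\<psi> + j)))"

text \<open>Taken at \<open>y = 0\<close> it makes the shot kernel integrable at infinity; with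
  general arguments it yields continuity in the scale \<open>s\<close>. The induction splits off one
  factor at a time.\<close>

lemma one_minus_inverse_power_le:
  fixes y z :: real
  assumes "0 \<le> y" "y \<le> z"
  shows "1 / (1 + y) ^ n - 1 / (1 + z) ^ n \<le> real n * (z - y)"
proof (induction n)
  case (Suc n)
  have "1 / (1 + y) ^ Suc n - 1 / (1 + z) ^ Suc n =
      (1 / (1 + y) ^ n - 1 / (1 + z) ^ n) * (1 / (1 + y)) + 1 / (1 + z) ^ n * (1 / (1 + y) - 1 / (1 + z))"
    using assms by (simp add: algebra_simps)
  also have "\<dots> \<le> real n * (z - y) * 1 + 1 * (z - y)"
  proof (intro add_mono mult_mono Suc)
    have "1 / (1 + y) - 1 / (1 + z) = (z - y) / ((1 + y) * (1 + z))"
      using assms by (simp add: field_simps)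
    also have "\<dots> \<le> z - y"
    proof -
      have "1 * 1 \<le> (1 + y) * (1 + z)" using assms by (intro mult_mono) auto
      then show ?thesis using assms by (simp add: divide_le_eq mult_le_cancel_left1)
    qed
    finally show "1 / (1 + y) - 1 / (1 + z) \<le> z - y" .
    show "0 \<le> 1 / (1 + y) - 1 / (1 + z)" using assms by (simp add: frac_le)
  qed (use assms in auto)
  finally show ?case by (simp add: algebra_simps)
qed simp

lemma inverse_power_mono:
  fixes y z :: real
  assumes "0 \<le> y" "y \<le> z"
  shows "1 / (1 + z) ^ n \<le> 1 / (1 + y) ^ n"
  using assms by (intro divide_left_mono power_mono mult_pos_pos zero_less_power) auto

lemma DERIV_inverse_power_affine:
  fixes y t :: real
  assumes "1 + t * y \<noteq> 0"
  shows "((\<lambda>t. 1 / (1 + t * y) ^ n) has_real_derivative - (real n * (y / (1 + t * y) ^ Suc n))) (at t)"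
proof -
  have "((\<lambda>t. inverse (1 + t * y)) has_real_derivative - (inverse (1 + t * y) * y * inverse (1 + t * y))) (at t)"
    by (rule DERIV_inverse') (use assms in \<open>auto intro!: derivative_eq_intros\<close>)
  from DERIV_power[OF this, of n]
  have "((\<lambda>t. inverse (1 + t * y) ^ n) has_real_derivative
    real n * (- (inverse (1 + t * y) * y * inverse (1 + t * y)) * inverse (1 + t * y) ^ (n - Suc 0))) (at t)" .
  moreover have "real n * (- (inverse (1 + t * y) * y * inverse (1 + t * y)) * inverse (1 + t * y) ^ (n - Suc 0)) =
    - (real n * (y / (1 + t * y) ^ Suc n))"
    by (cases n) (simp_all add: divide_inverse power_inverse)
  moreover have "inverse (1 + t * y) ^ n = 1 / (1 + t * y) ^ n" for t
    by (simp add: divide_inverse power_inverse)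
  ultimately show ?thesis by (simp only:)
qed

section \<open>The exponent of a single tier: integrability, closed forms, derivatives,
  continuity\<close>

context
  fixes \<alpha> p :: real and \<psi> :: nat
  assumes \<alpha>: "2 < \<alpha>" and p: "0 < p"
begin

lemma integrable_shot_kernel:
  assumes "0 < c" "0 \<le> s"
  shows "set_integrable lborel {c<..} (\<lambda>x. x * (1 - 1 / (1 + s * p * x powr - \<alpha>) ^ \<psi>))"
proof (rule set_integrable_bound)
  show "set_integrable lborel {c<..} (\<lambda>x. (real \<psi> * (s * p)) * x powr (1 - \<alpha>))"
    by (intro set_integrable_mult_right set_integrable_powr_at_top) (use \<alpha> assms in auto)
  show "set_borel_measurable lborel {c<..} (\<lambda>x. x * (1 - 1 / (1 + s * p * x powr - \<alpha>) ^ \<psi>))"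
    unfolding set_borel_measurable_def by measurable
  show "AE x in lborel. x \<in> {c<..} \<longrightarrow>
        norm (x * (1 - 1 / (1 + s * p * x powr - \<alpha>) ^ \<psi>)) \<le> norm ((real \<psi> * (s * p)) * x powr (1 - \<alpha>))"
  proof (intro AE_I2 impI)
    fix x assume "x \<in> {c<..}"
    then have x: "x > 0" using assms by auto
    have "1 - 1 / (1 + s * p * x powr - \<alpha>) ^ \<psi> \<le> real \<psi> * (s * p * x powr - \<alpha>)"
      using one_minus_inverse_power_le[of 0 "s * p * x powr - \<alpha>" \<psi>] assms p by simp
    then have "x * (1 - 1 / (1 + s * p * x powr - \<alpha>) ^ \<psi>) \<le> x * (real \<psi> * (s * p * x powr - \<alpha>))"
      using x by simp
    also have "\<dots> = (real \<psi> * (s * p)) * x powr (1 - \<alpha>)"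
      using x by (simp add: powr_diff powr_minus_divide)
    finally show "norm (x * (1 - 1 / (1 + s * p * x powr - \<alpha>) ^ \<psi>)) \<le> norm ((real \<psi> * (s * p)) * x powr (1 - \<alpha>))"
      using x p assms inverse_power_mono[of 0 "s * p * x powr - \<alpha>" \<psi>] by (simp add: abs_mult)
  qed
qed

lemma shot_exponent_nonneg:
  assumes "0 < c" "0 \<le> s"
  shows "0 \<le> shot_exponent \<alpha> \<psi> p c s"
  unfolding shot_exponent_def set_lebesgue_integral_def
proof (rule integral_nonneg_AE, rule AE_I2)
  fix x
  show "0 \<le> indicat_real {c<..} x *\<^sub>R (x * (1 - 1 / (1 + s * p * x powr - \<alpha>) ^ \<psi>))"
    using inverse_power_mono[of 0 "s * p * x powr - \<alpha>" \<psi>] assms p by (auto simp: indicator_def)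
qed

lemma shot_moment_closed_form:
  assumes "0 < c" "0 < s" "1 \<le> j"
  shows "s ^ j * shot_moment \<alpha> \<psi> p c j s = 1 / \<alpha> * (s * p) powr (2 / \<alpha>) *
    cinc_beta (real \<psi> + 2 / \<alpha>) (real j - 2 / \<alpha>) (1 / (1 + s * p * c powr - \<alpha>))"
    and "set_integrable lborel {c<..} (\<lambda>x. x * ((p * x powr - \<alpha>) ^ j / (1 + s * p * x powr - \<alpha>) ^ (\<psi> + j)))"
proof -
  note b = beta_substitution[OF \<alpha> mult_pos_pos[OF assms(2) p] assms(1,3), of "\<psi> + j"]
  have eq: "x * ((s * p * x powr - \<alpha>) ^ j / (1 + s * p * x powr - \<alpha>) ^ (\<psi> + j)) =
      s ^ j * (x * ((p * x powr - \<alpha>) ^ j / (1 + s * p * x powr - \<alpha>) ^ (\<psi> + j)))" for x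
    by (simp add: power_mult_distrib)
  show "set_integrable lborel {c<..} (\<lambda>x. x * ((p * x powr - \<alpha>) ^ j / (1 + s * p * x powr - \<alpha>) ^ (\<psi> + j)))"
    using set_integrable_mult_right[OF b(1)[unfolded eq], of "1 / s ^ j"] assms(2)
    by (simp add: field_simps)
  show "s ^ j * shot_moment \<alpha> \<psi> p c j s = 1 / \<alpha> * (s * p) powr (2 / \<alpha>) *
    cinc_beta (real \<psi> + 2 / \<alpha>) (real j - 2 / \<alpha>) (1 / (1 + s * p * c powr - \<alpha>))"
    using b(2) unfolding eq shot_moment_def set_integral_mult_right by simp
qed

text \<open>Over the common denominator \<open>(1 + y) ^ \<psi>\<close> the numerator is the
  binomial expansion of \<open>(1 + y) ^ \<psi> - 1\<close>, whose sum starts at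
  \<open>i = 1\<close>; each summand is one instance of the Beta substitution.\<close>

lemma shot_exponent_closed_form:
  assumes "0 < c" "0 < s"
  shows "shot_exponent \<alpha> \<psi> p c s = 1 / \<alpha> * (s * p) powr (2 / \<alpha>) *
    (\<Sum>i=1..\<psi>. real (\<psi> choose i) * cinc_beta (real \<psi> - real i + 2 / \<alpha>) (real i - 2 / \<alpha>) (1 / (1 + s * p * c powr - \<alpha>)))"
proof -
  note b = beta_substitution[OF \<alpha> mult_pos_pos[OF assms(2) p] assms(1)]
  have eq: "x * (1 - 1 / (1 + y) ^ \<psi>) = (\<Sum>i=1..\<psi>. real (\<psi> choose i) * (x * (y ^ i / (1 + y) ^ \<psi>)))"
    if "y \<ge> 0" for x y :: real
  proof -
    have "(y + 1) ^ \<psi> = (\<Sum>i\<le>\<psi>. real (\<psi> choose i) * y ^ i)"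
      by (simp add: binomial_ring)
    also have "\<dots> = 1 + (\<Sum>i=1..\<psi>. real (\<psi> choose i) * y ^ i)"
      by (simp add: sum.atMost_shift sum.atLeast1_atMost_eq)
    finally have "(1 + y) ^ \<psi> - 1 = (\<Sum>i=1..\<psi>. real (\<psi> choose i) * y ^ i)" by (simp add: add.commute)
    moreover have "x * (1 - 1 / (1 + y) ^ \<psi>) = x * ((1 + y) ^ \<psi> - 1) / (1 + y) ^ \<psi>"
      using that by (simp add: field_simps)
    ultimately show ?thesis
      by (simp add: sum_distrib_left sum_divide_distrib mult_ac)
  qed
  have "shot_exponent \<alpha> \<psi> p c s = (LBINT x:{c<..}. (\<Sum>i=1..\<psi>. real (\<psi> choose i) *
      (x * ((s * p * x powr - \<alpha>) ^ i / (1 + s * p * x powr - \<alpha>) ^ \<psi>))))"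
    unfolding shot_exponent_def
    by (rule set_lebesgue_integral_cong, simp, intro allI impI, rule eq) (use assms p in auto)
  also have "\<dots> = (\<Sum>i=1..\<psi>. LBINT x:{c<..}. real (\<psi> choose i) *
      (x * ((s * p * x powr - \<alpha>) ^ i / (1 + s * p * x powr - \<alpha>) ^ \<psi>)))"
    unfolding set_lebesgue_integral_def scaleR_sum_right
    by (rule Bochner_Integration.integral_sum)
       (unfold set_integrable_def[symmetric], intro set_integrable_mult_right b(1), auto)
  also have "\<dots> = (\<Sum>i=1..\<psi>. 1 / \<alpha> * (s * p) powr (2 / \<alpha>) * (real (\<psi> choose i) *
      cinc_beta (real \<psi> - real i + 2 / \<alpha>) (real i - 2 / \<alpha>) (1 / (1 + s * p * c powr - \<alpha>))))"
    by (rule sum.cong) (simp_all only: set_integral_mult_right, subst b(2), auto)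
  finally show ?thesis by (simp add: sum_distrib_left)
qed

lemma shot_exponent_has_derivative:
  assumes c: "0 < c" and s: "0 < s"
  shows "(shot_exponent \<alpha> \<psi> p c has_real_derivative real \<psi> * shot_moment \<alpha> \<psi> p c 1 s) (at s)"
proof -
  let ?y = "\<lambda>x. p * x powr - \<alpha>"
  have "((\<lambda>t. \<integral>x. indicat_real {c<..} x *\<^sub>R (x * (1 - 1 / (1 + t * ?y x) ^ \<psi>)) \<partial>lborel) has_real_derivative
     (\<integral>x. indicat_real {c<..} x *\<^sub>R (real \<psi> * (x * (?y x ^ 1 / (1 + s * ?y x) ^ (\<psi> + 1)))) \<partial>lborel)) (at s)"
  \<comment> \<open>The denominators are at least 1 for every nonnegative scale, so one dominating
    function works down to the endpoint 0.\<close>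
  proof (rule has_real_derivative_integral_dominated[where a=0 and b="s+1"
        and w="\<lambda>x. indicat_real {c<..} x *\<^sub>R (real \<psi> * p * x powr (1 - \<alpha>))"
        and f'="\<lambda>t x. indicat_real {c<..} x *\<^sub>R (real \<psi> * (x * (?y x ^ 1 / (1 + t * ?y x) ^ (\<psi> + 1))))"])
    show "integrable lborel (\<lambda>x. indicat_real {c<..} x *\<^sub>R (real \<psi> * p * x powr (1 - \<alpha>)))"
      unfolding set_integrable_def[symmetric]
      by (intro set_integrable_mult_right set_integrable_powr_at_top) (use \<alpha> c in auto)
  next
    fix t x :: real assume t: "t \<in> {0<..<s+1}"
    have nz: "1 + t * ?y x \<noteq> 0" using t p by (smt (verit) greaterThanLessThan_iff mult_nonneg_nonneg powr_ge_zero)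
    show "((\<lambda>t. indicat_real {c<..} x *\<^sub>R (x * (1 - 1 / (1 + t * ?y x) ^ \<psi>))) has_real_derivative
      indicat_real {c<..} x *\<^sub>R (real \<psi> * (x * (?y x ^ 1 / (1 + t * ?y x) ^ (\<psi> + 1))))) (at t)"
      using DERIV_cmult[OF DERIV_diff[OF DERIV_const[of 1] DERIV_inverse_power_affine[OF nz, of \<psi>]],
        of "indicat_real {c<..} x * x"]
      by (simp add: field_simps)
    show "\<bar>indicat_real {c<..} x *\<^sub>R (real \<psi> * (x * (?y x ^ 1 / (1 + t * ?y x) ^ (\<psi> + 1))))\<bar> \<le>
      indicat_real {c<..} x *\<^sub>R (real \<psi> * p * x powr (1 - \<alpha>))"
    proof (cases "x > c")
      case True
      then have x: "x > 0" using c by simp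
      have "?y x / (1 + t * ?y x) ^ (\<psi> + 1) \<le> ?y x"
      proof -
        have "1 \<le> (1 + t * ?y x) ^ (\<psi> + 1)" using t p by (intro one_le_power) simp
        then show ?thesis using divide_left_mono[of 1 "(1 + t * ?y x) ^ (\<psi> + 1)" "?y x"] p by simp
      qed
      then have "real \<psi> * (x * (?y x / (1 + t * ?y x) ^ (\<psi> + 1))) \<le> real \<psi> * (x * ?y x)"
        using x by (intro mult_left_mono) auto
      also have "\<dots> = real \<psi> * p * x powr (1 - \<alpha>)"
        using x by (simp add: powr_diff powr_minus_divide)
      finally show ?thesis using True x p t by (simp add: abs_mult)
    qed simp
  next
    fix t assume "t \<in> {0<..<s+1}"
    then show "integrable lborel (\<lambda>x. indicat_real {c<..} x *\<^sub>R (x * (1 - 1 / (1 + t * ?y x) ^ \<psi>)))"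
      using integrable_shot_kernel[OF c, of t] by (simp add: set_integrable_def mult.assoc)
  qed (use s in auto)
  moreover have "(LBINT x:{c<..}. real \<psi> * (x * (?y x ^ 1 / (1 + s * ?y x) ^ (\<psi> + 1)))) =
    real \<psi> * (LBINT x:{c<..}. x * (?y x ^ 1 / (1 + s * ?y x) ^ (\<psi> + 1)))"
    by (rule set_integral_mult_right)
  ultimately show ?thesis
    unfolding shot_exponent_def[abs_def] shot_moment_def set_lebesgue_integral_def[symmetric]
    by (simp only: mult.assoc)
qed

lemma shot_moment_has_derivative:
  assumes c: "0 < c" and s: "0 < s" and j: "1 \<le> j"
  shows "(shot_moment \<alpha> \<psi> p c j has_real_derivative - real (\<psi> + j) * shot_moment \<alpha> \<psi> p c (Suc j) s) (at s)"
proof -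
  let ?y = "\<lambda>x. p * x powr - \<alpha>"
  have "((\<lambda>t. \<integral>x. indicat_real {c<..} x *\<^sub>R (x * (?y x ^ j / (1 + t * ?y x) ^ (\<psi> + j))) \<partial>lborel) has_real_derivative
     (\<integral>x. indicat_real {c<..} x *\<^sub>R (- real (\<psi> + j) * (x * (?y x ^ Suc j / (1 + s * ?y x) ^ (\<psi> + Suc j)))) \<partial>lborel)) (at s)"
  \<comment> \<open>The integrand of the next moment decreases in the scale, so its value at
    \<open>s/2\<close> dominates; that this value is integrable is part of the closed form, which
    needs a positive scale.\<close>
  proof (rule has_real_derivative_integral_dominated[where a="s/2" and b="s+1"
        and w="\<lambda>x. indicat_real {c<..} x *\<^sub>R (real (\<psi> + j) * (x * (?y x ^ Suc j / (1 + s/2 * ?y x) ^ (\<psi> + Suc j))))"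
        and f'="\<lambda>t x. indicat_real {c<..} x *\<^sub>R (- real (\<psi> + j) * (x * (?y x ^ Suc j / (1 + t * ?y x) ^ (\<psi> + Suc j))))"])
    show "integrable lborel (\<lambda>x. indicat_real {c<..} x *\<^sub>R (real (\<psi> + j) * (x * (?y x ^ Suc j / (1 + s/2 * ?y x) ^ (\<psi> + Suc j)))))"
      unfolding set_integrable_def[symmetric]
      using shot_moment_closed_form(2)[OF c half_gt_zero[OF s], of "Suc j"]
      by (intro set_integrable_mult_right) (simp only: mult.assoc le_add1 plus_1_eq_Suc[symmetric])
  next
    fix t x :: real assume t: "t \<in> {s/2<..<s+1}"
    have t0: "t > 0" using t s by auto
    have y0: "0 \<le> ?y x" using p by simp
    have nz: "1 + t * ?y x > 0" using t0 y0 by (meson add_pos_nonneg less_imp_le mult_nonneg_nonneg zero_less_one)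
    show "((\<lambda>t. indicat_real {c<..} x *\<^sub>R (x * (?y x ^ j / (1 + t * ?y x) ^ (\<psi> + j)))) has_real_derivative
      indicat_real {c<..} x *\<^sub>R (- real (\<psi> + j) * (x * (?y x ^ Suc j / (1 + t * ?y x) ^ (\<psi> + Suc j))))) (at t)"
    proof -
      let ?a = "indicat_real {c<..} x * x * ?y x ^ j"
      have eq1: "(\<lambda>t. indicat_real {c<..} x *\<^sub>R (x * (?y x ^ j / (1 + t * ?y x) ^ (\<psi> + j)))) =
          (\<lambda>t. ?a * (1 / (1 + t * ?y x) ^ (\<psi> + j)))"
        by auto
      have eq2: "?a * - (real (\<psi> + j) * (?y x / (1 + t * ?y x) ^ Suc (\<psi> + j))) =
          indicat_real {c<..} x *\<^sub>R (- real (\<psi> + j) * (x * (?y x ^ Suc j / (1 + t * ?y x) ^ (\<psi> + Suc j))))"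
      proof -
        have "I * z * Y * - (r * (y / D)) = I *\<^sub>R (- r * (z * (y * Y / D)))" for I z Y r y D :: real
          by (simp add: algebra_simps)
        from this[of _ x "?y x ^ j"] show ?thesis unfolding add_Suc_right power_Suc[of "?y x"] .
      qed
      have "1 + t * ?y x \<noteq> 0" using nz by simp
      from DERIV_cmult[OF DERIV_inverse_power_affine[OF this, of "\<psi> + j"], of ?a]
      show ?thesis unfolding eq1 eq2 .
    qed
    have "(1 + s/2 * ?y x) ^ (\<psi> + Suc j) \<le> (1 + t * ?y x) ^ (\<psi> + Suc j)"
      using t s y0 by (intro power_mono add_left_mono mult_right_mono) auto
    then have *: "?y x ^ Suc j / (1 + t * ?y x) ^ (\<psi> + Suc j) \<le> ?y x ^ Suc j / (1 + s/2 * ?y x) ^ (\<psi> + Suc j)"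
      using s y0 nz by (intro divide_left_mono mult_pos_pos zero_less_power)
         (auto intro: add_pos_nonneg)
    have **: "0 \<le> ?y x ^ Suc j / (1 + t * ?y x) ^ (\<psi> + Suc j)" using y0 nz by simp
    show "\<bar>indicat_real {c<..} x *\<^sub>R (- real (\<psi> + j) * (x * (?y x ^ Suc j / (1 + t * ?y x) ^ (\<psi> + Suc j))))\<bar> \<le>
      indicat_real {c<..} x *\<^sub>R (real (\<psi> + j) * (x * (?y x ^ Suc j / (1 + s/2 * ?y x) ^ (\<psi> + Suc j))))"
    proof (cases "x > c")
      case True
      then have x: "x > 0" "indicat_real {c<..} x = 1" using c by auto
      have gen: "\<bar>1 *\<^sub>R (- r * (x * Q))\<bar> \<le> 1 *\<^sub>R (r * (x * Q'))" if "Q \<le> Q'" "0 \<le> Q" "0 \<le> r" for Q Q' r :: real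
        using that x by (simp add: abs_mult mult_left_mono)
      show ?thesis unfolding x(2) by (rule gen[OF * **]) simp
    qed simp
  next
    fix t assume "t \<in> {s/2<..<s+1}"
    then show "integrable lborel (\<lambda>x. indicat_real {c<..} x *\<^sub>R (x * (?y x ^ j / (1 + t * ?y x) ^ (\<psi> + j))))"
      using shot_moment_closed_form(2)[OF c _ j, of t] s by (simp add: set_integrable_def mult.assoc)
  qed (use s in auto)
  moreover have "(LBINT x:{c<..}. - real (\<psi> + j) * (x * (?y x ^ Suc j / (1 + s * ?y x) ^ (\<psi> + Suc j)))) =
    - real (\<psi> + j) * (LBINT x:{c<..}. x * (?y x ^ Suc j / (1 + s * ?y x) ^ (\<psi> + Suc j)))"
    by (rule set_integral_mult_right)
  ultimately show ?thesis
    unfolding shot_moment_def[abs_def] set_lebesgue_integral_def[symmetric]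
    by (simp only: mult.assoc)
qed

text \<open>The two integrals differ by the one over \<open>{c<..d}\<close>, where the kernel lies
  between 0 and \<open>d\<close>.\<close>

lemma shot_exponent_diff_radius:
  assumes c: "0 < c" "c \<le> d" and s: "0 \<le> s"
  shows "\<bar>shot_exponent \<alpha> \<psi> p c s - shot_exponent \<alpha> \<psi> p d s\<bar> \<le> d * (d - c)"
proof -
  let ?k = "\<lambda>x. x * (1 - 1 / (1 + s * p * x powr - \<alpha>) ^ \<psi>)"
  have k: "0 \<le> ?k x" "?k x \<le> x" if "x \<ge> 0" for x
    using that inverse_power_mono[of 0 "s * p * x powr - \<alpha>" \<psi>] s p
    by (auto simp: mult_le_cancel_left2)
  have i: "set_integrable lborel {c<..d} ?k"
    by (rule set_integrable_subset[OF integrable_shot_kernel[OF c(1) s]]) auto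
  have U: "{c<..} = {c<..d} \<union> {d<..}" using c by auto
  have "shot_exponent \<alpha> \<psi> p c s = (LBINT x:{c<..d}. ?k x) + shot_exponent \<alpha> \<psi> p d s"
    unfolding shot_exponent_def U
    by (rule set_integral_Un[OF _ i integrable_shot_kernel]) (use c s in auto)
  moreover have "0 \<le> (LBINT x:{c<..d}. ?k x)"
    using k c unfolding set_lebesgue_integral_def
    by (intro integral_nonneg_AE AE_I2) (auto simp: indicator_def)
  moreover have "(LBINT x:{c<..d}. ?k x) \<le> (LBINT x:{c<..d}. d)"
  proof (rule set_integral_mono[OF i])
    show "set_integrable lborel {c<..d} (\<lambda>x. d)"
      by (rule set_integrable_subset[OF borel_integrable_atLeastAtMost'[of c d]]) auto
    show "?k x \<le> d" if "x \<in> {c<..d}" for x using k(2)[of x] that c by (intro order_trans[OF k(2)]) auto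
  qed
  moreover have "(LBINT x:{c<..d}. d) = d * (d - c)"
    using c by (simp add: set_lebesgue_integral_def)
  ultimately show ?thesis by simp
qed

lemma shot_exponent_diff_scale:
  assumes c: "0 < c" and s: "0 \<le> s" "s \<le> t"
  shows "\<bar>shot_exponent \<alpha> \<psi> p c s - shot_exponent \<alpha> \<psi> p c t\<bar> \<le>
    (t - s) * (real \<psi> * p * (LBINT x:{c<..}. x powr (1 - \<alpha>)))"
proof -
  let ?k = "\<lambda>s x. x * (1 - 1 / (1 + s * p * x powr - \<alpha>) ^ \<psi>)"
  have i: "set_integrable lborel {c<..} (?k t)" "set_integrable lborel {c<..} (?k s)"
    using integrable_shot_kernel[OF c, of t] integrable_shot_kernel[OF c, of s] s by auto
  have k: "?k s x \<le> ?k t x" "?k t x - ?k s x \<le> (t - s) * (real \<psi> * p) * x powr (1 - \<alpha>)" if x: "x > 0" for x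
  proof -
    have m: "0 \<le> s * p * x powr - \<alpha>" "s * p * x powr - \<alpha> \<le> t * p * x powr - \<alpha>"
      using s p by (auto intro!: mult_right_mono)
    from inverse_power_mono[OF m, of \<psi>] x show "?k s x \<le> ?k t x" by simp
    have "?k t x - ?k s x = x * (1 / (1 + s * p * x powr - \<alpha>) ^ \<psi> - 1 / (1 + t * p * x powr - \<alpha>) ^ \<psi>)"
      by (simp add: algebra_simps)
    also have "\<dots> \<le> x * (real \<psi> * (t * p * x powr - \<alpha> - s * p * x powr - \<alpha>))"
      using x by (intro mult_left_mono one_minus_inverse_power_le m) auto
    also have "\<dots> = (t - s) * (real \<psi> * p) * x powr (1 - \<alpha>)"
      using x by (simp add: powr_diff powr_minus_divide field_simps)
    finally show "?k t x - ?k s x \<le> (t - s) * (real \<psi> * p) * x powr (1 - \<alpha>)" .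
  qed
  have "shot_exponent \<alpha> \<psi> p c t - shot_exponent \<alpha> \<psi> p c s = (LBINT x:{c<..}. ?k t x - ?k s x)"
    unfolding shot_exponent_def by (rule set_integral_diff(2)[OF i, symmetric])
  also have "\<dots> \<le> (LBINT x:{c<..}. (t - s) * (real \<psi> * p) * x powr (1 - \<alpha>))"
  proof (rule set_integral_mono)
    show "set_integrable lborel {c<..} (\<lambda>x. (t - s) * (real \<psi> * p) * x powr (1 - \<alpha>))"
      by (intro set_integrable_mult_right set_integrable_powr_at_top) (use \<alpha> c in auto)
  qed (use i k c in auto)
  also have "\<dots> = (t - s) * (real \<psi> * p * (LBINT x:{c<..}. x powr (1 - \<alpha>)))" by (simp add: mult.assoc)
  finally have "shot_exponent \<alpha> \<psi> p c t - shot_exponent \<alpha> \<psi> p c s \<le> \<dots>" .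
  moreover have "shot_exponent \<alpha> \<psi> p c s \<le> shot_exponent \<alpha> \<psi> p c t"
    unfolding shot_exponent_def by (rule set_integral_mono[OF i(2,1)]) (use k c in auto)
  ultimately show ?thesis by simp
qed

text \<open>Joint continuity in radius and scale. The radius is moved first, at the scale
  \<open>f x\<close>, with a bound independent of the scale; the scale is then moved at the fixed
  radius \<open>c\<close>, because its Lipschitz constant depends on the radius.\<close>

lemma tendsto_shot_exponent:
  assumes f: "(f \<longlongrightarrow> s) F" and g: "(g \<longlongrightarrow> c) F" and c: "0 < c" and s: "0 \<le> s"
    and f0: "\<forall>\<^sub>F x in F. 0 \<le> f x"
  shows "((\<lambda>x. shot_exponent \<alpha> \<psi> p (g x) (f x)) \<longlongrightarrow> shot_exponent \<alpha> \<psi> p c s) F"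
proof -
  let ?E = "shot_exponent \<alpha> \<psi> p"
  define C where "C = real \<psi> * p * (LBINT x:{c<..}. x powr (1 - \<alpha>))"
  have ev: "\<forall>\<^sub>F x in F. 0 < g x" using g c by (rule order_tendstoD)
  have "((\<lambda>x. ?E (g x) (f x) - ?E c s) \<longlongrightarrow> 0) F"
  proof (rule Lim_null_comparison)
    show "\<forall>\<^sub>F x in F. norm (?E (g x) (f x) - ?E c s) \<le> (\<bar>g x\<bar> + c) * \<bar>g x - c\<bar> + \<bar>f x - s\<bar> * C"
      using f0 ev
    proof eventually_elim
      case (elim x)
      have "\<bar>?E (g x) (f x) - ?E c (f x)\<bar> \<le> (\<bar>g x\<bar> + c) * \<bar>g x - c\<bar>"
      proof (cases "c \<le> g x")
        case True
        have "\<bar>?E (g x) (f x) - ?E c (f x)\<bar> \<le> g x * (g x - c)"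
          using shot_exponent_diff_radius[OF c True elim(1)] by simp
        also have "\<dots> \<le> (\<bar>g x\<bar> + c) * \<bar>g x - c\<bar>" using True c by (intro mult_mono) auto
        finally show ?thesis .
      next
        case False
        have "\<bar>?E (g x) (f x) - ?E c (f x)\<bar> \<le> c * (c - g x)"
          using shot_exponent_diff_radius[OF elim(2) _ elim(1), of c] False by simp
        also have "\<dots> \<le> (\<bar>g x\<bar> + c) * \<bar>g x - c\<bar>" using False c by (intro mult_mono) auto
        finally show ?thesis .
      qed
      moreover have "\<bar>?E c (f x) - ?E c s\<bar> \<le> \<bar>f x - s\<bar> * C"
      proof (cases "s \<le> f x")
        case True
        then show ?thesis using shot_exponent_diff_scale[OF c s True] by (simp add: C_def)
      next
        case False
        then show ?thesis using shot_exponent_diff_scale[OF c elim(1), of s] by (simp add: C_def)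
      qed
      ultimately show ?case by simp
    qed
    have "((\<lambda>x. (\<bar>g x\<bar> + c) * \<bar>g x - c\<bar> + \<bar>f x - s\<bar> * C) \<longlongrightarrow> (\<bar>c\<bar> + c) * \<bar>c - c\<bar> + \<bar>s - s\<bar> * C) F"
      by (intro tendsto_intros f g)
    then show "((\<lambda>x. (\<bar>g x\<bar> + c) * \<bar>g x - c\<bar> + \<bar>f x - s\<bar> * C) \<longlongrightarrow> 0) F" by simp
  qed
  then show ?thesis using Lim_null by blast
qed

end

section \<open>From one tier to the network: total exponent and logarithmic derivatives\<close>

lemma UNIV_tier: "(UNIV :: tier set) = {MBS, SBS}"
  using tier.exhaust by auto

definition tier_exponent :: "hetnet \<Rightarrow> tier \<Rightarrow> tier \<Rightarrow> real \<Rightarrow> real \<Rightarrow> real" where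
  "tier_exponent H l j r s =
    2 * pi * dens H j * shot_exponent (pathloss H) (users H j) (tx_power H j) (guard_dist H l j r) s"

text \<open>Unlike \<open>interference_laplace\<close>, which involves \<open>s powr (2 / \<alpha>)\<close> and \<open>beta_arg\<close>, this expression
  makes sense at \<open>s = 0\<close> as well.\<close>

definition outer_laplace :: "hetnet \<Rightarrow> tier \<Rightarrow> real \<Rightarrow> real \<Rightarrow> real" where
  "outer_laplace H l r s = exp (- (\<Sum>j\<in>UNIV. tier_exponent H l j r s))"

text \<open>The \<open>j\<close>-th derivative in \<open>s\<close> of the logarithm of the noisy
  Laplace transform, for \<open>j\<close> at least 1; the noise exponent is linear in
  \<open>s\<close> and survives only at \<open>j = 1\<close>. The quotient of factorials is the
  rising factorial collected by repeated differentiation of the shot moments.\<close>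

definition log_deriv :: "hetnet \<Rightarrow> tier \<Rightarrow> real \<Rightarrow> nat \<Rightarrow> real \<Rightarrow> real" where
  "log_deriv H l r j s = - noise H * (if j = 1 then 1 else 0) +
    (\<Sum>t\<in>UNIV. 2 * pi * dens H t * ((-1) ^ j * (fact (users H t + j - 1) / fact (users H t - 1)) *
      shot_moment (pathloss H) (users H t) (tx_power H t) (guard_dist H l t r) j s))"

context
  fixes H :: hetnet
  assumes H: "valid_hetnet H"
begin

lemma hetnet_pos:
  "0 < dens H j" "0 < tx_power H j" "0 < bias H j" "1 \<le> users H j" "2 < pathloss H" "0 \<le> noise H"
  using H by (auto simp: valid_hetnet_def)

lemma bias_ratio_pos: "0 < bias_ratio H"
  using hetnet_pos by (simp add: bias_ratio_def sbs_mbs_ratio_def dof_def)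

lemma guard_dist_pos: "0 < r \<Longrightarrow> 0 < guard_dist H l j r"
  using bias_ratio_pos by (simp add: guard_dist_def)

lemma interference_laplace_eq:
  assumes "0 < r" "0 < s"
  shows "interference_laplace H l s r = outer_laplace H l r s"
proof -
  have e: "tier_exponent H l j r s = s powr (2 / pathloss H) * (dens H j * tx_power H j powr (2 / pathloss H) *
      (2 * pi / pathloss H) * (\<Sum>i=1..users H j. real (users H j choose i) *
        cinc_beta (real (users H j) - real i + 2 / pathloss H) (real i - 2 / pathloss H) (beta_arg H l j s r)))" for j
  proof -
    have "(s * tx_power H j) powr (2 / pathloss H) = s powr (2 / pathloss H) * tx_power H j powr (2 / pathloss H)"
      using assms hetnet_pos(2)[of j] by (simp add: powr_mult)
    then show ?thesis
      unfolding tier_exponent_def beta_arg_def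
      by (subst shot_exponent_closed_form) (use assms hetnet_pos guard_dist_pos[OF assms(1)] in simp_all)
  qed
  have "interference_laplace H l s r = exp (- (\<Sum>j\<in>{SBS, MBS}. tier_exponent H l j r s))"
    unfolding interference_laplace_def e by (simp only: sum_distrib_left[symmetric] mult_minus_left)
  also have "{SBS, MBS} = (UNIV :: tier set)" by (auto simp: UNIV_tier)
  finally show ?thesis by (simp add: outer_laplace_def)
qed

lemma noisy_laplace_eq:
  assumes "0 < r" "0 < s"
  shows "noisy_laplace H l r s = exp (- s * noise H) * outer_laplace H l r s"
  using assms by (simp add: noisy_laplace_def interference_laplace_eq)

lemma outer_laplace_has_derivative:
  assumes "0 < r" "0 < s"
  shows "((\<lambda>s. exp (- s * noise H) * outer_laplace H l r s) has_real_derivative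
    log_deriv H l r 1 s * (exp (- s * noise H) * outer_laplace H l r s)) (at s)"
proof -
  let ?c = "\<lambda>t. fact (users H t) / fact (users H t - 1) :: real"
  have c: "?c t = real (users H t)" for t
    using hetnet_pos(4)[of t] by (simp add: fact_reduce)
  have d: "(tier_exponent H l t r has_real_derivative 2 * pi * dens H t * (?c t *
      shot_moment (pathloss H) (users H t) (tx_power H t) (guard_dist H l t r) 1 s)) (at s)" for t
    unfolding tier_exponent_def[abs_def] c
    using shot_exponent_has_derivative[of "pathloss H" "tx_power H t" "guard_dist H l t r" s "users H t"]
      hetnet_pos guard_dist_pos[OF assms(1)] assms by (intro DERIV_cmult) simp
  show ?thesis
    unfolding outer_laplace_def log_deriv_def
    by (rule derivative_eq_intros refl d)+ (simp add: sum_negf sum_distrib_right sum_distrib_left algebra_simps)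
qed

lemma log_deriv_has_derivative:
  assumes "0 < r" "0 < s" "1 \<le> j"
  shows "(log_deriv H l r j has_real_derivative log_deriv H l r (Suc j) s) (at s)"
proof -
  have f: "fact (users H t + Suc j - 1) = real (users H t + j) * fact (users H t + j - 1)" for t
    using assms(3) by (simp add: fact_reduce)
  have d: "(shot_moment (pathloss H) (users H t) (tx_power H t) (guard_dist H l t r) j has_real_derivative
    - real (users H t + j) * shot_moment (pathloss H) (users H t) (tx_power H t) (guard_dist H l t r) (Suc j) s) (at s)" for t
    using hetnet_pos guard_dist_pos[OF assms(1)] assms by (intro shot_moment_has_derivative) auto
  show ?thesis
    unfolding log_deriv_def[abs_def] f
    by (rule derivative_eq_intros refl d)+ (use assms in \<open>auto intro!: sum.cong simp: algebra_simps add_divide_distrib diff_divide_distrib\<close>)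
qed

lemma higher_deriv_noisy_laplace:
  assumes "0 < r" "0 < s"
  shows "((deriv ^^ k) (noisy_laplace H l r) has_real_derivative (deriv ^^ Suc k) (noisy_laplace H l r) s) (at s)"
    and "1 \<le> k \<Longrightarrow> (deriv ^^ k) (noisy_laplace H l r) s = noisy_laplace_deriv H l k r s"
proof -
  \<comment> \<open>\<open>noisy_laplace\<close> is known to agree with the differentiable
    expression only for positive \<open>s\<close>, hence the transfer on an open half-line.\<close>
  have F: "(noisy_laplace H l r has_real_derivative log_deriv H l r 1 s * noisy_laplace H l r s) (at s)" if "s \<in> {0<..}" for s
    unfolding noisy_laplace_eq[OF assms(1) that[unfolded greaterThan_iff]]
    by (rule has_field_derivative_transform_within_open[OF outer_laplace_has_derivative[OF assms(1)], of _ "{0<..}"])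
       (use that assms noisy_laplace_eq in auto)
  note * = deriv_pow_exp_eq_bell[OF open_greaterThan, of s 0 "noisy_laplace H l r" "log_deriv H l r" k,
      OF _ F log_deriv_has_derivative[OF assms(1)]]
  show "((deriv ^^ k) (noisy_laplace H l r) has_real_derivative (deriv ^^ Suc k) (noisy_laplace H l r) s) (at s)"
    by (rule *(2)) (use assms in auto)
  assume k: "1 \<le> k"
  have v: "log_deriv H l r j s = - noise H * (if j = 1 then 1 else 0) +
            2 * pi * (\<Sum>t\<in>{MBS, SBS}. fdb_coeff H l t j s r * tx_power H t ^ j *
                        (s * tx_power H t) powr (2 / pathloss H - real j))" if j: "1 \<le> j" for j
  proof -
    have "shot_moment (pathloss H) (users H t) (tx_power H t) (guard_dist H l t r) j s =
      1 / pathloss H * cinc_beta (real (users H t) + 2 / pathloss H) (real j - 2 / pathloss H) (beta_arg H l t s r) *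
      (tx_power H t ^ j * (s * tx_power H t) powr (2 / pathloss H - real j))" for t
    proof -
      \<comment> \<open>Extracting \<open>s ^ j\<close> makes it cancel against the same power on
        the left of \<open>shot_moment_closed_form\<close>.\<close>
      have "(s * tx_power H t) powr (2 / pathloss H) =
          s ^ j * (tx_power H t ^ j * (s * tx_power H t) powr (2 / pathloss H - real j))"
        using assms hetnet_pos(2)[of t] by (simp add: powr_diff powr_realpow power_mult_distrib)
      then have "s ^ j * shot_moment (pathloss H) (users H t) (tx_power H t) (guard_dist H l t r) j s =
        s ^ j * (1 / pathloss H * cinc_beta (real (users H t) + 2 / pathloss H) (real j - 2 / pathloss H) (beta_arg H l t s r) *
          (tx_power H t ^ j * (s * tx_power H t) powr (2 / pathloss H - real j)))"
        using shot_moment_closed_form(1)[of "pathloss H" "tx_power H t" "guard_dist H l t r" s j "users H t"]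
          hetnet_pos guard_dist_pos[OF assms(1)] assms j by (simp add: beta_arg_def)
      then show ?thesis by (rule mult_left_cancel[THEN iffD1, rotated]) (use assms(2) in simp)
    qed
    then show ?thesis
      unfolding log_deriv_def UNIV_tier fdb_coeff_def by (simp add: sum_distrib_left algebra_simps)
  qed
  have "(deriv ^^ k) (noisy_laplace H l r) s = noisy_laplace H l r s * bell (\<lambda>j. log_deriv H l r j s) k"
    by (rule *(1)) (use assms in auto)
  then show "(deriv ^^ k) (noisy_laplace H l r) s = noisy_laplace_deriv H l k r s"
    unfolding noisy_laplace_deriv_def bell_eq_sum_bell_indices[OF k]
    using v by (auto intro!: sum.cong prod.cong arg_cong2[where f="(*)"] arg_cong2[where f="(^)"])
qed

lemma tendsto_outer_laplace:
  assumes f: "(f \<longlongrightarrow> s) F" and g: "(g \<longlongrightarrow> r) F" and r: "0 < r" and s: "0 \<le> s"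
    and f0: "\<forall>\<^sub>F x in F. 0 \<le> f x"
  shows "((\<lambda>x. outer_laplace H l (g x) (f x)) \<longlongrightarrow> outer_laplace H l r s) F"
  unfolding outer_laplace_def tier_exponent_def
proof (intro tendsto_intros tendsto_shot_exponent f s f0 hetnet_pos guard_dist_pos r)
  show "((\<lambda>x. guard_dist H l j (g x)) \<longlongrightarrow> guard_dist H l j r) F" for j
    unfolding guard_dist_def by (auto intro!: tendsto_intros g)
qed

lemma outer_laplace_bounds:
  assumes "0 < r" "0 \<le> s"
  shows "0 < outer_laplace H l r s" "outer_laplace H l r s \<le> 1"
proof -
  have "0 \<le> (\<Sum>j\<in>UNIV. tier_exponent H l j r s)"
    unfolding tier_exponent_def
    using assms hetnet_pos guard_dist_pos[OF assms(1)]
    by (intro sum_nonneg mult_nonneg_nonneg shot_exponent_nonneg) (auto intro: less_imp_le)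
  then show "0 < outer_laplace H l r s" "outer_laplace H l r s \<le> 1"
    by (auto simp: outer_laplace_def)
qed

end

section \<open>Poisson point processes\<close>

locale ppp = prob_space M for M :: "'w measure" +
  fixes X :: "nat \<Rightarrow> 'w \<Rightarrow> 'a::euclidean_space" and rate :: real
  assumes ppp: "homogeneous_ppp M X rate" and rate_pos: "0 < rate"
begin

lemma measurable_point [measurable]: "X n \<in> borel_measurable M"
  using ppp by (simp add: homogeneous_ppp_def)

lemma AE_finite_count:
  "B \<in> sets borel \<Longrightarrow> bounded B \<Longrightarrow> AE \<omega> in M. finite {n. X n \<omega> \<in> B}"
  using ppp by (simp add: homogeneous_ppp_def)

lemma prob_count:
  "B \<in> sets borel \<Longrightarrow> bounded B \<Longrightarrow> \<P>(\<omega> in M. count_in X B \<omega> = k) =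
    (rate * measure lborel B) ^ k / fact k * exp (- (rate * measure lborel B))"
  using ppp by (simp add: homogeneous_ppp_def)

lemma indep_counts:
  fixes B :: "nat \<Rightarrow> 'a set"
  shows "finite I \<Longrightarrow> (\<And>i. i \<in> I \<Longrightarrow> B i \<in> sets borel) \<Longrightarrow> (\<And>i. i \<in> I \<Longrightarrow> bounded (B i)) \<Longrightarrow>
    disjoint_family_on B I \<Longrightarrow> indep_vars (\<lambda>_. count_space UNIV) (\<lambda>i. count_in X (B i)) I"
  using ppp by (simp add: homogeneous_ppp_def)

lemma measurable_count [measurable]:
  "B \<in> sets borel \<Longrightarrow> count_in X B \<in> M \<rightarrow>\<^sub>M count_space UNIV"
  unfolding count_in_def[abs_def]
  by (rule measurable_card) (use measurable_sets[OF measurable_point, of B] in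
      \<open>simp add: vimage_def Int_def conj_commute\<close>)

lemma nn_integral_count:
  fixes f :: "nat \<Rightarrow> ennreal"
  assumes [measurable]: "B \<in> sets borel"
  shows "(\<integral>\<^sup>+\<omega>. f (count_in X B \<omega>) \<partial>M) = (\<Sum>k. f k * ennreal (\<P>(\<omega> in M. count_in X B \<omega> = k)))"
proof -
  define A where "A k = {\<omega>\<in>space M. count_in X B \<omega> = k}" for k
  have [measurable]: "A k \<in> sets M" for k unfolding A_def by measurable
  have "(\<integral>\<^sup>+\<omega>. f (count_in X B \<omega>) \<partial>M) = (\<integral>\<^sup>+\<omega>. (\<Sum>k. f k * indicator (A k) \<omega>) \<partial>M)"
  proof (rule nn_integral_cong)
    fix \<omega> assume "\<omega> \<in> space M"
    then have "\<omega> \<in> A (count_in X B \<omega>)" by (simp add: A_def)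
    moreover have "disjoint_family A" by (auto simp: disjoint_family_on_def A_def)
    ultimately show "f (count_in X B \<omega>) = (\<Sum>k. f k * indicator (A k) \<omega>)"
      by (simp add: suminf_cmult_indicator)
  qed
  also have "\<dots> = (\<Sum>k. \<integral>\<^sup>+\<omega>. f k * indicator (A k) \<omega> \<partial>M)"
    by (rule nn_integral_suminf) measurable
  also have "\<dots> = (\<Sum>k. f k * emeasure M (A k))"
    by (simp add: nn_integral_cmult_indicator)
  finally show ?thesis by (simp add: A_def emeasure_eq_measure)
qed

lemma nn_integral_count_eq:
  assumes B: "B \<in> sets borel" "bounded B"
  shows "(\<integral>\<^sup>+\<omega>. ennreal (real (count_in X B \<omega>)) \<partial>M) = ennreal (rate * measure lborel B)"
proof -
  define m where "m = rate * measure lborel B"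
  have m: "0 \<le> m" using rate_pos by (simp add: m_def)
  have "(\<lambda>k. m ^ k / fact k) sums exp m" using exp_converges[of m] by (simp add: divide_inverse mult.commute)
  then have "(\<lambda>k. (m * exp (- m)) * (m ^ k / fact k)) sums ((m * exp (- m)) * exp m)" by (rule sums_mult)
  moreover have "(m * exp (- m)) * (m ^ k / fact k) = real (Suc k) * (m ^ Suc k / fact (Suc k) * exp (- m))" for k
    by (simp add: field_simps del: of_nat_Suc)
  moreover have "(m * exp (- m)) * exp m = m" by (simp add: exp_minus)
  ultimately have "(\<lambda>k. real (Suc k) * (m ^ Suc k / fact (Suc k) * exp (- m))) sums m" by (simp only:)
  then have "(\<lambda>k. real k * (m ^ k / fact k * exp (- m))) sums (m + real 0 * (m ^ 0 / fact 0 * exp (- m)))"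
    by (rule sums_Suc)
  then have s: "(\<lambda>k. real k * (m ^ k / fact k * exp (- m))) sums m" by simp
  have "(\<integral>\<^sup>+\<omega>. ennreal (real (count_in X B \<omega>)) \<partial>M) =
      (\<Sum>k. ennreal (real k) * ennreal (\<P>(\<omega> in M. count_in X B \<omega> = k)))"
    using nn_integral_count[OF B(1), of "\<lambda>k. ennreal (real k)"] .
  also have "\<dots> = (\<Sum>k. ennreal (real k * (m ^ k / fact k * exp (- m))))"
    unfolding prob_count[OF B] m_def[symmetric]
    by (rule suminf_cong) (rule ennreal_mult'[symmetric], simp)
  also have "\<dots> = ennreal m"
    using s m by (intro suminf_ennreal_eq) auto
  finally show ?thesis by (simp add: m_def)
qed

lemma expectation_exp_count:
  assumes B: "B \<in> sets borel" "bounded B" and a: "0 \<le> a"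
  shows "expectation (\<lambda>\<omega>. exp (- a * real (count_in X B \<omega>))) = exp (- rate * measure lborel B * (1 - exp (- a)))"
proof -
  note [measurable] = B(1)
  define m where "m = rate * measure lborel B"
  have m: "0 \<le> m" using rate_pos by (simp add: m_def)
  have "(\<lambda>k. (m * exp (- a)) ^ k / fact k) sums exp (m * exp (- a))"
    using exp_converges[of "m * exp (- a)"] by (simp add: divide_inverse mult.commute)
  then have "(\<lambda>k. exp (- m) * ((m * exp (- a)) ^ k / fact k)) sums (exp (- m) * exp (m * exp (- a)))"
    by (rule sums_mult)
  moreover have "exp (- m) * ((m * exp (- a)) ^ k / fact k) = exp (- a * real k) * (m ^ k / fact k * exp (- m))" for k
    by (simp add: power_mult_distrib exp_of_nat_mult[symmetric] mult.commute)
  moreover have "exp (- m) * exp (m * exp (- a)) = exp (- m * (1 - exp (- a)))"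
    by (simp add: exp_add[symmetric] algebra_simps)
  ultimately have s: "(\<lambda>k. exp (- a * real k) * (m ^ k / fact k * exp (- m))) sums exp (- m * (1 - exp (- a)))" by (simp only:)
  have "(\<integral>\<^sup>+\<omega>. ennreal (exp (- a * real (count_in X B \<omega>))) \<partial>M) =
      (\<Sum>k. ennreal (exp (- a * real k)) * ennreal (\<P>(\<omega> in M. count_in X B \<omega> = k)))"
    using nn_integral_count[OF B(1), of "\<lambda>k. ennreal (exp (- a * real k))"] .
  also have "\<dots> = (\<Sum>k. ennreal (exp (- a * real k) * (m ^ k / fact k * exp (- m))))"
    unfolding prob_count[OF B] m_def[symmetric]
    by (rule suminf_cong) (rule ennreal_mult'[symmetric], simp)
  also have "\<dots> = ennreal (exp (- m * (1 - exp (- a))))"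
    using s m by (intro suminf_ennreal_eq) auto
  finally have "(\<integral>\<^sup>+\<omega>. ennreal (exp (- a * real (count_in X B \<omega>))) \<partial>M) = ennreal (exp (- m * (1 - exp (- a))))" .
  then have "expectation (\<lambda>\<omega>. exp (- a * real (count_in X B \<omega>))) = exp (- m * (1 - exp (- a)))"
    by (subst integral_eq_nn_integral) auto
  then show ?thesis by (simp add: m_def)
qed

lemma suminf_indicator_points:
  "finite {n. X n \<omega> \<in> B} \<Longrightarrow> (\<Sum>n. indicator B (X n \<omega>) :: ennreal) = ennreal (real (count_in X B \<omega>))"
  by (subst suminf_finite[of "{n. X n \<omega> \<in> B}"])
     (auto simp: count_in_def indicator_def ennreal_of_nat_eq_real_of_nat)

text \<open>The mean number of points in a box is \<open>rate\<close> times its volume, and a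
  measure with the right values on boxes is Lebesgue measure; integrals of other functions
  follow.\<close>

lemma campbell:
  fixes \<phi> :: "'a \<Rightarrow> ennreal"
  assumes [measurable]: "\<phi> \<in> borel_measurable borel"
  shows "(\<integral>\<^sup>+\<omega>. (\<Sum>n. \<phi> (X n \<omega>)) \<partial>M) = ennreal rate * (\<integral>\<^sup>+x. \<phi> x \<partial>lborel)"
proof -
  \<comment> \<open>The intensity measure: counting measure on the indices times \<open>M\<close>,
    pushed forward to the positions of the points.\<close>
  define N where "N = distr (count_space (UNIV :: nat set) \<Otimes>\<^sub>M M) borel (\<lambda>(n, \<omega>). X n \<omega>)"
  have [measurable]: "(\<lambda>(n, \<omega>). X n \<omega>) \<in> count_space (UNIV :: nat set) \<Otimes>\<^sub>M M \<rightarrow>\<^sub>M borel"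
    by (rule measurable_pair_measure_countable1) auto
  interpret C: sigma_finite_measure "count_space (UNIV :: nat set)"
    by (rule sigma_finite_measure_count_space_countable) simp
  have N: "(\<integral>\<^sup>+x. f x \<partial>N) = (\<integral>\<^sup>+\<omega>. (\<Sum>n. f (X n \<omega>)) \<partial>M)" if [measurable]: "f \<in> borel_measurable borel" for f
  proof -
    have "(\<integral>\<^sup>+x. f x \<partial>N) = (\<integral>\<^sup>+z. f (case z of (n, \<omega>) \<Rightarrow> X n \<omega>) \<partial>(count_space UNIV \<Otimes>\<^sub>M M))"
      unfolding N_def by (rule nn_integral_distr) measurable
    also have "\<dots> = (\<integral>\<^sup>+n. \<integral>\<^sup>+\<omega>. f (X n \<omega>) \<partial>M \<partial>count_space UNIV)"
      by (subst nn_integral_fst[symmetric]) auto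
    also have "\<dots> = (\<Sum>n. \<integral>\<^sup>+\<omega>. f (X n \<omega>) \<partial>M)"
      by (rule nn_integral_count_space_nat)
    also have "\<dots> = (\<integral>\<^sup>+\<omega>. (\<Sum>n. f (X n \<omega>)) \<partial>M)"
      by (rule nn_integral_suminf[symmetric]) measurable
    finally show ?thesis .
  qed
  have sN [measurable_cong]: "sets N = sets borel" by (simp add: N_def)
  \<comment> \<open>Dividing by \<open>rate\<close> gives a measure to which the characterisation of
    Lebesgue measure by boxes applies directly.\<close>
  have "lborel = density N (\<lambda>_. ennreal (1 / rate))"
  proof (rule lborel_eqI)
    fix l u :: 'a assume lu: "\<And>b. b \<in> Basis \<Longrightarrow> l \<bullet> b \<le> u \<bullet> b"
    have B: "box l u \<in> sets borel" "bounded (box l u)" by auto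
    have "emeasure N (box l u) = (\<integral>\<^sup>+x. indicator (box l u) x \<partial>N)" by simp
    also have "\<dots> = (\<integral>\<^sup>+\<omega>. (\<Sum>n. indicator (box l u) (X n \<omega>)) \<partial>M)" by (rule N) measurable
    also have "\<dots> = (\<integral>\<^sup>+\<omega>. ennreal (real (count_in X (box l u) \<omega>)) \<partial>M)"
      by (rule nn_integral_cong_AE) (use AE_finite_count[OF B] in eventually_elim, rule suminf_indicator_points)
    also have "\<dots> = ennreal (rate * measure lborel (box l u))" by (rule nn_integral_count_eq[OF B])
    also have "measure lborel (box l u) = (\<Prod>b\<in>Basis. (u - l) \<bullet> b)" using lu by (simp add: inner_diff_left)
    finally have "emeasure N (box l u) = ennreal (rate * (\<Prod>b\<in>Basis. (u - l) \<bullet> b))" .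
    then show "emeasure (density N (\<lambda>_. ennreal (1 / rate))) (box l u) = ennreal (\<Prod>b\<in>Basis. (u - l) \<bullet> b)"
      using rate_pos by (simp add: emeasure_density_const ennreal_mult'[symmetric] emeasure_density nn_integral_cmult)
  qed (simp add: sN)
  then have "(\<integral>\<^sup>+x. \<phi> x \<partial>lborel) = (\<integral>\<^sup>+x. \<phi> x \<partial>density N (\<lambda>_. ennreal (1 / rate)))" by simp
  also have "\<dots> = ennreal (1 / rate) * (\<integral>\<^sup>+x. \<phi> x \<partial>N)"
    by (subst nn_integral_density) (auto simp: nn_integral_cmult)
  finally have "ennreal rate * (\<integral>\<^sup>+x. \<phi> x \<partial>lborel) = (ennreal rate * ennreal (1 / rate)) * (\<integral>\<^sup>+x. \<phi> x \<partial>N)"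
    by (simp add: mult.assoc)
  also have "ennreal rate * ennreal (1 / rate) = 1" using rate_pos by (simp add: ennreal_mult[symmetric])
  finally show ?thesis using N[of \<phi>] by simp
qed

text \<open>By Campbell's formula the sum has finite mean, hence it is almost surely finite.\<close>

lemma AE_summable_points:
  fixes \<phi> :: "'a \<Rightarrow> real"
  assumes "integrable lborel \<phi>" "\<And>x. 0 \<le> \<phi> x"
  shows "AE \<omega> in M. summable (\<lambda>n. \<phi> (X n \<omega>))"
proof -
  have [measurable]: "\<phi> \<in> borel_measurable borel" using borel_measurable_integrable[OF assms(1)] by simp
  have "(\<integral>\<^sup>+\<omega>. (\<Sum>n. ennreal (\<phi> (X n \<omega>))) \<partial>M) = ennreal rate * (\<integral>\<^sup>+x. ennreal (\<phi> x) \<partial>lborel)"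
    by (rule campbell) measurable
  also have "\<dots> \<noteq> \<infinity>"
    using assms by (subst nn_integral_eq_integral) (auto simp: ennreal_mult_eq_top_iff)
  finally have "AE \<omega> in M. (\<Sum>n. ennreal (\<phi> (X n \<omega>))) \<noteq> \<infinity>"
    by (intro nn_integral_noteq_infinite) auto
  then show ?thesis
    by eventually_elim (use assms(2) in \<open>auto intro: summable_suminf_not_top\<close>)
qed

text \<open>The factor \<open>of_bool\<close> makes these identities say as well that the points seen by \<open>v\<close> are
  independent of the counts in \<open>B\<close> and \<open>C\<close>; no separate independence statement about the
  configuration outside a disc is needed.\<close>

lemma laplace_functional_simple:
  fixes v :: "'a \<Rightarrow> real"
  assumes v: "simple_function borel v" "\<And>x. 0 \<le> v x" and bv: "bounded {x. v x \<noteq> 0}"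
    and B: "B \<in> sets borel" "bounded B" "C \<in> sets borel" "bounded C" "B \<inter> C = {}"
    and vB: "\<And>x. x \<in> B \<union> C \<Longrightarrow> v x = 0"
  shows "expectation (\<lambda>\<omega>. of_bool (count_in X B \<omega> = k \<and> count_in X C \<omega> = l) * exp (- (\<Sum>n. v (X n \<omega>)))) =
    \<P>(\<omega> in M. count_in X B \<omega> = k) * \<P>(\<omega> in M. count_in X C \<omega> = l) *
      exp (- rate * (\<integral>x. 1 - exp (- v x) \<partial>lborel))"
proof -
  \<comment> \<open>The nonzero values of \<open>v\<close>. Their level sets are disjoint, bounded,
    and away from \<open>B\<close> and \<open>C\<close>, so the counts in all of these sets are
    independent Poisson variables.\<close>
  define V where "V = v ` UNIV - {0}"
  have fV: "finite V" using v(1) by (simp add: V_def simple_function_def)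
  then obtain e where e: "bij_betw e {0..<card V} V"
    using ex_bij_betw_nat_finite by blast
  define m where "m = card V"
  have e: "bij_betw e {..<m} V" using e by (simp add: m_def atLeast0LessThan)
  define L where "L a = v -` {a}" for a
  have L: "L a \<in> sets borel" "bounded (L a)" if "a \<in> V" for a
  proof -
    show "L a \<in> sets borel" using simple_functionD(2)[OF v(1), of "{a}"] by (simp add: L_def)
    show "bounded (L a)" by (rule bounded_subset[OF bv]) (use that in \<open>auto simp: L_def V_def\<close>)
  qed
  \<comment> \<open>Slots 0 and 1 hold \<open>B\<close> and \<open>C\<close>, hence the shift by 2:
    the independence axiom speaks of one finite disjoint family.\<close>
  define D where "D i = (if i = 0 then B else if i = 1 then C else L (e (i - 2)))" for i :: nat
  define f :: "nat \<Rightarrow> nat \<Rightarrow> real" where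
    "f i n = (if i = 0 then of_bool (n = k) else if i = 1 then of_bool (n = l) else exp (- e (i - 2) * real n))" for i n
  have eV: "e i \<in> V" if "i < m" for i using e that by (auto simp: bij_betw_def)
  have einj: "e i = e j \<longleftrightarrow> i = j" if "i < m" "j < m" for i j
    using e that by (auto simp: bij_betw_def inj_on_def)
  have D: "D i \<in> sets borel" "bounded (D i)" if "i < m + 2" for i
    using that B L[OF eV] by (auto simp: D_def)
  have disj: "disjoint_family_on D {..<m+2}"
  proof -
    have 1: "B \<inter> L (e i) = {}" "C \<inter> L (e i) = {}" if "i < m" for i
      using vB eV[OF that] by (auto simp: L_def V_def)
    have 2: "L (e i) \<inter> L (e j) = {}" if "i < m" "j < m" "i \<noteq> j" for i j
      using einj that by (auto simp: L_def)
    have 3: "D i \<inter> D j = {}" if "i < j" "j < m + 2" for i j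
    proof (cases "2 \<le> i")
      case True
      then have "i - 2 < m" "j - 2 < m" "i - 2 \<noteq> j - 2" using that by auto
      then show ?thesis using True that 2 by (auto simp: D_def)
    next
      case False
      then have "i = 0 \<or> i = 1" by auto
      moreover have "j = 1 \<or> j - 2 < m" using that by auto
      ultimately show ?thesis using 1[of "j - 2"] B(5) that by (auto simp: D_def)
    qed
    then show ?thesis unfolding disjoint_family_on_def by (metis Int_commute lessThan_iff linorder_neqE_nat)
  qed
  have indep: "indep_vars (\<lambda>_. borel) (\<lambda>i \<omega>. f i (count_in X (D i) \<omega>)) {..<m+2}"
    by (rule indep_vars_compose2[OF indep_counts]) (use D disj in auto)
  have e0: "0 \<le> e i" if "i < m" for i using eV[OF that] v(2) by (auto simp: V_def)
  have bnd: "\<bar>f i n\<bar> \<le> 1" if "i < m + 2" for i n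
    using e0[of "i - 2"] that by (auto simp: f_def)
  have int: "integrable M (\<lambda>\<omega>. f i (count_in X (D i) \<omega>))" if "i < m + 2" for i
  proof (rule integrable_const_bound[where B=1])
    have "count_in X (D i) \<in> M \<rightarrow>\<^sub>M count_space UNIV" using measurable_count D(1)[OF that] .
    then show "(\<lambda>\<omega>. f i (count_in X (D i) \<omega>)) \<in> borel_measurable M"
      by (rule measurable_compose) simp
  qed (use bnd[OF that] in auto)
  have "(\<Prod>i<m+2. f i (count_in X (D i) \<omega>)) = of_bool (count_in X B \<omega> = k \<and> count_in X C \<omega> = l) *
      exp (- (\<Sum>a\<in>V. a * real (count_in X (L a) \<omega>)))" for \<omega>
  proof -
    have "(\<Prod>i<m+2. f i (count_in X (D i) \<omega>)) = of_bool (count_in X B \<omega> = k) * (of_bool (count_in X C \<omega> = l) *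
      (\<Prod>i<m. exp (- e i * real (count_in X (L (e i)) \<omega>))))"
      by (simp add: prod.lessThan_Suc_shift f_def D_def del: prod.lessThan_Suc)
    also have "(\<Prod>i<m. exp (- e i * real (count_in X (L (e i)) \<omega>))) = (\<Prod>a\<in>V. exp (- a * real (count_in X (L a) \<omega>)))"
      by (rule prod.reindex_bij_betw[OF e])
    also have "\<dots> = exp (- (\<Sum>a\<in>V. a * real (count_in X (L a) \<omega>)))"
      by (simp add: exp_sum[OF fV] sum_negf[symmetric])
    finally show ?thesis by (simp add: of_bool_conj)
  qed
  note prod_eq = this
  \<comment> \<open>This holds only almost surely, because \<open>count_in\<close> takes the value 0
    on infinite sets; finiteness of all level counts makes the series a finite sum that can be
    grouped by level.\<close>
  have AEsum: "AE \<omega> in M. (\<Sum>n. v (X n \<omega>)) = (\<Sum>a\<in>V. a * real (count_in X (L a) \<omega>))"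
  proof -
    have "AE \<omega> in M. \<forall>a\<in>V. finite {n. X n \<omega> \<in> L a}"
      using fV AE_finite_count[OF L] by (intro AE_finite_allI) auto
    then show ?thesis
    proof eventually_elim
      case (elim \<omega>)
      have fin: "finite {n. v (X n \<omega>) \<noteq> 0}"
      proof (rule finite_subset)
        show "{n. v (X n \<omega>) \<noteq> 0} \<subseteq> (\<Union>a\<in>V. {n. X n \<omega> \<in> L a})" by (auto simp: V_def L_def)
      qed (use fV elim in auto)
      have "(\<Sum>n. v (X n \<omega>)) = (\<Sum>n\<in>{n. v (X n \<omega>) \<noteq> 0}. v (X n \<omega>))"
        by (rule suminf_finite) (use fin in auto)
      also have "{n. v (X n \<omega>) \<noteq> 0} = (\<Union>a\<in>V. {n. X n \<omega> \<in> L a})" by (auto simp: V_def L_def)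
      also have "(\<Sum>n\<in>(\<Union>a\<in>V. {n. X n \<omega> \<in> L a}). v (X n \<omega>)) = (\<Sum>a\<in>V. \<Sum>n\<in>{n. X n \<omega> \<in> L a}. v (X n \<omega>))"
        by (rule sum.UNION_disjoint) (use fV elim in \<open>auto simp: L_def\<close>)
      also have "\<dots> = (\<Sum>a\<in>V. a * real (count_in X (L a) \<omega>))"
        by (rule sum.cong) (auto simp: L_def count_in_def)
      finally show ?case .
    qed
  qed
  have "(\<integral>x. 1 - exp (- v x) \<partial>lborel) = (\<integral>x. (\<Sum>a\<in>V. (1 - exp (- a)) * indicator (L a) x) \<partial>lborel)"
  proof (rule Bochner_Integration.integral_cong[OF refl])
    fix x
    have "(\<Sum>a\<in>V. (1 - exp (- a)) * indicator (L a) x) = (\<Sum>a\<in>V. if a = v x then 1 - exp (- a) else 0)"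
      by (rule sum.cong) (auto simp: L_def indicator_def)
    also have "\<dots> = 1 - exp (- v x)" using fV by (auto simp: V_def)
    finally show "1 - exp (- v x) = (\<Sum>a\<in>V. (1 - exp (- a)) * indicator (L a) x)" ..
  qed
  also have "\<dots> = (\<Sum>a\<in>V. (1 - exp (- a)) * measure lborel (L a))"
  proof (subst Bochner_Integration.integral_sum)
    fix a assume "a \<in> V"
    then show "integrable lborel (\<lambda>x. (1 - exp (- a)) * indicat_real (L a) x)"
      using L emeasure_bounded_finite by (intro integrable_mult_right integrable_real_indicator) auto
  qed simp
  finally have int_v: "(\<integral>x. 1 - exp (- v x) \<partial>lborel) = (\<Sum>a\<in>V. (1 - exp (- a)) * measure lborel (L a))" .
  have "expectation (\<lambda>\<omega>. of_bool (count_in X B \<omega> = k \<and> count_in X C \<omega> = l) * exp (- (\<Sum>n. v (X n \<omega>)))) =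
      expectation (\<lambda>\<omega>. \<Prod>i<m+2. f i (count_in X (D i) \<omega>))"
  proof (rule integral_cong_AE)
    note [measurable] = B(1,3)
    have [measurable]: "v \<in> borel_measurable borel" using v(1) by (rule borel_measurable_simple_function)
    show "(\<lambda>\<omega>. of_bool (count_in X B \<omega> = k \<and> count_in X C \<omega> = l) * exp (- (\<Sum>n. v (X n \<omega>)))) \<in> borel_measurable M"
      by measurable
    show "(\<lambda>\<omega>. \<Prod>i<m+2. f i (count_in X (D i) \<omega>)) \<in> borel_measurable M"
      using int by (intro borel_measurable_prod) auto
    show "AE \<omega> in M. of_bool (count_in X B \<omega> = k \<and> count_in X C \<omega> = l) * exp (- (\<Sum>n. v (X n \<omega>))) =
        (\<Prod>i<m+2. f i (count_in X (D i) \<omega>))"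
      unfolding prod_eq using AEsum by eventually_elim simp
  qed
  also have "\<dots> = (\<Prod>i<m+2. expectation (\<lambda>\<omega>. f i (count_in X (D i) \<omega>)))"
    by (rule indep_vars_lebesgue_integral[OF _ indep]) (use int in auto)
  also have "\<dots> = expectation (\<lambda>\<omega>. of_bool (count_in X B \<omega> = k)) * (expectation (\<lambda>\<omega>. of_bool (count_in X C \<omega> = l)) *
      (\<Prod>i<m. expectation (\<lambda>\<omega>. exp (- e i * real (count_in X (L (e i)) \<omega>)))))"
    by (simp add: prod.lessThan_Suc_shift f_def D_def del: prod.lessThan_Suc)
  also have "(\<Prod>i<m. expectation (\<lambda>\<omega>. exp (- e i * real (count_in X (L (e i)) \<omega>)))) =
      (\<Prod>a\<in>V. expectation (\<lambda>\<omega>. exp (- a * real (count_in X (L a) \<omega>))))"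
    by (rule prod.reindex_bij_betw[OF e])
  also have "\<dots> = (\<Prod>a\<in>V. exp (- rate * measure lborel (L a) * (1 - exp (- a))))"
    by (rule prod.cong[OF refl], rule expectation_exp_count) (use L v(2) in \<open>auto simp: V_def\<close>)
  also have "\<dots> = exp (- rate * (\<integral>x. 1 - exp (- v x) \<partial>lborel))"
    unfolding int_v by (simp add: exp_sum[OF fV, symmetric] sum_distrib_left mult_ac sum_negf)
  also have "expectation (\<lambda>\<omega>. of_bool (count_in X B \<omega> = k)) = \<P>(\<omega> in M. count_in X B \<omega> = k)"
    by (subst Bochner_Integration.integral_cong[OF refl, of M _ "indicator {\<omega>\<in>space M. count_in X B \<omega> = k}"])
       (auto simp: indicator_def intro!: arg_cong[where f=prob])
  also have "expectation (\<lambda>\<omega>. of_bool (count_in X C \<omega> = l)) = \<P>(\<omega> in M. count_in X C \<omega> = l)"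
    by (subst Bochner_Integration.integral_cong[OF refl, of M _ "indicator {\<omega>\<in>space M. count_in X C \<omega> = l}"])
       (auto simp: indicator_def intro!: arg_cong[where f=prob])
  finally show ?thesis by (simp add: mult.assoc)
qed

text \<open>Approximation from below by simple functions of bounded support. On the Lebesgue side
  \<open>1 - exp (- w)\<close> is dominated by \<open>v\<close>, on the probability side the
  integrand is at most 1.\<close>

lemma laplace_functional:
  fixes v :: "'a \<Rightarrow> real"
  assumes v: "integrable lborel v" "\<And>x. 0 \<le> v x"
    and B: "B \<in> sets borel" "bounded B" "C \<in> sets borel" "bounded C" "B \<inter> C = {}"
    and vB: "\<And>x. x \<in> B \<union> C \<Longrightarrow> v x = 0"
  shows "expectation (\<lambda>\<omega>. of_bool (count_in X B \<omega> = k \<and> count_in X C \<omega> = l) * exp (- (\<Sum>n. v (X n \<omega>)))) =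
    \<P>(\<omega> in M. count_in X B \<omega> = k) * \<P>(\<omega> in M. count_in X C \<omega> = l) *
      exp (- rate * (\<integral>x. 1 - exp (- v x) \<partial>lborel))"
proof -
  have mv [measurable]: "v \<in> borel_measurable borel" using borel_measurable_integrable[OF v(1)] by simp
  obtain f where f: "incseq f" "\<And>i. simple_function borel (f i)" "\<And>x. bdd_above (range (\<lambda>i. f i x))"
    "\<And>i x. 0 \<le> f i x" "v = (SUP i. f i)"
    using borel_measurable_implies_simple_function_sequence_real[OF mv v(2)] by metis
  \<comment> \<open>The cut-off to growing balls supplies the bounded support required in the simple
    case.\<close>
  define w where "w i x = f i x * indicator (cball 0 (real i)) x" for i x
  have fv: "f i x \<le> v x" for i x
    unfolding f(5) SUP_apply by (rule cSUP_upper[OF UNIV_I f(3)])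
  have fi: "f i x \<le> f j x" if "i \<le> j" for i j x using incseqD[OF f(1) that] by (simp add: le_fun_def)
  have flim: "(\<lambda>i. f i x) \<longlonglongrightarrow> v x" for x
    unfolding f(5) SUP_apply by (rule LIMSEQ_incseq_SUP[OF f(3)]) (auto simp: incseq_def fi)
  have w0: "0 \<le> w i x" "w i x \<le> v x" for i x using f(4) fv v(2) by (auto simp: w_def indicator_def)
  have ws: "simple_function borel (w i)" for i
    unfolding w_def by (intro simple_function_mult f(2) simple_function_indicator) auto
  have [measurable]: "w i \<in> borel_measurable borel" for i using ws by (rule borel_measurable_simple_function)
  have wlim: "(\<lambda>i. w i x) \<longlonglongrightarrow> v x" for x
  proof -
    obtain N where N: "norm x \<le> real N" using real_arch_simple by blast
    have "\<forall>\<^sub>F i in sequentially. f i x = w i x"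
      using eventually_ge_at_top[of N] by eventually_elim (use N in \<open>auto simp: w_def\<close>)
    with flim show ?thesis by (rule Lim_transform_eventually)
  qed
  let ?I = "\<lambda>\<omega>. of_bool (count_in X B \<omega> = k \<and> count_in X C \<omega> = l) :: real"
  have eq: "expectation (\<lambda>\<omega>. ?I \<omega> * exp (- (\<Sum>n. w i (X n \<omega>)))) =
    \<P>(\<omega> in M. count_in X B \<omega> = k) * \<P>(\<omega> in M. count_in X C \<omega> = l) *
      exp (- rate * (\<integral>x. 1 - exp (- w i x) \<partial>lborel))" for i
  proof (rule laplace_functional_simple[OF ws _ _ B])
    show "bounded {x. w i x \<noteq> 0}"
      by (rule bounded_subset[of "cball 0 (real i)"]) (auto simp: w_def indicator_def split: if_splits)
    show "w i x = 0" if "x \<in> B \<union> C" for x using w0[of i x] vB[OF that] by simp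
  qed (use w0 in auto)
  have "(\<lambda>i. \<integral>x. 1 - exp (- w i x) \<partial>lborel) \<longlonglongrightarrow> (\<integral>x. 1 - exp (- v x) \<partial>lborel)"
  proof (rule integral_dominated_convergence[where w=v])
    show "AE x in lborel. (\<lambda>i. 1 - exp (- w i x)) \<longlonglongrightarrow> 1 - exp (- v x)"
      by (intro AE_I2 tendsto_intros wlim)
    show "AE x in lborel. norm (1 - exp (- w i x)) \<le> v x" for i
    proof (rule AE_I2)
      fix x
      have "1 - exp (- w i x) \<le> w i x" using exp_ge_add_one_self[of "- w i x"] by simp
      then show "norm (1 - exp (- w i x)) \<le> v x" using w0[of i x] by auto
    qed
  qed (use v in auto)
  then have lim1: "(\<lambda>i. \<P>(\<omega> in M. count_in X B \<omega> = k) * \<P>(\<omega> in M. count_in X C \<omega> = l) *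
      exp (- rate * (\<integral>x. 1 - exp (- w i x) \<partial>lborel))) \<longlonglongrightarrow>
    \<P>(\<omega> in M. count_in X B \<omega> = k) * \<P>(\<omega> in M. count_in X C \<omega> = l) *
      exp (- rate * (\<integral>x. 1 - exp (- v x) \<partial>lborel))"
    by (intro tendsto_intros)
  note [measurable] = B(1,3)
  have lim2: "(\<lambda>i. expectation (\<lambda>\<omega>. ?I \<omega> * exp (- (\<Sum>n. w i (X n \<omega>))))) \<longlonglongrightarrow>
    expectation (\<lambda>\<omega>. ?I \<omega> * exp (- (\<Sum>n. v (X n \<omega>))))"
  proof (rule integral_dominated_convergence[where w="\<lambda>_. 1"])
    show "AE \<omega> in M. (\<lambda>i. ?I \<omega> * exp (- (\<Sum>n. w i (X n \<omega>)))) \<longlonglongrightarrow> ?I \<omega> * exp (- (\<Sum>n. v (X n \<omega>)))"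
      using AE_summable_points[OF v]
    proof eventually_elim
      case (elim \<omega>)
      \<comment> \<open>Tannery's theorem: each term converges and is dominated by the almost surely
        summable \<open>v (X n \<omega>)\<close>.\<close>
      have "(\<lambda>i. \<Sum>n. w i (X n \<omega>)) \<longlonglongrightarrow> (\<Sum>n. v (X n \<omega>))"
        by (rule tannerys_theorem[where M="\<lambda>n. v (X n \<omega>)", THEN conjunct2, THEN conjunct2])
           (use w0 wlim elim in \<open>auto intro: always_eventually\<close>)
      then show ?case by (intro tendsto_intros)
    qed
    show "AE \<omega> in M. norm (?I \<omega> * exp (- (\<Sum>n. w i (X n \<omega>)))) \<le> 1" for i
      using AE_summable_points[OF v]
    proof eventually_elim
      case (elim \<omega>)
      have "summable (\<lambda>n. w i (X n \<omega>))"
        by (rule summable_comparison_test'[OF elim, of 0]) (use w0 in auto)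
      then have "0 \<le> (\<Sum>n. w i (X n \<omega>))" using w0 by (intro suminf_nonneg) auto
      then show ?case by simp
    qed
  qed auto
  show ?thesis using LIMSEQ_unique[OF lim2] lim1 unfolding eq by blast
qed

end

section \<open>Independent sources and fading marks\<close>

text \<open>The joint law of \<open>U\<close> and \<open>V\<close> is the product law, so Fubini
  integrates out \<open>V\<close> alone. Independence is phrased through families of events, the
  form in which the model provides it.\<close>

lemma (in prob_space) nn_integral_indep_set:
  assumes ind: "indep_set F G"
    and U [measurable]: "U \<in> M \<rightarrow>\<^sub>M N" and V [measurable]: "V \<in> M \<rightarrow>\<^sub>M K"
    and UF: "\<And>A. A \<in> sets N \<Longrightarrow> U -` A \<inter> space M \<in> F" and VG: "\<And>A. A \<in> sets K \<Longrightarrow> V -` A \<inter> space M \<in> G"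
    and [measurable]: "f \<in> borel_measurable (N \<Otimes>\<^sub>M K)"
  shows "(\<integral>\<^sup>+\<omega>. f (U \<omega>, V \<omega>) \<partial>M) = (\<integral>\<^sup>+\<omega>. (\<integral>\<^sup>+v. f (U \<omega>, v) \<partial>distr M K V) \<partial>M)"
proof -
  interpret U: prob_space "distr M N U" by (rule prob_space_distr) measurable
  interpret V: prob_space "distr M K V" by (rule prob_space_distr) measurable
  have prod: "distr M N U \<Otimes>\<^sub>M distr M K V = distr M (N \<Otimes>\<^sub>M K) (\<lambda>\<omega>. (U \<omega>, V \<omega>))"
  proof (rule pair_measure_eqI)
    fix A B assume A: "A \<in> sets (distr M N U)" and B: "B \<in> sets (distr M K V)"
    have "(\<lambda>\<omega>. (U \<omega>, V \<omega>)) -` (A \<times> B) \<inter> space M = (U -` A \<inter> space M) \<inter> (V -` B \<inter> space M)" by auto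
    moreover have "prob ((U -` A \<inter> space M) \<inter> (V -` B \<inter> space M)) = prob (U -` A \<inter> space M) * prob (V -` B \<inter> space M)"
      by (rule indep_setD[OF ind UF VG]) (use A B in auto)
    ultimately show "emeasure (distr M N U) A * emeasure (distr M K V) B =
        emeasure (distr M (N \<Otimes>\<^sub>M K) (\<lambda>\<omega>. (U \<omega>, V \<omega>))) (A \<times> B)"
      using A B by (simp add: emeasure_distr emeasure_eq_measure ennreal_mult')
  qed (auto intro: U.sigma_finite_measure_axioms V.sigma_finite_measure_axioms)
  have "(\<integral>\<^sup>+\<omega>. f (U \<omega>, V \<omega>) \<partial>M) = (\<integral>\<^sup>+z. f z \<partial>distr M (N \<Otimes>\<^sub>M K) (\<lambda>\<omega>. (U \<omega>, V \<omega>)))"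
    by (rule nn_integral_distr[symmetric]) measurable
  also have "\<dots> = (\<integral>\<^sup>+z. f z \<partial>(distr M N U \<Otimes>\<^sub>M distr M K V))"
    by (simp only: prod)
  also have "\<dots> = (\<integral>\<^sup>+u. \<integral>\<^sup>+v. f (u, v) \<partial>distr M K V \<partial>distr M N U)"
    by (rule V.nn_integral_fst[symmetric]) measurable
  also have "\<dots> = (\<integral>\<^sup>+\<omega>. (\<integral>\<^sup>+v. f (U \<omega>, v) \<partial>distr M K V) \<partial>M)"
    by (rule nn_integral_distr) measurable
  finally show ?thesis .
qed

text \<open>Exponential tilting: \<open>exp (- v * u)\<close> turns the density of rate 1 into a
  multiple of the density of rate \<open>1 + u\<close>, whose total mass is 1.\<close>

lemma nn_integral_erlang_exp:
  assumes u: "0 \<le> u"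
  shows "(\<integral>\<^sup>+v. ennreal (exp (- v * u)) \<partial>density lborel (\<lambda>x. ennreal (erlang_density k 1 x))) =
    ennreal ((1 / (1 + u)) ^ Suc k)"
proof -
  have "(\<integral>\<^sup>+v. ennreal (exp (- v * u)) \<partial>density lborel (\<lambda>x. ennreal (erlang_density k 1 x))) =
      (\<integral>\<^sup>+v. ennreal (erlang_density k 1 v) * ennreal (exp (- v * u)) \<partial>lborel)"
    by (subst nn_integral_density) auto
  also have "\<dots> = (\<integral>\<^sup>+v. ennreal ((1 / (1 + u)) ^ Suc k) * ennreal (erlang_density k (1 + u) v * v ^ 0) \<partial>lborel)"
  proof (rule nn_integral_cong)
    fix v
    have "erlang_density k 1 v * exp (- v * u) = (1 / (1 + u)) ^ Suc k * erlang_density k (1 + u) v"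
    proof (cases "v < 0")
      case False
      have "(1 / (1 + u)) ^ Suc k * (1 + u) ^ Suc k = 1" using u by (simp add: power_divide)
      moreover have "exp (- v) * exp (- v * u) = exp (- (1 + u) * v)"
        by (simp add: exp_add[symmetric] algebra_simps)
      ultimately show ?thesis using False u by (simp add: erlang_density_def power_divide)
    qed (simp add: erlang_density_def)
    then show "ennreal (erlang_density k 1 v) * ennreal (exp (- v * u)) =
        ennreal ((1 / (1 + u)) ^ Suc k) * ennreal (erlang_density k (1 + u) v * v ^ 0)"
      using u by (simp add: ennreal_mult'[symmetric])
  qed
  also have "\<dots> = ennreal ((1 / (1 + u)) ^ Suc k)"
    using u by (subst nn_integral_cmult) (use nn_integral_erlang_ith_moment[of "1 + u" k 0] in auto)
  finally show ?thesis .
qed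

lemma nn_integral_erlang_mean:
  "(\<integral>\<^sup>+v. ennreal v \<partial>density lborel (\<lambda>x. ennreal (erlang_density k 1 x))) = ennreal (real (Suc k))"
proof -
  have "(\<integral>\<^sup>+v. ennreal v \<partial>density lborel (\<lambda>x. ennreal (erlang_density k 1 x))) =
      (\<integral>\<^sup>+v. ennreal (erlang_density k 1 v * v ^ 1) \<partial>lborel)"
    by (subst nn_integral_density) (auto simp: ennreal_mult'[symmetric])
  also have "\<dots> = ennreal (fact (k + 1) / (fact k * 1 ^ 1))" by (rule nn_integral_erlang_ith_moment) simp
  also have "fact (k + 1) / (fact k * 1 ^ 1) = real (Suc k)" by (simp del: of_nat_Suc)
  finally show ?thesis .
qed

lemma radial_integral:
  fixes f :: "real \<Rightarrow> real"
  assumes [measurable]: "f \<in> borel_measurable borel"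
  shows "integrable lborel (\<lambda>x. f (norm (x::real^2))) \<longleftrightarrow> integrable lborel (\<lambda>r. indicator {0..} r * r * f r)"
    and "(\<integral>x. f (norm (x::real^2)) \<partial>lborel) = 2 * pi * (\<integral>r. indicator {0..} r * r * f r \<partial>lborel)"
proof -
  have nn: "AE r in lborel. 0 \<le> 2 * pi * r * indicator {0..} r"
    by (auto simp: indicator_def)
  have eq: "(2 * pi * r * indicator {0..} r) *\<^sub>R f r = (2 * pi) * (indicator {0..} r * r * f r)" for r :: real
    by simp
  have "integrable lborel (\<lambda>x. f (norm (x::real^2))) \<longleftrightarrow> integrable (distr lborel borel (norm :: real^2 \<Rightarrow> real)) f"
    by (rule integrable_distr_eq[symmetric]) auto
  also have "\<dots> \<longleftrightarrow> integrable lborel (\<lambda>r. (2 * pi * r * indicator {0..} r) *\<^sub>R f r)"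
    unfolding distr_norm_real2 by (rule integrable_density) (use nn in auto)
  finally show "integrable lborel (\<lambda>x. f (norm (x::real^2))) \<longleftrightarrow> integrable lborel (\<lambda>r. indicator {0..} r * r * f r)"
    unfolding eq by simp
  have "(\<integral>x. f (norm (x::real^2)) \<partial>lborel) = (\<integral>r. f r \<partial>distr lborel borel (norm :: real^2 \<Rightarrow> real))"
    by (rule integral_distr[symmetric]) auto
  also have "\<dots> = (\<integral>r. (2 * pi * r * indicator {0..} r) *\<^sub>R f r \<partial>lborel)"
    unfolding distr_norm_real2 by (rule integral_density) (use nn in auto)
  finally show "(\<integral>x. f (norm (x::real^2)) \<partial>lborel) = 2 * pi * (\<integral>r. indicator {0..} r * r * f r \<partial>lborel)"
    unfolding eq by simp
qed

section \<open>Sigma-algebras generated by groups of sources, and integrating out the marks\<close>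

locale hetnet_sources =
  fixes M :: "'w measure" and H :: hetnet
    and X :: "tier \<Rightarrow> nat \<Rightarrow> 'w \<Rightarrow> real^2"
    and g :: "tier \<Rightarrow> nat \<Rightarrow> 'w \<Rightarrow> real" and h :: "tier \<Rightarrow> 'w \<Rightarrow> real"
  assumes valid: "valid_hetnet H" and model: "hetnet_model M H X g h"
begin

sublocale prob_space M
  using model by (simp add: hetnet_model_def)

definition source_sigma :: "source set \<Rightarrow> 'w measure" where
  "source_sigma J = sigma (space M) (\<Union>src\<in>J. source_events M X g h src)"

lemma source_events_subset: "source_events M X g h src \<subseteq> Pow (space M)"
  using sets.space_closed by (fastforce simp: source_events_def split: source.splits)

lemma space_source_sigma [simp]: "space (source_sigma J) = space M"
  unfolding source_sigma_def by (rule space_measure_of) (use source_events_subset in blast)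

lemma sets_source_sigma: "sets (source_sigma J) = sigma_sets (space M) (\<Union>src\<in>J. source_events M X g h src)"
  unfolding source_sigma_def by (rule sets_measure_of) (use source_events_subset in blast)

lemma measurable_source_sigmaI:
  assumes "src \<in> J" and f: "f \<in> N \<rightarrow>\<^sub>M K" and "space N = space M" "sets N = source_events M X g h src"
  shows "f \<in> source_sigma J \<rightarrow>\<^sub>M K"
proof (rule measurableI)
  fix x assume "x \<in> space (source_sigma J)"
  then show "f x \<in> space K" using measurable_space[OF f] assms(3) by simp
next
  fix A assume "A \<in> sets K"
  then have "f -` A \<inter> space M \<in> source_events M X g h src"
    using measurable_sets[OF f] assms by simp
  then show "f -` A \<inter> space (source_sigma J) \<in> sets (source_sigma J)"
    using assms(1) by (auto simp: sets_source_sigma)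
qed

lemma measurable_points:
  assumes "Points j \<in> J" shows "X j n \<in> borel_measurable (source_sigma J)"
proof (rule measurable_source_sigmaI[OF assms])
  let ?V = "vimage_algebra (space M) (\<lambda>\<omega> n. X j n \<omega>) (PiM UNIV (\<lambda>_. borel))"
  have "(\<lambda>\<omega> n. X j n \<omega>) \<in> ?V \<rightarrow>\<^sub>M PiM UNIV (\<lambda>_. borel)"
    by (rule measurable_vimage_algebra1) (auto simp: space_PiM)
  from measurable_compose[OF this measurable_component_singleton[of n]]
  show "X j n \<in> ?V \<rightarrow>\<^sub>M borel" by simp
qed (simp_all add: source_events_def)

lemma measurable_interf:
  "Interf j n \<in> J \<Longrightarrow> g j n \<in> borel_measurable (source_sigma J)"
  by (rule measurable_source_sigmaI[where N="vimage_algebra (space M) (g j n) borel"])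
     (auto simp: source_events_def intro!: measurable_vimage_algebra1)

lemma measurable_signal:
  "Signal l \<in> J \<Longrightarrow> h l \<in> borel_measurable (source_sigma J)"
  by (rule measurable_source_sigmaI[where N="vimage_algebra (space M) (h l) borel"])
     (auto simp: source_events_def intro!: measurable_vimage_algebra1)

lemma indep_source_events: "indep_sets (source_events M X g h) UNIV"
  using model by (simp add: hetnet_model_def)

lemma source_sigma_le: "sets (source_sigma J) \<subseteq> sets M"
proof -
  have "source_events M X g h src \<subseteq> sets M" for src
    using indep_source_events by (auto simp: indep_sets_def)
  then show ?thesis unfolding sets_source_sigma by (intro sets.sigma_sets_subset) blast
qed

lemma measurable_source_sigma_imp: "f \<in> source_sigma J \<rightarrow>\<^sub>M N \<Longrightarrow> f \<in> M \<rightarrow>\<^sub>M N"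
  using source_sigma_le[of J] by (auto simp: measurable_def)

text \<open>The events of every single source are closed under intersection, so independence of the
  sources passes to the sigma-algebras generated by disjoint groups of them.\<close>

lemma indep_set_source_sigma:
  assumes JK: "J \<inter> K = {}"
  shows "indep_set (sets (source_sigma J)) (sets (source_sigma K))"
proof -
  have "indep_sets (\<lambda>b. sigma_sets (space M) (\<Union>src\<in>case_bool J K b. source_events M X g h src)) UNIV"
  proof (rule indep_sets_collect_sigma)
    show "indep_sets (source_events M X g h) (\<Union>b\<in>UNIV. case_bool J K b)"
      by (rule indep_sets_mono_index[OF _ indep_source_events]) auto
    show "Int_stable (source_events M X g h i)" for i
      by (auto simp: source_events_def Int_stable_def split: source.splits)
    show "disjoint_family_on (case_bool J K) UNIV"
      using JK by (auto simp: disjoint_family_on_def split: bool.splits)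
  qed
  then show ?thesis
    unfolding indep_set_def
    by (rule indep_sets_cong[THEN iffD1, rotated -1]) (auto simp: sets_source_sigma split: bool.split)
qed

lemma nn_integral_source_sigma:
  assumes U: "U \<in> source_sigma J \<rightarrow>\<^sub>M N" and V: "V \<in> source_sigma K \<rightarrow>\<^sub>M L" and JK: "J \<inter> K = {}"
    and f: "f \<in> borel_measurable (N \<Otimes>\<^sub>M L)"
  shows "(\<integral>\<^sup>+\<omega>. f (U \<omega>, V \<omega>) \<partial>M) = (\<integral>\<^sup>+\<omega>. (\<integral>\<^sup>+v. f (U \<omega>, v) \<partial>distr M L V) \<partial>M)"
  by (rule nn_integral_indep_set[OF indep_set_source_sigma[OF JK] measurable_source_sigma_imp[OF U]
        measurable_source_sigma_imp[OF V] _ _ f])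
     (use measurable_sets[OF U] measurable_sets[OF V] in auto)

lemma ppp_points: "ppp M (X j) (dens H j)"
  using model hetnet_pos(1)[OF valid] by unfold_locales (auto simp: hetnet_model_def)

lemma distributed_interf: "distributed M lborel (g j n) (\<lambda>x. ennreal (erlang_density (users H j - 1) 1 x))"
  using model by (simp add: hetnet_model_def)

lemma distributed_signal: "distributed M lborel (h l) (\<lambda>x. ennreal (erlang_density (dof H l - 1) 1 x))"
  using model by (simp add: hetnet_model_def)

lemma distr_interf: "distr M borel (g j n) = density lborel (\<lambda>x. ennreal (erlang_density (users H j - 1) 1 x))"
  using distributed_distr_eq_density[OF distributed_interf] by (simp cong: distr_cong)

lemma AE_interf_pos: "AE \<omega> in M. 0 < g j n \<omega>"
proof -
  have [measurable]: "g j n \<in> borel_measurable M"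
    using distributed_measurable[OF distributed_interf] by simp
  have "AE x in distr M borel (g j n). 0 < x"
  proof -
    have "AE x in lborel. x \<noteq> (0::real)" by (rule AE_lborel_singleton)
    then show ?thesis
      unfolding distr_interf by (subst AE_density) (auto elim!: eventually_mono simp: erlang_density_def)
  qed
  then show ?thesis by (subst (asm) AE_distr_iff) auto
qed

lemma measurable_X [measurable]: "X j n \<in> borel_measurable M"
  by (rule measurable_source_sigma_imp[OF measurable_points[OF UNIV_I]])

lemma measurable_g [measurable]: "g j n \<in> borel_measurable M"
  by (rule measurable_source_sigma_imp[OF measurable_interf[OF UNIV_I]])

lemma measurable_h [measurable]: "h l \<in> borel_measurable M"
  by (rule measurable_source_sigma_imp[OF measurable_signal[OF UNIV_I]])

text \<open>The marks are integrated out one by one, the last index first. The factor left behind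
  depends on the points only and is absorbed into \<open>Y\<close>, which is why \<open>Y\<close> is
  arbitrary in the induction.\<close>

lemma nn_integral_marks_finite:
  fixes u :: "real^2 \<Rightarrow> real" and Y :: "'w \<Rightarrow> real"
  assumes [measurable]: "u \<in> borel_measurable borel" and u: "\<And>x. 0 \<le> u x"
    and "Y \<in> borel_measurable (source_sigma {Points j})" "\<And>\<omega>. 0 \<le> Y \<omega>"
  shows "(\<integral>\<^sup>+\<omega>. ennreal (Y \<omega> * (\<Prod>n<N. exp (- g j n \<omega> * u (X j n \<omega>)))) \<partial>M) =
    (\<integral>\<^sup>+\<omega>. ennreal (Y \<omega> * (\<Prod>n<N. (1 / (1 + u (X j n \<omega>))) ^ users H j)) \<partial>M)"
  using assms(3,4)
proof (induction N arbitrary: Y)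
  case (Suc N)
  \<comment> \<open>The sources behind everything except the last mark, and disjoint from
    \<open>Interf j N\<close>.\<close>
  let ?J = "insert (Points j) (Interf j ` {..<N})"
  let ?U = "\<lambda>\<omega>. (Y \<omega> * (\<Prod>n<N. exp (- g j n \<omega> * u (X j n \<omega>))), u (X j N \<omega>))"
  let ?f = "\<lambda>z :: (real \<times> real) \<times> real. ennreal (fst (fst z) * exp (- snd z * snd (fst z)))"
  have mono: "f \<in> borel_measurable (source_sigma ?J)" if "f \<in> borel_measurable (source_sigma {Points j})"
    for f :: "'w \<Rightarrow> real"
  proof -
    have "sets (source_sigma {Points j}) \<subseteq> sets (source_sigma ?J)"
      unfolding sets_source_sigma by (rule sigma_sets_mono') auto
    then show ?thesis using that by (auto simp: measurable_def)
  qed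
  have [measurable]: "Y \<in> borel_measurable (source_sigma ?J)" by (rule mono[OF Suc.prems(1)])
  have [measurable]: "X j n \<in> borel_measurable (source_sigma ?J)" for n by (rule measurable_points) simp
  have "(\<lambda>\<omega>. \<Prod>n<N. exp (- g j n \<omega> * u (X j n \<omega>))) \<in> borel_measurable (source_sigma ?J)"
  proof (rule borel_measurable_prod)
    fix n assume "n \<in> {..<N}"
    then have [measurable]: "g j n \<in> borel_measurable (source_sigma ?J)" by (intro measurable_interf) auto
    show "(\<lambda>\<omega>. exp (- g j n \<omega> * u (X j n \<omega>))) \<in> borel_measurable (source_sigma ?J)" by measurable
  qed
  then have U: "?U \<in> source_sigma ?J \<rightarrow>\<^sub>M borel \<Otimes>\<^sub>M borel" by measurable
  have V: "g j N \<in> source_sigma {Interf j N} \<rightarrow>\<^sub>M borel" by (rule measurable_interf) simp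
  have "(\<integral>\<^sup>+\<omega>. ennreal (Y \<omega> * (\<Prod>n<Suc N. exp (- g j n \<omega> * u (X j n \<omega>)))) \<partial>M) =
      (\<integral>\<^sup>+\<omega>. ?f (?U \<omega>, g j N \<omega>) \<partial>M)"
    by (simp add: mult.assoc)
  also have "\<dots> = (\<integral>\<^sup>+\<omega>. (\<integral>\<^sup>+v. ?f (?U \<omega>, v) \<partial>distr M borel (g j N)) \<partial>M)"
    by (rule nn_integral_source_sigma[OF U V]) auto
  also have "\<dots> = (\<integral>\<^sup>+\<omega>. ennreal ((Y \<omega> * (1 / (1 + u (X j N \<omega>))) ^ users H j) *
      (\<Prod>n<N. exp (- g j n \<omega> * u (X j n \<omega>)))) \<partial>M)"
  proof (rule nn_integral_cong)
    fix \<omega>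
    define y where "y = Y \<omega> * (\<Prod>n<N. exp (- g j n \<omega> * u (X j n \<omega>)))"
    have y: "0 \<le> y" unfolding y_def by (intro mult_nonneg_nonneg prod_nonneg Suc.prems(2)) simp
    have "(\<integral>\<^sup>+v. ?f (?U \<omega>, v) \<partial>distr M borel (g j N)) =
        (\<integral>\<^sup>+v. ennreal y * ennreal (exp (- v * u (X j N \<omega>))) \<partial>distr M borel (g j N))"
      using y by (simp add: y_def ennreal_mult')
    also have "\<dots> = ennreal y * ennreal ((1 / (1 + u (X j N \<omega>))) ^ Suc (users H j - 1))"
      unfolding distr_interf by (subst nn_integral_cmult) (simp, simp only: nn_integral_erlang_exp[OF u])
    also have "Suc (users H j - 1) = users H j" using hetnet_pos(4)[OF valid, of j] by simp
    finally show "(\<integral>\<^sup>+v. ?f (?U \<omega>, v) \<partial>distr M borel (g j N)) =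
      ennreal ((Y \<omega> * (1 / (1 + u (X j N \<omega>))) ^ users H j) * (\<Prod>n<N. exp (- g j n \<omega> * u (X j n \<omega>))))"
      using y u by (simp add: y_def ennreal_mult'[symmetric] mult_ac)
  qed
  also have "\<dots> = (\<integral>\<^sup>+\<omega>. ennreal ((Y \<omega> * (1 / (1 + u (X j N \<omega>))) ^ users H j) *
      (\<Prod>n<N. (1 / (1 + u (X j n \<omega>))) ^ users H j)) \<partial>M)"
  proof (rule Suc.IH)
    have [measurable]: "X j N \<in> borel_measurable (source_sigma {Points j})" by (rule measurable_points) simp
    note [measurable] = Suc.prems(1)
    show "(\<lambda>\<omega>. Y \<omega> * (1 / (1 + u (X j N \<omega>))) ^ users H j) \<in> borel_measurable (source_sigma {Points j})"
      by measurable
  qed (use Suc.prems(2) u in auto)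
  finally show ?case by (simp add: mult_ac)
qed simp

section \<open>Shot noise of the points beyond a fixed radius\<close>

definition kernel :: "tier \<Rightarrow> real \<Rightarrow> real^2 \<Rightarrow> real" where
  "kernel j c x = tx_power H j * norm x powr (- pathloss H) * indicator {c<..} (norm x)"

text \<open>The radius is deterministic and no point is singled out as the server, so this is an
  ordinary shot noise to which the Laplace functional applies; the cut-off in \<open>kernel\<close>
  keeps the path-loss singularity at the user away.\<close>

definition outer_shot :: "tier \<Rightarrow> real \<Rightarrow> 'w \<Rightarrow> real" where
  "outer_shot j c \<omega> = (\<Sum>n. g j n \<omega> * kernel j c (X j n \<omega>))"

lemma kernel_nonneg: "0 \<le> kernel j c x"
  using hetnet_pos[OF valid] by (simp add: kernel_def less_imp_le)

lemma measurable_kernel [measurable]: "kernel j c \<in> borel_measurable borel"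
  unfolding kernel_def[abs_def] by measurable

lemma integrable_kernel:
  assumes c: "0 < c"
  shows "integrable lborel (kernel j c)"
proof -
  have "set_integrable lborel {c<..} (\<lambda>r. tx_power H j * r powr (1 - pathloss H))"
    by (intro set_integrable_mult_right set_integrable_powr_at_top) (use c hetnet_pos(5)[OF valid] in auto)
  moreover have "indicat_real {c<..} r *\<^sub>R (tx_power H j * r powr (1 - pathloss H)) =
    indicator {0..} r * r * (tx_power H j * r powr (- pathloss H) * indicator {c<..} r)" for r
    using c by (auto simp: indicator_def powr_diff powr_minus_divide)
  ultimately have "integrable lborel (\<lambda>r. indicator {0..} r * r * (tx_power H j * r powr (- pathloss H) * indicator {c<..} r))"
    by (simp only: set_integrable_def)
  then show ?thesis
    unfolding kernel_def[abs_def]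
    by (subst radial_integral(1)[of "\<lambda>r. tx_power H j * r powr (- pathloss H) * indicator {c<..} r"]) auto
qed

lemma AE_interf_pos_all: "AE \<omega> in M. \<forall>j n. 0 < g j n \<omega>"
proof -
  have "AE \<omega> in M. \<forall>n. 0 < g j n \<omega>" for j by (simp add: AE_all_countable AE_interf_pos)
  from this[of MBS] this[of SBS] show ?thesis
    by eventually_elim (metis tier.exhaust)
qed

text \<open>In the mean of the series each mark may be replaced by its expectation
  \<open>users H j\<close>; Campbell's formula then bounds the mean by an integral of the
  kernel.\<close>

lemma AE_summable_outer_shot:
  assumes c: "0 < c"
  shows "AE \<omega> in M. summable (\<lambda>n. g j n \<omega> * kernel j c (X j n \<omega>))"
proof -
  interpret P: ppp M "X j" "dens H j" by (rule ppp_points)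
  have mean: "(\<integral>\<^sup>+\<omega>. ennreal (kernel j c (X j n \<omega>)) * ennreal (g j n \<omega>) \<partial>M) =
      (\<integral>\<^sup>+\<omega>. ennreal (kernel j c (X j n \<omega>)) * ennreal (real (users H j)) \<partial>M)" for n
  proof -
    have [measurable]: "X j n \<in> borel_measurable (source_sigma {Points j})" by (rule measurable_points) simp
    have U: "(\<lambda>\<omega>. kernel j c (X j n \<omega>)) \<in> source_sigma {Points j} \<rightarrow>\<^sub>M borel" by measurable
    have V: "g j n \<in> source_sigma {Interf j n} \<rightarrow>\<^sub>M borel" by (rule measurable_interf) simp
    have "(\<integral>\<^sup>+\<omega>. ennreal (kernel j c (X j n \<omega>)) * ennreal (g j n \<omega>) \<partial>M) =
        (\<integral>\<^sup>+\<omega>. (\<integral>\<^sup>+v. ennreal (kernel j c (X j n \<omega>)) * ennreal v \<partial>distr M borel (g j n)) \<partial>M)"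
      using nn_integral_source_sigma[OF U V, of "\<lambda>z. ennreal (fst z) * ennreal (snd z)"] by simp
    also have "\<dots> = (\<integral>\<^sup>+\<omega>. ennreal (kernel j c (X j n \<omega>)) * ennreal (real (users H j)) \<partial>M)"
    proof (rule nn_integral_cong)
      fix \<omega>
      have "(\<integral>\<^sup>+v. ennreal v \<partial>distr M borel (g j n)) = ennreal (real (users H j))"
        unfolding distr_interf nn_integral_erlang_mean using hetnet_pos(4)[OF valid, of j] by simp
      then show "(\<integral>\<^sup>+v. ennreal (kernel j c (X j n \<omega>)) * ennreal v \<partial>distr M borel (g j n)) =
          ennreal (kernel j c (X j n \<omega>)) * ennreal (real (users H j))"
        by (subst nn_integral_cmult) auto
    qed
    finally show ?thesis .
  qed
  have "(\<integral>\<^sup>+\<omega>. (\<Sum>n. ennreal (kernel j c (X j n \<omega>)) * ennreal (g j n \<omega>)) \<partial>M) =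
      (\<Sum>n. \<integral>\<^sup>+\<omega>. ennreal (kernel j c (X j n \<omega>)) * ennreal (real (users H j)) \<partial>M)"
    by (subst nn_integral_suminf) (simp_all add: mean)
  also have "\<dots> = (\<integral>\<^sup>+\<omega>. (\<Sum>n. ennreal (kernel j c (X j n \<omega>)) * ennreal (real (users H j))) \<partial>M)"
    by (rule nn_integral_suminf[symmetric]) measurable
  also have "\<dots> = ennreal (dens H j) * (\<integral>\<^sup>+x. ennreal (kernel j c x) * ennreal (real (users H j)) \<partial>lborel)"
    by (rule P.campbell) measurable
  also have "\<dots> \<noteq> \<infinity>"
    by (subst nn_integral_multc, simp, subst nn_integral_eq_integral[OF integrable_kernel[OF c]])
       (auto simp: kernel_nonneg ennreal_mult_eq_top_iff)
  finally have "AE \<omega> in M. (\<Sum>n. ennreal (kernel j c (X j n \<omega>)) * ennreal (g j n \<omega>)) \<noteq> \<infinity>"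
    by (intro nn_integral_noteq_infinite) auto
  with AE_interf_pos_all show ?thesis
  proof eventually_elim
    case (elim \<omega>)
    have "ennreal (kernel j c (X j n \<omega>)) * ennreal (g j n \<omega>) = ennreal (g j n \<omega> * kernel j c (X j n \<omega>))" for n
      using elim(1) by (simp add: ennreal_mult' mult.commute less_imp_le)
    then have "(\<Sum>n. ennreal (g j n \<omega> * kernel j c (X j n \<omega>))) \<noteq> \<top>" using elim(2) by simp
    then show ?case
      using elim(1) kernel_nonneg by (intro summable_suminf_not_top) (auto simp: less_imp_le)
  qed
qed

lemma measurable_outer_shot:
  assumes [measurable]: "\<And>n. X j n \<in> borel_measurable N" "\<And>n. g j n \<in> borel_measurable N"
  shows "outer_shot j c \<in> borel_measurable N"
  unfolding outer_shot_def[abs_def] by measurable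

lemma outer_shot_nonneg: "AE \<omega> in M. 0 \<le> outer_shot j c \<omega>" if "0 < c"
  using AE_interf_pos_all AE_summable_outer_shot[OF that, of j]
  by eventually_elim (auto simp: outer_shot_def kernel_nonneg less_imp_le intro!: suminf_nonneg)

text \<open>After the marks are integrated out, the factors \<open>(1 + u)\<close> to the power
  \<open>- users H j\<close> are written as exponentials of logarithms, which gives a Laplace
  functional of the unmarked process. \<open>Y\<close> depends on the points only and will carry the
  count event.\<close>

lemma expectation_exp_outer_shot:
  assumes c: "0 < c" and s: "0 \<le> s"
    and Ym: "Y \<in> borel_measurable (source_sigma {Points j})" and Y: "\<And>\<omega>. 0 \<le> Y \<omega>" "\<And>\<omega>. Y \<omega> \<le> 1"
  shows "expectation (\<lambda>\<omega>. Y \<omega> * exp (- s * outer_shot j c \<omega>)) =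
    expectation (\<lambda>\<omega>. Y \<omega> * exp (- (\<Sum>n. real (users H j) * ln (1 + s * kernel j c (X j n \<omega>)))))"
proof -
  interpret P: ppp M "X j" "dens H j" by (rule ppp_points)
  have [measurable]: "Y \<in> borel_measurable M" by (rule measurable_source_sigma_imp[OF Ym])
  let ?\<psi> = "users H j"
  let ?u = "\<lambda>x. s * kernel j c x"
  define v where "v x = real ?\<psi> * ln (1 + ?u x)" for x
  have u: "0 \<le> ?u x" for x using s kernel_nonneg by simp
  have v: "0 \<le> v x" "v x \<le> real ?\<psi> * ?u x" for x
    using u[of x] ln_add_one_self_le_self[OF u[of x]] by (auto simp: v_def intro!: mult_left_mono)
  have [measurable]: "v \<in> borel_measurable borel" unfolding v_def[abs_def] by measurable
  have "integrable lborel v"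
    by (rule Bochner_Integration.integrable_bound[of _ "\<lambda>x. real ?\<psi> * ?u x"])
       (use integrable_kernel[OF c] v u in \<open>auto simp: abs_of_nonneg\<close>)
  then have sumv: "AE \<omega> in M. summable (\<lambda>n. v (X j n \<omega>))" using v by (intro P.AE_summable_points)
  let ?a = "\<lambda>N \<omega>. Y \<omega> * (\<Prod>n<N. exp (- g j n \<omega> * ?u (X j n \<omega>)))"
  let ?b = "\<lambda>N \<omega>. Y \<omega> * (\<Prod>n<N. (1 / (1 + ?u (X j n \<omega>))) ^ ?\<psi>)"
  have b: "?b N \<omega> = Y \<omega> * exp (- (\<Sum>n<N. v (X j n \<omega>)))" for N \<omega>
  proof -
    have "(1 / (1 + ?u x)) ^ ?\<psi> = exp (- v x)" for x
    proof -
      have "exp (- v x) = exp (ln (1 + ?u x)) powr (- real ?\<psi>)" by (simp add: v_def powr_def)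
      also have "\<dots> = (1 / (1 + ?u x)) ^ ?\<psi>"
        using u[of x] by (simp add: powr_minus_divide powr_realpow power_divide add_pos_nonneg)
      finally show ?thesis ..
    qed
    then show ?thesis by (simp add: exp_sum[symmetric] sum_negf)
  qed
  have a: "?a N \<omega> = Y \<omega> * exp (- s * (\<Sum>n<N. g j n \<omega> * kernel j c (X j n \<omega>)))" for N \<omega>
    by (simp add: exp_sum[symmetric] sum_negf sum_distrib_left mult_ac)
  have eq: "expectation (?a N) = expectation (?b N)" for N
  proof -
    have "(\<integral>\<^sup>+\<omega>. ennreal (?a N \<omega>) \<partial>M) = (\<integral>\<^sup>+\<omega>. ennreal (?b N \<omega>) \<partial>M)"
      by (rule nn_integral_marks_finite[OF _ u Ym Y(1)]) measurable
    moreover have "expectation (?a N) = enn2real (\<integral>\<^sup>+\<omega>. ennreal (?a N \<omega>) \<partial>M)"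
      unfolding a by (rule integral_eq_nn_integral) (use Y in \<open>auto intro!: AE_I2\<close>)
    moreover have "expectation (?b N) = enn2real (\<integral>\<^sup>+\<omega>. ennreal (?b N \<omega>) \<partial>M)"
      unfolding b by (rule integral_eq_nn_integral) (use Y in \<open>auto intro!: AE_I2\<close>)
    ultimately show ?thesis by simp
  qed
  have "(\<lambda>N. expectation (?a N)) \<longlonglongrightarrow> expectation (\<lambda>\<omega>. Y \<omega> * exp (- s * outer_shot j c \<omega>))"
    unfolding a
  proof (rule integral_dominated_convergence[where w="\<lambda>_. 1"])
    show "(\<lambda>\<omega>. Y \<omega> * exp (- s * outer_shot j c \<omega>)) \<in> borel_measurable M"
      using measurable_outer_shot[OF measurable_X measurable_g] by measurable
    show "AE \<omega> in M. (\<lambda>N. Y \<omega> * exp (- s * (\<Sum>n<N. g j n \<omega> * kernel j c (X j n \<omega>)))) \<longlonglongrightarrow> Y \<omega> * exp (- s * outer_shot j c \<omega>)"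
      using AE_summable_outer_shot[OF c, of j]
      by eventually_elim (auto simp: outer_shot_def intro!: tendsto_intros summable_LIMSEQ)
    show "AE \<omega> in M. norm (Y \<omega> * exp (- s * (\<Sum>n<N. g j n \<omega> * kernel j c (X j n \<omega>)))) \<le> 1" for N
      using AE_interf_pos_all
    proof eventually_elim
      case (elim \<omega>)
      have "0 \<le> s * (\<Sum>n<N. g j n \<omega> * kernel j c (X j n \<omega>))"
        using elim s kernel_nonneg by (intro mult_nonneg_nonneg sum_nonneg) (auto simp: less_imp_le)
      then show ?case using Y[of \<omega>] by (simp add: abs_mult mult_le_one)
    qed
  qed (use Y in auto)
  moreover have "(\<lambda>N. expectation (?b N)) \<longlonglongrightarrow> expectation (\<lambda>\<omega>. Y \<omega> * exp (- (\<Sum>n. v (X j n \<omega>))))"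
    unfolding b
  proof (rule integral_dominated_convergence[where w="\<lambda>_. 1"])
    show "AE \<omega> in M. (\<lambda>N. Y \<omega> * exp (- (\<Sum>n<N. v (X j n \<omega>)))) \<longlonglongrightarrow> Y \<omega> * exp (- (\<Sum>n. v (X j n \<omega>)))"
      using sumv by eventually_elim (auto intro!: tendsto_intros summable_LIMSEQ)
    show "AE \<omega> in M. norm (Y \<omega> * exp (- (\<Sum>n<N. v (X j n \<omega>)))) \<le> 1" for N
    proof (rule AE_I2)
      fix \<omega>
      have "0 \<le> (\<Sum>n<N. v (X j n \<omega>))" using v by (intro sum_nonneg) auto
      then show "norm (Y \<omega> * exp (- (\<Sum>n<N. v (X j n \<omega>)))) \<le> 1" using Y[of \<omega>] by (simp add: abs_mult mult_le_one)
    qed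
  qed (use Y in auto)
  ultimately show ?thesis unfolding eq v_def using LIMSEQ_unique by blast
qed

lemma shot_exponent_radial:
  assumes c: "0 < c" and s: "0 \<le> s"
  shows "(\<integral>x. 1 - exp (- (real (users H j) * ln (1 + s * kernel j c x))) \<partial>lborel) =
    2 * pi * shot_exponent (pathloss H) (users H j) (tx_power H j) c s"
proof -
  let ?f = "\<lambda>r. indicator {c<..} r * (1 - 1 / (1 + s * tx_power H j * r powr (- pathloss H)) ^ users H j)"
  have "1 - exp (- (real (users H j) * ln (1 + s * kernel j c x))) = ?f (norm x)" for x
  proof (cases "norm x > c")
    case True
    have "0 < 1 + s * kernel j c x" using s kernel_nonneg[of j c x] by (simp add: add_pos_nonneg)
    then have "exp (- (real (users H j) * ln (1 + s * kernel j c x))) = 1 / (1 + s * kernel j c x) ^ users H j"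
      by (simp add: exp_minus exp_of_nat_mult divide_inverse)
    then show ?thesis using True by (simp add: kernel_def mult.assoc)
  qed (simp add: kernel_def)
  then have "(\<integral>x. 1 - exp (- (real (users H j) * ln (1 + s * kernel j c x))) \<partial>lborel) =
      (\<integral>x. ?f (norm (x :: real^2)) \<partial>lborel)" by simp
  also have "\<dots> = 2 * pi * (\<integral>r. indicator {0..} r * r * ?f r \<partial>lborel)"
    by (rule radial_integral(2)) measurable
  also have "(\<integral>r. indicator {0..} r * r * ?f r \<partial>lborel) = shot_exponent (pathloss H) (users H j) (tx_power H j) c s"
    unfolding shot_exponent_def set_lebesgue_integral_def
    by (rule Bochner_Integration.integral_cong) (use c in \<open>auto simp: indicator_def\<close>)
  finally show ?thesis .
qed

text \<open>The kernel vanishes on \<open>cball 0 c\<close>, which contains both \<open>B\<close>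
  and \<open>C\<close>; therefore the counts there and the shot noise factorise.\<close>

lemma tier_laplace:
  assumes c: "0 < c" and s: "0 \<le> s"
    and B: "B \<in> sets borel" "B \<subseteq> cball 0 c" "C \<in> sets borel" "C \<subseteq> cball 0 c" "B \<inter> C = {}"
  shows "expectation (\<lambda>\<omega>. of_bool (count_in (X j) B \<omega> = k \<and> count_in (X j) C \<omega> = l) * exp (- s * outer_shot j c \<omega>)) =
    \<P>(\<omega> in M. count_in (X j) B \<omega> = k) * \<P>(\<omega> in M. count_in (X j) C \<omega> = l) *
      exp (- (2 * pi * dens H j * shot_exponent (pathloss H) (users H j) (tx_power H j) c s))"
proof -
  interpret P: ppp M "X j" "dens H j" by (rule ppp_points)
  let ?Y = "\<lambda>\<omega>. of_bool (count_in (X j) B \<omega> = k \<and> count_in (X j) C \<omega> = l) :: real"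
  let ?v = "\<lambda>x. real (users H j) * ln (1 + s * kernel j c x)"
  have [measurable]: "X j n \<in> borel_measurable (source_sigma {Points j})" for n by (rule measurable_points) simp
  have cm: "count_in (X j) D \<in> source_sigma {Points j} \<rightarrow>\<^sub>M count_space UNIV" if [measurable]: "D \<in> sets borel" for D
    unfolding count_in_def[abs_def] by (rule measurable_card) measurable
  have [measurable]: "count_in (X j) B \<in> source_sigma {Points j} \<rightarrow>\<^sub>M count_space UNIV"
    "count_in (X j) C \<in> source_sigma {Points j} \<rightarrow>\<^sub>M count_space UNIV" using cm B by auto
  have Y: "?Y \<in> borel_measurable (source_sigma {Points j})" by measurable
  have u: "0 \<le> s * kernel j c x" for x using s kernel_nonneg by simp
  have v: "0 \<le> ?v x" "?v x \<le> real (users H j) * (s * kernel j c x)" for x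
    using u[of x] ln_add_one_self_le_self[OF u[of x]] by (auto intro!: mult_left_mono)
  have iv: "integrable lborel ?v"
    by (rule Bochner_Integration.integrable_bound[of _ "\<lambda>x. real (users H j) * (s * kernel j c x)"])
       (use integrable_kernel[OF c] v u in \<open>auto simp: abs_of_nonneg\<close>)
  have "expectation (\<lambda>\<omega>. ?Y \<omega> * exp (- s * outer_shot j c \<omega>)) =
      expectation (\<lambda>\<omega>. ?Y \<omega> * exp (- (\<Sum>n. ?v (X j n \<omega>))))"
    by (rule expectation_exp_outer_shot[OF c s Y]) auto
  also have "\<dots> = \<P>(\<omega> in M. count_in (X j) B \<omega> = k) * \<P>(\<omega> in M. count_in (X j) C \<omega> = l) *
      exp (- dens H j * (\<integral>x. 1 - exp (- ?v x) \<partial>lborel))"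
  proof (rule P.laplace_functional[OF iv v(1) B(1) _ B(3) _ B(5)])
    show "bounded B" by (rule bounded_subset[OF bounded_cball B(2)])
    show "bounded C" by (rule bounded_subset[OF bounded_cball B(4)])
    show "?v x = 0" if "x \<in> B \<union> C" for x using that B by (auto simp: kernel_def dist_norm)
  qed
  finally show ?thesis unfolding shot_exponent_radial[OF c s] by (simp add: mult_ac)
qed

end

section \<open>Association and interference pathwise\<close>

text \<open>Serves measurability: unconditional and absolute summability of real families agree, and
  the default 0 of \<open>infsum\<close> outside that case is made explicit by a countable
  test.\<close>

lemma infsum_real_nat_eq:
  fixes f :: "nat \<Rightarrow> real"
  shows "infsum f S = (if (\<Sum>n. ennreal \<bar>f n * indicator S n\<bar>) = \<top> then 0 else (\<Sum>n. f n * indicator S n))"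
proof -
  let ?f = "\<lambda>n. f n * indicator S n"
  have *: "infsum f S = infsum ?f UNIV"
    by (rule infsum_cong_neutral) auto
  show ?thesis
  proof (cases "(\<Sum>n. ennreal \<bar>?f n\<bar>) = \<top>")
    case True
    have "\<not> ?f summable_on UNIV"
    proof
      assume "?f summable_on UNIV"
      then have "(\<lambda>n. \<bar>?f n\<bar>) summable_on UNIV"
        by (rule summable_on_iff_abs_summable_on_real[THEN iffD1, unfolded real_norm_def])
      then have "summable (\<lambda>n. \<bar>?f n\<bar>)" by (subst (asm) summable_on_UNIV_nonneg_real_iff) auto
      then have "(\<Sum>n. ennreal \<bar>?f n\<bar>) \<noteq> \<top>" by (rule ennreal_suminf_neq_top) auto
      then show False using True by simp
    qed
    then show ?thesis using True * by (simp add: infsum_not_exists)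
  next
    case False
    then have s: "summable (\<lambda>n. \<bar>?f n\<bar>)" by (intro summable_suminf_not_top) auto
    then have "(?f has_sum suminf ?f) UNIV"
      by (intro norm_summable_imp_has_sum summable_sums summable_rabs_cancel[OF s]) (simp only: real_norm_def)
    then show ?thesis using False * by (simp add: infsumI)
  qed
qed

section \<open>Measurability for any sigma-algebra with measurable points and marks, not only that
  of \<open>M\<close>\<close>

context
  fixes N :: "'w measure" and H :: hetnet
    and X :: "tier \<Rightarrow> nat \<Rightarrow> 'w \<Rightarrow> real^2" and g :: "tier \<Rightarrow> nat \<Rightarrow> 'w \<Rightarrow> real"
  assumes X [measurable]: "\<And>j n. X j n \<in> borel_measurable N"
begin

lemma measurable_nearest_dist [measurable]: "nearest_dist X j \<in> borel_measurable N"
  unfolding nearest_dist_def[abs_def]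
  by (rule borel_measurable_cINF) (auto intro!: bdd_belowI[of _ 0])

lemma measurable_nearest_index: "nearest_index X j \<in> N \<rightarrow>\<^sub>M count_space UNIV"
  unfolding nearest_index_def[abs_def] by (rule measurable_Least) measurable

lemma measurable_serving_tier: "serving_tier H X \<in> N \<rightarrow>\<^sub>M count_space UNIV"
  unfolding serving_tier_def[abs_def] biased_power_def by measurable

lemma measurable_serving_dist: "serving_dist H X \<in> borel_measurable N"
proof -
  have "serving_dist H X = (\<lambda>\<omega>. if serving_tier H X \<omega> = SBS then nearest_dist X SBS \<omega> else nearest_dist X MBS \<omega>)"
    by (auto simp: serving_dist_def fun_eq_iff serving_tier_def)
  moreover note measurable_serving_tier [measurable]
  ultimately show ?thesis by simp
qed

lemma measurable_interference:
  assumes g [measurable]: "\<And>j n. g j n \<in> borel_measurable N"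
  shows "interference H X g \<in> borel_measurable N"
proof -
  note measurable_serving_tier [measurable] measurable_nearest_index [measurable]
  have ind: "(\<lambda>\<omega>. indicator (interferers H X j \<omega>) n :: real) \<in> borel_measurable N" for j n
  proof -
    have "(\<lambda>\<omega>. indicator (interferers H X j \<omega>) n :: real) =
        (\<lambda>\<omega>. if j = serving_tier H X \<omega> \<and> n = nearest_index X j \<omega> then 0 else 1)"
      by (auto simp: interferers_def fun_eq_iff)
    also have "\<dots> \<in> borel_measurable N" by measurable
    finally show ?thesis .
  qed
  note [measurable] = ind
  show ?thesis
    unfolding interference_def[abs_def] infsum_real_nat_eq by measurable
qed

end

definition other_tier :: "tier \<Rightarrow> tier" where
  "other_tier l = (if l = MBS then SBS else MBS)"

lemma other_tier_simps [simp]: "other_tier l \<noteq> l" "l \<noteq> other_tier l" "other_tier MBS = SBS" "other_tier SBS = MBS"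
  by (cases l; simp add: other_tier_def)+

lemma UNIV_tier_other: "(UNIV :: tier set) = {l, other_tier l}"
  using UNIV_tier by (cases l) auto

lemma tier_neq_iff: "j \<noteq> l \<longleftrightarrow> j = other_tier l"
  by (cases j; cases l; simp)

section \<open>Almost sure path properties and the geometry of association\<close>

context hetnet_sources begin

text \<open>Collects the almost sure properties that make the remaining arguments of this part
  pathwise: locally finite, no point at the user, positive marks, summable shot noise at every
  positive cut-off.\<close>

definition regular_config :: "'w \<Rightarrow> bool" where
  "regular_config \<omega> \<longleftrightarrow> (\<forall>j r. finite {n. X j n \<omega> \<in> cball 0 r}) \<and> (\<forall>j n. X j n \<omega> \<noteq> 0) \<and>
    (\<forall>j n. 0 < g j n \<omega>) \<and> (\<forall>j c. 0 < c \<longrightarrow> summable (\<lambda>n. g j n \<omega> * kernel j c (X j n \<omega>)))"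

lemma AE_all_tiers: "(\<And>j :: tier. AE \<omega> in M. P j \<omega>) \<Longrightarrow> AE \<omega> in M. \<forall>j. P j \<omega>"
  by (rule AE_finite_allI[of UNIV, simplified]) (auto simp: UNIV_tier)

text \<open>The uncountably many radii and cut-offs reduce to natural radii and cut-offs
  \<open>1 / (k + 1)\<close>, by monotonicity. No point sits at the user because a singleton has
  Lebesgue measure zero.\<close>

lemma AE_regular_config: "AE \<omega> in M. regular_config \<omega>"
proof -
  have "AE \<omega> in M. \<forall>k::nat. finite {n. X j n \<omega> \<in> cball 0 (real k)}" for j
  proof -
    interpret P: ppp M "X j" "dens H j" by (rule ppp_points)
    show ?thesis unfolding AE_all_countable by (intro allI P.AE_finite_count) auto
  qed
  then have fin: "AE \<omega> in M. \<forall>j. \<forall>k::nat. finite {n. X j n \<omega> \<in> cball 0 (real k)}" by (rule AE_all_tiers)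
  have "AE \<omega> in M. \<forall>n. X j n \<omega> \<noteq> 0" for j
  proof -
    interpret P: ppp M "X j" "dens H j" by (rule ppp_points)
    have "prob {\<omega>\<in>space M. count_in (X j) {0} \<omega> = 0} = 1"
      using P.prob_count[of "{0}" 0] by simp
    then have "AE \<omega> in M. count_in (X j) {0} \<omega> = 0"
      by (subst (asm) prob_Collect_eq_1) (auto intro!: measurable_sets_Collect[OF P.measurable_count] )
    moreover have "AE \<omega> in M. finite {n. X j n \<omega> \<in> {0}}" by (rule P.AE_finite_count) auto
    ultimately show ?thesis by eventually_elim (auto simp: count_in_def)
  qed
  then have nz: "AE \<omega> in M. \<forall>j n. X j n \<omega> \<noteq> 0" by (rule AE_all_tiers)
  have "AE \<omega> in M. \<forall>k::nat. summable (\<lambda>n. g j n \<omega> * kernel j (1 / real (Suc k)) (X j n \<omega>))" for j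
    unfolding AE_all_countable by (intro allI AE_summable_outer_shot) auto
  then have sm: "AE \<omega> in M. \<forall>j. \<forall>k::nat. summable (\<lambda>n. g j n \<omega> * kernel j (1 / real (Suc k)) (X j n \<omega>))"
    by (rule AE_all_tiers)
  show ?thesis
    using fin nz sm AE_interf_pos_all
  proof eventually_elim
    case (elim \<omega>)
    have "finite {n. X j n \<omega> \<in> cball 0 r}" for j r
    proof -
      obtain k where "r \<le> real k" using real_arch_simple by blast
      then have "{n. X j n \<omega> \<in> cball 0 r} \<subseteq> {n. X j n \<omega> \<in> cball 0 (real k)}" by auto
      then show ?thesis using elim(1) finite_subset by blast
    qed
    moreover have "summable (\<lambda>n. g j n \<omega> * kernel j c (X j n \<omega>))" if "0 < c" for j c
    proof -
      from nat_approx_posE[OF that] obtain k where k: "1 / real (Suc k) < c" by blast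
      have "kernel j c x \<le> kernel j (1 / real (Suc k)) x" for x
        using k hetnet_pos(2)[OF valid, of j] by (auto simp: kernel_def indicator_def less_imp_le)
      then show ?thesis
        using elim(4) kernel_nonneg
        by (intro summable_comparison_test'[OF elim(3)[rule_format, of j k], of 0])
           (auto simp: less_imp_le intro!: mult_left_mono)
    qed
    ultimately show ?case using elim by (auto simp: regular_config_def)
  qed
qed

lemma nearest_dist_le: "nearest_dist X j \<omega> \<le> norm (X j n \<omega>)"
  unfolding nearest_dist_def by (rule cINF_lower) (auto intro!: bdd_belowI[of _ 0])

text \<open>Only the finitely many points no farther away than the point of index 0 compete for the
  infimum.\<close>

lemma nearest_dist_attained:
  assumes "regular_config \<omega>"
  shows "norm (X j (nearest_index X j \<omega>) \<omega>) = nearest_dist X j \<omega>"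
proof -
  let ?S = "{n. X j n \<omega> \<in> cball 0 (norm (X j 0 \<omega>))}"
  have S: "finite ?S" "0 \<in> ?S" using assms by (auto simp: regular_config_def)
  obtain m where m: "m \<in> ?S" "\<And>n. n \<in> ?S \<Longrightarrow> norm (X j m \<omega>) \<le> norm (X j n \<omega>)"
    using arg_min_if_finite[of ?S "\<lambda>n. norm (X j n \<omega>)"] S by (metis empty_iff linorder_not_less)
  have "norm (X j m \<omega>) \<le> norm (X j n \<omega>)" for n
  proof (cases "n \<in> ?S")
    case False
    then have "norm (X j 0 \<omega>) \<le> norm (X j n \<omega>)" by simp
    with m(2)[OF S(2)] show ?thesis by simp
  qed (rule m(2))
  then have "norm (X j m \<omega>) \<le> nearest_dist X j \<omega>"
    unfolding nearest_dist_def by (intro cINF_greatest) auto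
  then have "norm (X j m \<omega>) = nearest_dist X j \<omega>" using nearest_dist_le[of j \<omega> m] by simp
  then show ?thesis unfolding nearest_index_def by (rule LeastI)
qed

lemma nearest_dist_pos: "regular_config \<omega> \<Longrightarrow> 0 < nearest_dist X j \<omega>"
  using nearest_dist_attained[of \<omega> j, symmetric] by (simp add: regular_config_def)

lemma nearest_dist_gt_iff:
  assumes "regular_config \<omega>"
  shows "r < nearest_dist X j \<omega> \<longleftrightarrow> count_in (X j) (cball 0 r) \<omega> = 0"
proof -
  have "r < nearest_dist X j \<omega> \<longleftrightarrow> (\<forall>n. r < norm (X j n \<omega>))"
    using nearest_dist_attained[OF assms, of j] nearest_dist_le[of j \<omega>] by (metis order_less_le_trans)
  also have "\<dots> \<longleftrightarrow> {n. X j n \<omega> \<in> cball 0 r} = {}" by (auto simp: not_le)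
  also have "\<dots> \<longleftrightarrow> count_in (X j) (cball 0 r) \<omega> = 0"
    using assms unfolding count_in_def by (subst card_0_eq) (auto simp: regular_config_def)
  finally show ?thesis .
qed

lemma guard_dist_mono_iff:
  "guard_dist H l j r \<le> guard_dist H l j s \<longleftrightarrow> r \<le> s" "guard_dist H l j r < guard_dist H l j s \<longleftrightarrow> r < s"
  using bias_ratio_pos[OF valid] by (auto simp: guard_dist_def)

text \<open>The guard distance is where the other tier has the same biased power as the server at
  distance \<open>r\<close>. This identity fixes the sign of the exponent of
  \<open>bias_ratio\<close> in either case.\<close>

lemma biased_power_guard_dist:
  assumes "0 < r"
  shows "bias H j * tx_power H j * real (dof H j) * guard_dist H l j r powr (- pathloss H) =
    bias H l * tx_power H l * real (dof H l) * r powr (- pathloss H)"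
proof (cases "j = l")
  case False
  note pos = hetnet_pos[OF valid] bias_ratio_pos[OF valid]
  have d: "0 < real (dof H t)" for t by (simp add: dof_def)
  have br: "bias_ratio H = (bias H SBS * tx_power H SBS * real (dof H SBS)) / (bias H MBS * tx_power H MBS * real (dof H MBS))"
    by (simp add: bias_ratio_def sbs_mbs_ratio_def mult_ac)
  show ?thesis
  proof (cases l)
    case MBS
    then have j: "j = SBS" using False by (cases j) auto
    have "guard_dist H l j r powr (- pathloss H) = r powr (- pathloss H) / bias_ratio H"
      using MBS False pos assms by (simp add: guard_dist_def powr_mult powr_powr powr_minus divide_inverse)
    then show ?thesis unfolding j MBS br using pos(2,3)[of SBS] pos(2,3)[of MBS] d[of SBS] d[of MBS] by (simp add: field_simps)
  next
    case SBS
    then have j: "j = MBS" using False by (cases j) auto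
    have "guard_dist H l j r powr (- pathloss H) = r powr (- pathloss H) * bias_ratio H"
      using SBS False pos assms by (simp add: guard_dist_def powr_mult powr_powr)
    then show ?thesis unfolding j SBS br using pos(2,3)[of SBS] pos(2,3)[of MBS] d[of SBS] d[of MBS] by (simp add: field_simps)
  qed
qed (simp add: guard_dist_def)

lemma guard_dist_vs_biased_power:
  assumes "regular_config \<omega>"
  shows "biased_power H X j \<omega> < biased_power H X l \<omega> \<longleftrightarrow> guard_dist H l j (nearest_dist X l \<omega>) < nearest_dist X j \<omega>"
    and "biased_power H X j \<omega> \<le> biased_power H X l \<omega> \<longleftrightarrow> guard_dist H l j (nearest_dist X l \<omega>) \<le> nearest_dist X j \<omega>"
proof -
  note pos = nearest_dist_pos[OF assms] hetnet_pos[OF valid]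
  have w: "0 < bias H j * tx_power H j * real (dof H j)" using pos by (simp add: dof_def)
  have eq: "biased_power H X l \<omega> =
      bias H j * tx_power H j * real (dof H j) * guard_dist H l j (nearest_dist X l \<omega>) powr (- pathloss H)"
    unfolding biased_power_def by (rule biased_power_guard_dist[symmetric]) (rule pos)
  have gp: "0 < guard_dist H l j (nearest_dist X l \<omega>)" by (rule guard_dist_pos[OF valid pos(1)])
  have pw: "x powr (- pathloss H) < y powr (- pathloss H) \<longleftrightarrow> y < x" if "0 < x" "0 < y" for x y
    using that pos(6) powr_less_mono2_neg[of "- pathloss H"]
    by (metis less_asym linorder_neqE neg_less_0_iff_less order_less_trans zero_less_numeral)
  show 1: "biased_power H X j \<omega> < biased_power H X l \<omega> \<longleftrightarrow> guard_dist H l j (nearest_dist X l \<omega>) < nearest_dist X j \<omega>"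
    unfolding eq unfolding biased_power_def using w pw[OF pos(1) gp] by (simp add: mult_less_cancel_left_pos)
  have "biased_power H X l \<omega> < biased_power H X j \<omega> \<longleftrightarrow> nearest_dist X j \<omega> < guard_dist H l j (nearest_dist X l \<omega>)"
    unfolding eq unfolding biased_power_def using w pw[OF gp pos(1)] by (simp add: mult_less_cancel_left_pos)
  then show "biased_power H X j \<omega> \<le> biased_power H X l \<omega> \<longleftrightarrow> guard_dist H l j (nearest_dist X l \<omega>) \<le> nearest_dist X j \<omega>"
    by (meson not_le)
qed

text \<open>Weak here and strict in \<open>serving_tierI\<close>: ties are decided in favour of the
  MBS, so these are the forms valid for both tiers alike.\<close>

lemma serving_tierD:
  assumes "regular_config \<omega>" "serving_tier H X \<omega> = l"
  shows "guard_dist H l (other_tier l) (nearest_dist X l \<omega>) \<le> nearest_dist X (other_tier l) \<omega>"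
  using assms(2) guard_dist_vs_biased_power(2)[OF assms(1), of "other_tier l" l]
  by (cases l) (auto simp: serving_tier_def split: if_splits)

lemma serving_tierI:
  assumes "regular_config \<omega>" "guard_dist H l (other_tier l) (nearest_dist X l \<omega>) < nearest_dist X (other_tier l) \<omega>"
  shows "serving_tier H X \<omega> = l"
  using assms(2) guard_dist_vs_biased_power(1)[OF assms(1), of "other_tier l" l]
  by (cases l) (auto simp: serving_tier_def)

lemma infsum_eq_outer_shot:
  assumes "regular_config \<omega>" "0 < c" and S: "\<And>n. n \<in> S \<longleftrightarrow> c < norm (X j n \<omega>)"
  shows "(\<Sum>\<^sub>\<infinity>n\<in>S. tx_power H j * g j n \<omega> * norm (X j n \<omega>) powr (- pathloss H)) = outer_shot j c \<omega>"
proof -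
  have sm: "summable (\<lambda>n. g j n \<omega> * kernel j c (X j n \<omega>))" using assms by (simp add: regular_config_def)
  have eq: "tx_power H j * g j n \<omega> * norm (X j n \<omega>) powr (- pathloss H) * indicator S n =
      g j n \<omega> * kernel j c (X j n \<omega>)" for n
    using S[of n] by (auto simp: kernel_def indicator_def)
  have "0 \<le> g j n \<omega> * kernel j c (X j n \<omega>)" for n
    using assms(1) kernel_nonneg by (simp add: regular_config_def less_imp_le)
  then have "(\<Sum>n. ennreal \<bar>g j n \<omega> * kernel j c (X j n \<omega>)\<bar>) \<noteq> \<top>"
    using sm by (intro ennreal_suminf_neq_top) auto
  then show ?thesis
    unfolding infsum_real_nat_eq eq outer_shot_def by simp
qed

text \<open>Up to probability \<open>O((b - a)\<^sup>2)\<close>, this is the event that tier \<open>l\<close> serves at a distance in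
  \<open>(a, b]\<close>. It only involves counts within the guard distances, and on it the interference comes
  exactly from the points beyond them.\<close>

definition cell_event :: "tier \<Rightarrow> real \<Rightarrow> real \<Rightarrow> 'w \<Rightarrow> bool" where
  "cell_event l a b \<omega> \<longleftrightarrow> count_in (X l) (cball 0 a) \<omega> = 0 \<and> count_in (X l) (cball 0 b - cball 0 a) \<omega> = 1 \<and>
    count_in (X (other_tier l)) (cball 0 (guard_dist H l (other_tier l) b)) \<omega> = 0"

definition outer_interference :: "tier \<Rightarrow> real \<Rightarrow> 'w \<Rightarrow> real" where
  "outer_interference l r \<omega> = (\<Sum>j\<in>UNIV. outer_shot j (guard_dist H l j r) \<omega>)"

text \<open>The only tier-\<open>l\<close> point within \<open>b\<close> is the nearest one, so
  leaving out the server removes exactly the points within the guard distance, and from the other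
  tier nothing has to be removed.\<close>

lemma cell_eventD:
  assumes reg: "regular_config \<omega>" and ab: "0 < a" "a < b" and cell: "cell_event l a b \<omega>"
  shows "serving_tier H X \<omega> = l" "a < serving_dist H X \<omega>" "serving_dist H X \<omega> \<le> b"
    "interference H X g \<omega> = outer_interference l b \<omega>"
proof -
  have a: "a < nearest_dist X l \<omega>" using cell nearest_dist_gt_iff[OF reg] by (simp add: cell_event_def)
  then have ga: "a < norm (X l n \<omega>)" for n using nearest_dist_le order_less_le_trans by blast
  have "card {n. X l n \<omega> \<in> cball 0 b - cball 0 a} = 1" using cell by (simp add: cell_event_def count_in_def)
  then obtain m where m: "{n. X l n \<omega> \<in> cball 0 b - cball 0 a} = {m}" by (auto simp: card_1_singleton_iff)
  then have m': "norm (X l n \<omega>) \<le> b \<longleftrightarrow> n = m" for n using ga[of n] by (auto simp: set_eq_iff not_le)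
  have b: "nearest_dist X l \<omega> \<le> b" using nearest_dist_le[of l \<omega> m] m'[of m] by simp
  have m_near: "nearest_index X l \<omega> = m"
    by (rule m'[THEN iffD1]) (simp add: nearest_dist_attained[OF reg] b)
  have o: "guard_dist H l (other_tier l) b < nearest_dist X (other_tier l) \<omega>"
    using cell nearest_dist_gt_iff[OF reg] by (simp add: cell_event_def)
  show st: "serving_tier H X \<omega> = l"
    by (rule serving_tierI[OF reg], rule order_le_less_trans[OF _ o]) (simp add: guard_dist_mono_iff b)
  show "a < serving_dist H X \<omega>" "serving_dist H X \<omega> \<le> b"
    using a b by (auto simp: serving_dist_def st)
  have "(\<Sum>\<^sub>\<infinity>n\<in>interferers H X j \<omega>. tx_power H j * g j n \<omega> * norm (X j n \<omega>) powr (- pathloss H)) =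
      outer_shot j (guard_dist H l j b) \<omega>" for j
  proof (rule infsum_eq_outer_shot[OF reg])
    show "0 < guard_dist H l j b" using guard_dist_pos[OF valid] ab by simp
    show "n \<in> interferers H X j \<omega> \<longleftrightarrow> guard_dist H l j b < norm (X j n \<omega>)" for n
    proof (cases "j = l")
      case True
      then show ?thesis using m'[of n] by (auto simp: interferers_def st m_near guard_dist_def)
    next
      case False
      then have "j = other_tier l" by (simp add: tier_neq_iff)
      then show ?thesis using o nearest_dist_le[of j \<omega> n] by (auto simp: interferers_def st)
    qed
  qed
  then show "interference H X g \<omega> = outer_interference l b \<omega>"
    by (simp add: interference_def outer_interference_def UNIV_tier)
qed

text \<open>The source of the second-order error: each alternative asks for two points in thin
  annuli, either both in the annulus of tier \<open>l\<close>, or one there and one of the other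
  tier between its guard distances for \<open>a\<close> and \<open>b\<close>.\<close>

lemma not_cell_eventD:
  assumes reg: "regular_config \<omega>" and ab: "0 < a" "a < b"
    and l: "serving_tier H X \<omega> = l" "a < serving_dist H X \<omega>" "serving_dist H X \<omega> \<le> b" and nc: "\<not> cell_event l a b \<omega>"
  shows "2 \<le> count_in (X l) (cball 0 b - cball 0 a) \<omega> \<or>
    1 \<le> count_in (X l) (cball 0 b - cball 0 a) \<omega> \<and>
    1 \<le> count_in (X (other_tier l)) (cball 0 (guard_dist H l (other_tier l) b) - cball 0 (guard_dist H l (other_tier l) a)) \<omega>"
proof -
  let ?o = "other_tier l"
  have fin: "finite {n. X j n \<omega> \<in> cball 0 r - B}" for j r B
    by (rule finite_subset[of _ "{n. X j n \<omega> \<in> cball 0 r}"]) (use reg in \<open>auto simp: regular_config_def\<close>)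
  have nd: "a < nearest_dist X l \<omega>" "nearest_dist X l \<omega> \<le> b" using l by (auto simp: serving_dist_def)
  have "nearest_index X l \<omega> \<in> {n. X l n \<omega> \<in> cball 0 b - cball 0 a}"
    using nearest_dist_attained[OF reg, of l] nd by auto
  then have 1: "1 \<le> count_in (X l) (cball 0 b - cball 0 a) \<omega>"
    using fin unfolding count_in_def by (metis One_nat_def Suc_leI card_gt_0_iff empty_iff)
  show ?thesis
  proof (cases "count_in (X l) (cball 0 b - cball 0 a) \<omega> = 1")
    case True
    have "count_in (X l) (cball 0 a) \<omega> = 0" using nd nearest_dist_gt_iff[OF reg] by simp
    then have "count_in (X ?o) (cball 0 (guard_dist H l ?o b)) \<omega> \<noteq> 0"
      using nc True by (simp add: cell_event_def)
    then have 2: "nearest_dist X ?o \<omega> \<le> guard_dist H l ?o b"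
      using nearest_dist_gt_iff[OF reg, of "guard_dist H l ?o b" ?o] by linarith
    have "guard_dist H l ?o a < guard_dist H l ?o (nearest_dist X l \<omega>)"
      using nd by (simp add: guard_dist_mono_iff)
    also have "\<dots> \<le> nearest_dist X ?o \<omega>" by (rule serving_tierD[OF reg l(1)])
    finally have "nearest_index X ?o \<omega> \<in> {n. X ?o n \<omega> \<in> cball 0 (guard_dist H l ?o b) - cball 0 (guard_dist H l ?o a)}"
      using nearest_dist_attained[OF reg, of ?o] 2 by auto
    then have "1 \<le> count_in (X ?o) (cball 0 (guard_dist H l ?o b) - cball 0 (guard_dist H l ?o a)) \<omega>"
      using fin unfolding count_in_def by (metis One_nat_def Suc_leI card_gt_0_iff empty_iff)
    with 1 show ?thesis by simp
  qed (use 1 in linarith)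
qed

end

section \<open>Disintegration along the serving distance\<close>

text \<open>Tails of the serving distance are differentiated only at positive arguments. Continuity
  from below along \<open>1 / (n + 1)\<close> reaches \<open>{0<..}\<close>, and the rest of the
  line is null.\<close>

lemma measure_eqI_greaterThan_pos:
  fixes M N :: "real measure"
  assumes sets: "sets M = sets borel" "sets N = sets borel"
    and neg: "emeasure M {..0} = 0" "emeasure N {..0} = 0"
    and fin: "\<And>x. 0 < x \<Longrightarrow> emeasure M {x<..} = emeasure N {x<..}" "emeasure M UNIV < \<infinity>"
  shows "M = N"
proof -
  have zero: "emeasure K {0<..} = (SUP n. emeasure K {1 / real (Suc n)<..})" if "sets K = sets borel" for K :: "real measure"
  proof -
    have "incseq (\<lambda>n. {1 / real (Suc n)<..})"
      by (auto simp: incseq_def frac_le intro: order_le_less_trans[rotated])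
    then have "(SUP n. emeasure K {1 / real (Suc n)<..}) = emeasure K (\<Union>n. {1 / real (Suc n)<..})"
      by (intro SUP_emeasure_incseq) (auto simp: that)
    also have "(\<Union>n. {1 / real (Suc n)<..}) = {0<..}"
    proof (intro set_eqI iffI)
      fix x :: real assume "x \<in> (\<Union>n. {1 / real (Suc n)<..})"
      then obtain n where n: "1 / real (Suc n) < x" by auto
      have "0 < 1 / real (Suc n)" by simp
      with n have "0 < x" by linarith
      then show "x \<in> {0<..}" by simp
    next
      fix x :: real assume "x \<in> {0<..}"
      then have "0 < x" by simp
      from nat_approx_posE[OF this] obtain n where "1 / real (Suc n) < x" by blast
      then show "x \<in> (\<Union>n. {1 / real (Suc n)<..})" by auto
    qed
    finally show ?thesis ..
  qed
  have neg_eq: "emeasure K {x<..} = emeasure K {0<..}" if s: "sets K = sets borel" and "emeasure K {..0} = 0" and "x \<le> 0" for K and x :: real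
  proof -
    have "emeasure K {x<..0} \<le> emeasure K {..0}" by (rule emeasure_mono) (auto simp: s)
    then have "{x<..0} \<in> null_sets K" using that by (auto simp: null_sets_def)
    then have "emeasure K ({0<..} \<union> {x<..0}) = emeasure K {0<..}" by (rule emeasure_Un_null_set[rotated]) (simp add: s)
    also have "{0<..} \<union> {x<..0} = {x<..}" using that by auto
    finally show ?thesis .
  qed
  show ?thesis
  proof (rule measure_eqI_lessThan[OF sets])
    fix x :: real
    have "emeasure M {x<..} \<le> emeasure M UNIV" by (rule emeasure_mono) (auto simp: sets)
    with fin(2) show "emeasure M {x<..} < \<infinity>" by (rule le_less_trans[rotated])
    have "emeasure M {0<..} = emeasure N {0<..}" unfolding zero[OF sets(1)] zero[OF sets(2)] using fin(1) by simp
    then show "emeasure M {x<..} = emeasure N {x<..}"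
      using fin(1)[of x] neg_eq[OF sets(1) neg(1), of x] neg_eq[OF sets(2) neg(2), of x] by (cases "0 < x") auto
  qed
qed

context hetnet_sources begin

lemma expectation_mult_source_sigma:
  fixes U V :: "'w \<Rightarrow> real"
  assumes U: "U \<in> borel_measurable (source_sigma J)" "\<And>\<omega>. 0 \<le> U \<omega>"
    and V: "V \<in> borel_measurable (source_sigma K)" "\<And>\<omega>. 0 \<le> V \<omega>" and JK: "J \<inter> K = {}"
  shows "expectation (\<lambda>\<omega>. U \<omega> * V \<omega>) = expectation U * expectation V"
proof -
  note [measurable] = measurable_source_sigma_imp[OF U(1)] measurable_source_sigma_imp[OF V(1)]
  have "(\<integral>\<^sup>+\<omega>. ennreal (U \<omega> * V \<omega>) \<partial>M) = (\<integral>\<^sup>+\<omega>. ennreal (U \<omega>) * ennreal (V \<omega>) \<partial>M)"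
    using U V by (simp add: ennreal_mult)
  also have "\<dots> = (\<integral>\<^sup>+\<omega>. (\<integral>\<^sup>+v. ennreal (U \<omega>) * ennreal v \<partial>distr M borel V) \<partial>M)"
    using nn_integral_source_sigma[OF U(1) V(1) JK, of "\<lambda>z. ennreal (fst z) * ennreal (snd z)"] by simp
  also have "\<dots> = (\<integral>\<^sup>+\<omega>. ennreal (U \<omega>) * (\<integral>\<^sup>+\<omega>. ennreal (V \<omega>) \<partial>M) \<partial>M)"
    by (subst nn_integral_cmult, simp, subst nn_integral_distr) auto
  also have "\<dots> = (\<integral>\<^sup>+\<omega>. ennreal (U \<omega>) \<partial>M) * (\<integral>\<^sup>+\<omega>. ennreal (V \<omega>) \<partial>M)"
    by (rule nn_integral_multc) measurable
  finally have *: "(\<integral>\<^sup>+\<omega>. ennreal (U \<omega> * V \<omega>) \<partial>M) = (\<integral>\<^sup>+\<omega>. ennreal (U \<omega>) \<partial>M) * (\<integral>\<^sup>+\<omega>. ennreal (V \<omega>) \<partial>M)" .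
  have "expectation (\<lambda>\<omega>. U \<omega> * V \<omega>) = enn2real (\<integral>\<^sup>+\<omega>. ennreal (U \<omega> * V \<omega>) \<partial>M)"
    "expectation U = enn2real (\<integral>\<^sup>+\<omega>. ennreal (U \<omega>) \<partial>M)" "expectation V = enn2real (\<integral>\<^sup>+\<omega>. ennreal (V \<omega>) \<partial>M)"
    using U V by (auto intro!: integral_eq_nn_integral AE_I2)
  then show ?thesis by (simp add: * enn2real_mult)
qed

definition void_prob :: "tier \<Rightarrow> real \<Rightarrow> real" where
  "void_prob l r = exp (- (\<Sum>j\<in>UNIV. dens H j * (pi * (guard_dist H l j r)\<^sup>2)))"

definition tier_sources :: "tier \<Rightarrow> source set" where
  "tier_sources j = insert (Points j) (range (Interf j))"

lemma measure_cball_real2: "0 \<le> r \<Longrightarrow> measure lborel (cball (0::real^2) r) = pi * r\<^sup>2"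
  using emeasure_cball_real2[of r 0] by (simp add: measure_def)

lemma measure_annulus_real2:
  assumes "0 \<le> a" "a \<le> b"
  shows "measure lborel (cball (0 :: real^2) b - cball 0 a) = pi * (b\<^sup>2 - a\<^sup>2)"
proof -
  have "measure lborel (cball (0 :: real^2) b - cball 0 a) = measure lborel (cball (0::real^2) b) - measure lborel (cball (0::real^2) a)"
    by (rule measure_Diff) (use assms in \<open>auto simp: emeasure_cball_real2\<close>)
  then show ?thesis using assms by (simp add: measure_cball_real2 algebra_simps)
qed

lemma measurable_count_in:
  assumes "Points j \<in> J" "B \<in> sets borel"
  shows "count_in (X j) B \<in> source_sigma J \<rightarrow>\<^sub>M count_space UNIV"
proof -
  note [measurable] = measurable_points[OF assms(1)] assms(2)
  show ?thesis unfolding count_in_def[abs_def] by (rule measurable_card) measurable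
qed

lemma measurable_count_M [measurable]: "B \<in> sets borel \<Longrightarrow> count_in (X j) B \<in> M \<rightarrow>\<^sub>M count_space UNIV"
  by (rule measurable_source_sigma_imp[OF measurable_count_in[of j UNIV]]) auto

lemma measurable_outer_shot_sources:
  "tier_sources j \<subseteq> J \<Longrightarrow> outer_shot j c \<in> borel_measurable (source_sigma J)"
  by (rule measurable_outer_shot; rule measurable_points measurable_interf) (auto simp: tier_sources_def)

lemma measurable_outer_shot_M [measurable]: "outer_shot j c \<in> borel_measurable M"
  by (rule measurable_source_sigma_imp[OF measurable_outer_shot_sources[of j UNIV]]) auto

lemma measurable_outer_interference [measurable]: "outer_interference l r \<in> borel_measurable M"
  unfolding outer_interference_def[abs_def] by measurable

lemma measurable_cell_event [measurable]: "Measurable.pred M (cell_event l a b)"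
  unfolding cell_event_def[abs_def] by measurable

text \<open>The two tiers draw on disjoint groups of sources, so the expectation is a product of two
  instances of \<open>tier_laplace\<close>.\<close>

lemma cell_laplace:
  assumes ab: "0 < a" "a < b" and s: "0 \<le> s"
  shows "expectation (\<lambda>\<omega>. of_bool (cell_event l a b \<omega>) * exp (- s * outer_interference l b \<omega>)) =
    dens H l * (pi * (b\<^sup>2 - a\<^sup>2)) * void_prob l b * outer_laplace H l b s"
proof -
  let ?o = "other_tier l"
  let ?g = "guard_dist H l ?o b"
  let ?E = "\<lambda>\<omega>. count_in (X l) (cball 0 a) \<omega> = 0 \<and> count_in (X l) (cball 0 b - cball 0 a) \<omega> = 1"
  \<comment> \<open>The count in \<open>{}\<close> is vacuous; it only fits the one count of the
    other tier into the two-set form of \<open>tier_laplace\<close>.\<close>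
  let ?F = "\<lambda>\<omega>. count_in (X ?o) (cball 0 ?g) \<omega> = 0 \<and> count_in (X ?o) {} \<omega> = 0"
  let ?U = "\<lambda>\<omega>. of_bool (?E \<omega>) * exp (- s * outer_shot l b \<omega>)"
  let ?V = "\<lambda>\<omega>. of_bool (?F \<omega>) * exp (- s * outer_shot ?o ?g \<omega>)"
  interpret L: ppp M "X l" "dens H l" by (rule ppp_points)
  interpret O: ppp M "X ?o" "dens H ?o" by (rule ppp_points)
  have g: "0 < ?g" using guard_dist_pos[OF valid] ab by simp
  have gl: "guard_dist H l l r = r" for r by (simp add: guard_dist_def)
  have "expectation (\<lambda>\<omega>. of_bool (cell_event l a b \<omega>) * exp (- s * outer_interference l b \<omega>)) =
      expectation (\<lambda>\<omega>. ?U \<omega> * ?V \<omega>)"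
    by (rule Bochner_Integration.integral_cong)
       (auto simp: cell_event_def outer_interference_def UNIV_tier_other[of l] gl exp_add[symmetric] algebra_simps count_in_def)
  also have "\<dots> = expectation ?U * expectation ?V"
  proof (rule expectation_mult_source_sigma)
    note [measurable] = measurable_count_in[of l "tier_sources l"] measurable_count_in[of ?o "tier_sources ?o"]
      measurable_outer_shot_sources[OF order_refl]
    have [simp]: "Points j \<in> tier_sources j" for j by (simp add: tier_sources_def)
    show "?U \<in> borel_measurable (source_sigma (tier_sources l))" by measurable
    show "?V \<in> borel_measurable (source_sigma (tier_sources ?o))" by measurable
    show "tier_sources l \<inter> tier_sources ?o = {}" by (auto simp: tier_sources_def)
  qed auto
  finally have UV: "expectation (\<lambda>\<omega>. of_bool (cell_event l a b \<omega>) * exp (- s * outer_interference l b \<omega>)) =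
    expectation ?U * expectation ?V" .
  have sub: "cball (0::real^2) a \<subseteq> cball 0 b" using ab by auto
  have "expectation ?U = \<P>(\<omega> in M. count_in (X l) (cball 0 a) \<omega> = 0) *
      \<P>(\<omega> in M. count_in (X l) (cball 0 b - cball 0 a) \<omega> = 1) * exp (- tier_exponent H l l b s)"
    using tier_laplace[of b s "cball 0 a" "cball 0 b - cball 0 a" l 0 1] ab s sub
    by (simp add: tier_exponent_def gl)
  also have "\<P>(\<omega> in M. count_in (X l) (cball 0 a) \<omega> = 0) = exp (- (dens H l * (pi * a\<^sup>2)))"
    using L.prob_count[of "cball 0 a" 0] ab by (simp add: measure_cball_real2)
  also have "\<P>(\<omega> in M. count_in (X l) (cball 0 b - cball 0 a) \<omega> = 1) =
      dens H l * (pi * (b\<^sup>2 - a\<^sup>2)) * exp (- (dens H l * (pi * (b\<^sup>2 - a\<^sup>2))))"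
    using L.prob_count[of "cball 0 b - cball 0 a" 1] ab by (simp add: measure_annulus_real2 bounded_diff)
  finally have EU: "expectation ?U = exp (- (dens H l * (pi * a\<^sup>2))) *
      (dens H l * (pi * (b\<^sup>2 - a\<^sup>2)) * exp (- (dens H l * (pi * (b\<^sup>2 - a\<^sup>2))))) * exp (- tier_exponent H l l b s)" .
  have "expectation ?V = \<P>(\<omega> in M. count_in (X ?o) (cball 0 ?g) \<omega> = 0) *
      \<P>(\<omega> in M. count_in (X ?o) {} \<omega> = 0) * exp (- tier_exponent H l ?o b s)"
    using tier_laplace[of ?g s "cball 0 ?g" "{}" ?o 0 0] g s by (simp add: tier_exponent_def)
  also have "\<P>(\<omega> in M. count_in (X ?o) {} \<omega> = 0) = 1"
    using O.prob_count[of "{}" 0] by simp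
  also have "\<P>(\<omega> in M. count_in (X ?o) (cball 0 ?g) \<omega> = 0) = exp (- (dens H ?o * (pi * ?g\<^sup>2)))"
    using O.prob_count[of "cball 0 ?g" 0] g by (simp add: measure_cball_real2)
  finally have EV: "expectation ?V = exp (- (dens H ?o * (pi * ?g\<^sup>2))) * 1 * exp (- tier_exponent H l ?o b s)" .
  \<comment> \<open>The void probability of the inner disc and the exponential factor of the annulus
    combine to the void probability of the disc of radius \<open>b\<close>; the linear factor of the
    Poisson weight at 1 is what remains.\<close>
  have void: "exp (- (dens H l * (pi * a\<^sup>2))) * exp (- (dens H l * (pi * (b\<^sup>2 - a\<^sup>2)))) * exp (- (dens H ?o * (pi * ?g\<^sup>2))) =
      void_prob l b"
    unfolding void_prob_def UNIV_tier_other[of l] by (simp add: gl exp_add[symmetric] algebra_simps)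
  have lap: "exp (- tier_exponent H l l b s) * exp (- tier_exponent H l ?o b s) = outer_laplace H l b s"
    unfolding outer_laplace_def UNIV_tier_other[of l] by (simp add: exp_add[symmetric])
  show ?thesis
    unfolding UV EU EV void[symmetric] lap[symmetric] by (simp only: mult_1_right mult_ac)
qed

section \<open>Second-order bound for the exceptional event\<close>

lemma prob_count_ge_1:
  assumes "B \<in> sets borel" "bounded B"
  shows "\<P>(\<omega> in M. 1 \<le> count_in (X j) B \<omega>) \<le> dens H j * measure lborel B"
proof -
  interpret P: ppp M "X j" "dens H j" by (rule ppp_points)
  note [measurable] = assms(1)
  have "{\<omega>\<in>space M. 1 \<le> count_in (X j) B \<omega>} = space M - {\<omega>\<in>space M. count_in (X j) B \<omega> = 0}" by auto
  then have "\<P>(\<omega> in M. 1 \<le> count_in (X j) B \<omega>) = 1 - \<P>(\<omega> in M. count_in (X j) B \<omega> = 0)"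
    by (simp add: prob_compl)
  also have "\<dots> = 1 - exp (- (dens H j * measure lborel B))"
    using P.prob_count[OF assms, of 0] by simp
  also have "\<dots> \<le> dens H j * measure lborel B"
    using exp_ge_add_one_self[of "- (dens H j * measure lborel B)"] by linarith
  finally show ?thesis .
qed

lemma prob_count_ge_2:
  assumes "B \<in> sets borel" "bounded B"
  shows "\<P>(\<omega> in M. 2 \<le> count_in (X j) B \<omega>) \<le> (dens H j * measure lborel B)\<^sup>2"
proof -
  interpret P: ppp M "X j" "dens H j" by (rule ppp_points)
  note [measurable] = assms(1)
  define m where "m = dens H j * measure lborel B"
  have m: "0 \<le> m" using P.rate_pos by (simp add: m_def)
  have "{\<omega>\<in>space M. 2 \<le> count_in (X j) B \<omega>} = space M -
      ({\<omega>\<in>space M. count_in (X j) B \<omega> = 0} \<union> {\<omega>\<in>space M. count_in (X j) B \<omega> = 1})" by auto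
  then have "\<P>(\<omega> in M. 2 \<le> count_in (X j) B \<omega>) = 1 - prob ({\<omega>\<in>space M. count_in (X j) B \<omega> = 0} \<union> {\<omega>\<in>space M. count_in (X j) B \<omega> = 1})"
    by (simp add: prob_compl)
  also have "\<dots> = 1 - (\<P>(\<omega> in M. count_in (X j) B \<omega> = 0) + \<P>(\<omega> in M. count_in (X j) B \<omega> = 1))"
    by (subst finite_measure_Union) auto
  also have "\<dots> = 1 - (1 + m) * exp (- m)"
    using P.prob_count[OF assms, of 0] P.prob_count[OF assms, of 1] by (simp add: m_def algebra_simps)
  also have "\<dots> \<le> 1 - (1 + m) * (1 - m)"
    using m exp_ge_add_one_self[of "- m"] by (intro diff_left_mono mult_left_mono) auto
  also have "\<dots> = m\<^sup>2" by (simp add: algebra_simps power2_eq_square)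
  finally show ?thesis by (simp add: m_def)
qed

lemma prob_not_cell:
  fixes l :: tier
  assumes ab: "0 < a" "a < b"
  defines "A \<equiv> cball 0 b - cball 0 a :: (real^2) set"
    and "D \<equiv> cball 0 (guard_dist H l (other_tier l) b) - cball 0 (guard_dist H l (other_tier l) a) :: (real^2) set"
  shows "\<P>(\<omega> in M. 2 \<le> count_in (X l) A \<omega> \<or> 1 \<le> count_in (X l) A \<omega> \<and> 1 \<le> count_in (X (other_tier l)) D \<omega>) \<le>
    ((dens H l)\<^sup>2 + dens H l * dens H (other_tier l) * (guard_dist H l (other_tier l) 1)\<^sup>2) * (pi * (b\<^sup>2 - a\<^sup>2))\<^sup>2"
proof -
  let ?o = "other_tier l"
  have AD: "A \<in> sets borel" "bounded A" "D \<in> sets borel" "bounded D" by (auto simp: A_def D_def bounded_diff)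
  note [measurable] = AD(1,3)
  let ?E1 = "{\<omega>\<in>space M. 2 \<le> count_in (X l) A \<omega>}"
  let ?E2 = "{\<omega>\<in>space M. 1 \<le> count_in (X l) A \<omega>}"
  let ?E3 = "{\<omega>\<in>space M. 1 \<le> count_in (X ?o) D \<omega>}"
  \<comment> \<open>Guard distances are linear in \<open>r\<close>, so the area between two of them
    is a constant multiple of that of the annulus.\<close>
  have gd: "guard_dist H l ?o r = guard_dist H l ?o 1 * r" for r by (simp add: guard_dist_def)
  have g1: "0 < guard_dist H l ?o 1" by (rule guard_dist_pos[OF valid]) simp
  have mA: "measure lborel A = pi * (b\<^sup>2 - a\<^sup>2)" unfolding A_def using ab by (intro measure_annulus_real2) auto
  have mD: "measure lborel D = (guard_dist H l ?o 1)\<^sup>2 * (pi * (b\<^sup>2 - a\<^sup>2))"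
    unfolding D_def gd[of a] gd[of b] using ab g1
    by (subst measure_annulus_real2) (auto simp: power_mult_distrib algebra_simps)
  have "prob (?E2 \<inter> ?E3) = prob ?E2 * prob ?E3"
  proof (rule indep_setD[OF indep_set_source_sigma[of "{Points l}" "{Points ?o}"]])
    have [measurable]: "count_in (X l) A \<in> source_sigma {Points l} \<rightarrow>\<^sub>M count_space UNIV"
      "count_in (X ?o) D \<in> source_sigma {Points ?o} \<rightarrow>\<^sub>M count_space UNIV"
      using measurable_count_in AD by auto
    have "{\<omega>\<in>space (source_sigma {Points l}). 1 \<le> count_in (X l) A \<omega>} \<in> sets (source_sigma {Points l})" by measurable
    then show "?E2 \<in> sets (source_sigma {Points l})" by simp
    have "{\<omega>\<in>space (source_sigma {Points ?o}). 1 \<le> count_in (X ?o) D \<omega>} \<in> sets (source_sigma {Points ?o})" by measurable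
    then show "?E3 \<in> sets (source_sigma {Points ?o})" by simp
  qed simp
  also have "\<dots> \<le> (dens H l * measure lborel A) * (dens H ?o * measure lborel D)"
    using AD hetnet_pos(1)[OF valid] by (intro mult_mono prob_count_ge_1) (auto simp: less_imp_le)
  finally have p23: "prob (?E2 \<inter> ?E3) \<le> (dens H l * measure lborel A) * (dens H ?o * measure lborel D)" .
  have "\<P>(\<omega> in M. 2 \<le> count_in (X l) A \<omega> \<or> 1 \<le> count_in (X l) A \<omega> \<and> 1 \<le> count_in (X ?o) D \<omega>) = prob (?E1 \<union> (?E2 \<inter> ?E3))"
    by (rule arg_cong[where f=prob]) auto
  also have "\<dots> \<le> prob ?E1 + prob (?E2 \<inter> ?E3)" by (rule measure_Un_le) auto
  also have "\<dots> \<le> (dens H l * measure lborel A)\<^sup>2 + (dens H l * measure lborel A) * (dens H ?o * measure lborel D)"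
    by (intro add_mono prob_count_ge_2 p23) (use AD in auto)
  finally show ?thesis unfolding mA mD by (simp add: power_mult_distrib algebra_simps power2_eq_square)
qed

lemma measurable_serving [measurable]:
  "serving_tier H X \<in> M \<rightarrow>\<^sub>M count_space UNIV" "serving_dist H X \<in> borel_measurable M"
  "interference H X g \<in> borel_measurable M"
  by (rule measurable_serving_tier measurable_serving_dist measurable_interference; measurable)+

lemma interference_nonneg: "regular_config \<omega> \<Longrightarrow> 0 \<le> interference H X g \<omega>"
  using hetnet_pos(2)[OF valid]
  by (auto simp: interference_def regular_config_def less_imp_le intro!: infsum_nonneg add_nonneg_nonneg)

lemma serving_dist_pos: "regular_config \<omega> \<Longrightarrow> 0 < serving_dist H X \<omega>"
  by (simp add: serving_dist_def nearest_dist_pos)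

text \<open>The argument \<open>\<sigma>\<close> of the Laplace transform may depend on the serving distance: constant \<open>\<sigma>\<close>
  give the distance law (\<open>\<sigma> = 0\<close>) and the conditional Laplace transform, and multiples of
  \<open>T * r powr \<alpha> / p\<^sub>l\<close> give the coverage probability.\<close>

definition serving_tail :: "tier \<Rightarrow> (real \<Rightarrow> real) \<Rightarrow> real \<Rightarrow> real" where
  "serving_tail l \<sigma> a = expectation (\<lambda>\<omega>. of_bool (serving_tier H X \<omega> = l \<and> a < serving_dist H X \<omega>) *
    exp (- \<sigma> (serving_dist H X \<omega>) * interference H X g \<omega>))"

definition serving_density :: "tier \<Rightarrow> real \<Rightarrow> real" where
  "serving_density l r = 2 * pi * dens H l * r * void_prob l r"

context
  fixes \<sigma> :: "real \<Rightarrow> real" and l :: tier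
  assumes \<sigma>0: "\<And>r. 0 < r \<Longrightarrow> 0 \<le> \<sigma> r"
    and \<sigma>mono: "\<And>a b. 0 < a \<Longrightarrow> a \<le> b \<Longrightarrow> \<sigma> a \<le> \<sigma> b"
    and \<sigma>cont: "\<And>r. 0 < r \<Longrightarrow> isCont \<sigma> r"
    and \<sigma>meas [measurable]: "\<sigma> \<in> borel_measurable borel"
begin

lemma integrable_serving:
  assumes [measurable]: "Measurable.pred M P"
  shows "integrable M (\<lambda>\<omega>. of_bool (P \<omega>) * exp (- \<sigma> (serving_dist H X \<omega>) * interference H X g \<omega>))"
proof (rule integrable_const_bound[where B=1])
  show "AE \<omega> in M. norm (of_bool (P \<omega>) * exp (- \<sigma> (serving_dist H X \<omega>) * interference H X g \<omega>)) \<le> 1"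
    using AE_regular_config
    by eventually_elim (auto simp: interference_nonneg serving_dist_pos \<sigma>0)
qed measurable

text \<open>On the cell event the distance lies in \<open>(a, b]\<close>, so by monotonicity of
  \<open>\<sigma>\<close> the exponential lies between those taken with \<open>\<sigma> b\<close>
  and \<open>\<sigma> a\<close>. Outside it the integrand is at most 1 and the exceptional event
  pays for the rest.\<close>

lemma serving_tail_sandwich:
  assumes ab: "0 < a" "a < b"
  shows "dens H l * (pi * (b\<^sup>2 - a\<^sup>2)) * void_prob l b * outer_laplace H l b (\<sigma> b) \<le> serving_tail l \<sigma> a - serving_tail l \<sigma> b"
    (is ?lower)
    and "serving_tail l \<sigma> a - serving_tail l \<sigma> b \<le>
      dens H l * (pi * (b\<^sup>2 - a\<^sup>2)) * void_prob l b * outer_laplace H l b (\<sigma> a) +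
      ((dens H l)\<^sup>2 + dens H l * dens H (other_tier l) * (guard_dist H l (other_tier l) 1)\<^sup>2) * (pi * (b\<^sup>2 - a\<^sup>2))\<^sup>2"
    (is ?upper)
proof -
  let ?Q = "\<lambda>\<omega>. serving_tier H X \<omega> = l \<and> a < serving_dist H X \<omega> \<and> serving_dist H X \<omega> \<le> b"
  let ?e = "\<lambda>\<omega>. exp (- \<sigma> (serving_dist H X \<omega>) * interference H X g \<omega>)"
  let ?R = "\<lambda>\<omega>. 2 \<le> count_in (X l) (cball 0 b - cball 0 a) \<omega> \<or>
    1 \<le> count_in (X l) (cball 0 b - cball 0 a) \<omega> \<and>
    1 \<le> count_in (X (other_tier l)) (cball 0 (guard_dist H l (other_tier l) b) - cball 0 (guard_dist H l (other_tier l) a)) \<omega>"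
  have diff: "serving_tail l \<sigma> a - serving_tail l \<sigma> b = expectation (\<lambda>\<omega>. of_bool (?Q \<omega>) * ?e \<omega>)"
    unfolding serving_tail_def
    by (subst Bochner_Integration.integral_diff[symmetric]; (intro integrable_serving)?; (measurable)?)
       (use ab in \<open>auto intro!: Bochner_Integration.integral_cong\<close>)
  have cell_int: "integrable M (\<lambda>\<omega>. of_bool (cell_event l a b \<omega>) * exp (- s * outer_interference l b \<omega>))" if "0 \<le> s" for s
  proof (rule integrable_const_bound[where B=1])
    show "AE \<omega> in M. norm (of_bool (cell_event l a b \<omega>) * exp (- s * outer_interference l b \<omega>)) \<le> 1"
      using AE_regular_config
    proof eventually_elim
      case (elim \<omega>)
      then show ?case using cell_eventD(4)[OF elim ab, of l] interference_nonneg[OF elim] that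
        by (cases "cell_event l a b \<omega>") auto
    qed
  qed measurable
  have \<sigma>ab: "0 \<le> \<sigma> a" "0 \<le> \<sigma> b" using \<sigma>0 ab by auto
  have "expectation (\<lambda>\<omega>. of_bool (cell_event l a b \<omega>) * exp (- \<sigma> b * outer_interference l b \<omega>)) \<le>
      expectation (\<lambda>\<omega>. of_bool (?Q \<omega>) * ?e \<omega>)"
  proof (rule integral_mono_AE[OF cell_int[OF \<sigma>ab(2)] integrable_serving])
    show "AE \<omega> in M. of_bool (cell_event l a b \<omega>) * exp (- \<sigma> b * outer_interference l b \<omega>) \<le> of_bool (?Q \<omega>) * ?e \<omega>"
      using AE_regular_config
    proof eventually_elim
      case (elim \<omega>)
      show ?case
      proof (cases "cell_event l a b \<omega>")
        case True
        note c = cell_eventD[OF elim ab True]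
        have "\<sigma> (serving_dist H X \<omega>) \<le> \<sigma> b" using c ab by (intro \<sigma>mono) auto
        then show ?thesis using c interference_nonneg[OF elim] by (auto intro!: mult_right_mono)
      qed simp
    qed
  qed measurable
  then show ?lower unfolding diff cell_laplace[OF ab \<sigma>ab(2)] .
  have "expectation (\<lambda>\<omega>. of_bool (?Q \<omega>) * ?e \<omega>) \<le>
      expectation (\<lambda>\<omega>. of_bool (cell_event l a b \<omega>) * exp (- \<sigma> a * outer_interference l b \<omega>) + indicator {\<omega>\<in>space M. ?R \<omega>} \<omega>)"
  proof (rule integral_mono_AE[OF integrable_serving Bochner_Integration.integrable_add[OF cell_int[OF \<sigma>ab(1)]]])
    show "AE \<omega> in M. of_bool (?Q \<omega>) * ?e \<omega> \<le>
        of_bool (cell_event l a b \<omega>) * exp (- \<sigma> a * outer_interference l b \<omega>) + indicator {\<omega>\<in>space M. ?R \<omega>} \<omega>"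
      using AE_regular_config AE_space
    proof eventually_elim
      case (elim \<omega>)
      have e1: "?e \<omega> \<le> 1" using \<sigma>0 serving_dist_pos[OF elim(1)] interference_nonneg[OF elim(1)] by simp
      show ?case
      proof (cases "cell_event l a b \<omega>")
        case True
        note c = cell_eventD[OF elim(1) ab True]
        have "\<sigma> a \<le> \<sigma> (serving_dist H X \<omega>)" using c ab by (intro \<sigma>mono) auto
        then have "?e \<omega> \<le> exp (- \<sigma> a * outer_interference l b \<omega>)"
          using c interference_nonneg[OF elim(1)] by (auto intro!: mult_right_mono)
        then show ?thesis using True c by (simp add: add_increasing2)
      next
        case False
        show ?thesis
        proof (cases "?Q \<omega>")
          case True
          then have "?R \<omega>" using not_cell_eventD[OF elim(1) ab _ _ _ False] by blast
          then have "indicator {\<omega>\<in>space M. ?R \<omega>} \<omega> = (1::real)" using elim(2) by simp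
          then show ?thesis using e1 True False by simp
        next
          case nQ: False
          then have "of_bool (?Q \<omega>) = (0::real)" by simp
          then show ?thesis by (simp only: mult_zero_left) (intro add_nonneg_nonneg, auto)
        qed
      qed
    qed
    show "integrable M (indicat_real {\<omega>\<in>space M. ?R \<omega>})" by (rule integrable_real_indicator) (auto simp: emeasure_eq_measure)
  qed measurable
  also have "\<dots> = expectation (\<lambda>\<omega>. of_bool (cell_event l a b \<omega>) * exp (- \<sigma> a * outer_interference l b \<omega>)) + \<P>(\<omega> in M. ?R \<omega>)"
    by (subst Bochner_Integration.integral_add[OF cell_int[OF \<sigma>ab(1)]])
       (auto simp: emeasure_eq_measure intro!: integrable_real_indicator)
  also have "\<P>(\<omega> in M. ?R \<omega>) \<le>
      ((dens H l)\<^sup>2 + dens H l * dens H (other_tier l) * (guard_dist H l (other_tier l) 1)\<^sup>2) * (pi * (b\<^sup>2 - a\<^sup>2))\<^sup>2"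
    by (rule prob_not_cell[OF ab])
  finally show ?upper unfolding diff cell_laplace[OF ab \<sigma>ab(1)] by simp
qed

lemma tendsto_void_prob: "(f \<longlongrightarrow> r) F \<Longrightarrow> ((\<lambda>x. void_prob l (f x)) \<longlongrightarrow> void_prob l r) F"
  unfolding void_prob_def guard_dist_def by (auto intro!: tendsto_intros)

lemma serving_tail_has_derivative:
  assumes x: "0 < x"
  shows "(serving_tail l \<sigma> has_real_derivative - (serving_density l x * outer_laplace H l x (\<sigma> x))) (at x)"
proof -
  \<comment> \<open>Ordering \<open>x\<close> and \<open>y\<close> by minimum and maximum treats the
    left and right difference quotients at once.\<close>
  define a where "a y = min x y" for y :: real
  define b where "b y = max x y" for y :: real
  define K where "K = (dens H l)\<^sup>2 + dens H l * dens H (other_tier l) * (guard_dist H l (other_tier l) 1)\<^sup>2"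
  define q where "q y = (serving_tail l \<sigma> (a y) - serving_tail l \<sigma> (b y)) / (b y - a y)" for y
  define lo where "lo y = dens H l * (pi * (b y + a y)) * void_prob l (b y) * outer_laplace H l (b y) (\<sigma> (b y))" for y
  \<comment> \<open>\<open>(b y)\<^sup>2 - (a y)\<^sup>2\<close> contains the factor
    \<open>b y - a y\<close>; after division by it the squared error keeps one such factor and tends
    to 0.\<close>
  define hi where "hi y = dens H l * (pi * (b y + a y)) * void_prob l (b y) * outer_laplace H l (b y) (\<sigma> (a y)) +
      K * (pi * (b y + a y))\<^sup>2 * (b y - a y)" for y
  have idl: "((\<lambda>y. y) \<longlongrightarrow> x) (at x)" by (rule tendsto_ident_at)
  have al: "(a \<longlongrightarrow> x) (at x)" using tendsto_min[OF tendsto_const[of x] idl] by (simp add: a_def[abs_def])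
  have bl: "(b \<longlongrightarrow> x) (at x)" using tendsto_max[OF tendsto_const[of x] idl] by (simp add: b_def[abs_def])
  have ev: "\<forall>\<^sub>F y in at x. 0 < y \<and> y \<noteq> x"
    using order_tendstoD(1)[OF idl x] eventually_neq_at_within[of x x UNIV] by eventually_elim auto
  have sa: "((\<lambda>y. \<sigma> (a y)) \<longlongrightarrow> \<sigma> x) (at x)" "((\<lambda>y. \<sigma> (b y)) \<longlongrightarrow> \<sigma> x) (at x)"
    using isCont_tendsto_compose[OF \<sigma>cont[OF x]] al bl by auto
  have s0: "\<forall>\<^sub>F y in at x. 0 \<le> \<sigma> (a y)" "\<forall>\<^sub>F y in at x. 0 \<le> \<sigma> (b y)"
    using ev by (eventually_elim; use \<sigma>0 x in \<open>auto simp: a_def b_def\<close>)+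
  note L = tendsto_outer_laplace[OF valid _ bl x \<sigma>0[OF x], where l=l]
  have "(lo \<longlongrightarrow> dens H l * (pi * (x + x)) * void_prob l x * outer_laplace H l x (\<sigma> x)) (at x)"
    unfolding lo_def by (intro tendsto_intros al bl tendsto_void_prob L sa s0)
  moreover have "dens H l * (pi * (x + x)) * void_prob l x * outer_laplace H l x (\<sigma> x) = serving_density l x * outer_laplace H l x (\<sigma> x)"
    by (simp add: serving_density_def)
  ultimately have lo: "(lo \<longlongrightarrow> serving_density l x * outer_laplace H l x (\<sigma> x)) (at x)" by (simp only:)
  have "(hi \<longlongrightarrow> dens H l * (pi * (x + x)) * void_prob l x * outer_laplace H l x (\<sigma> x) + K * (pi * (x + x))\<^sup>2 * (x - x)) (at x)"
    unfolding hi_def by (intro tendsto_intros al bl tendsto_void_prob L sa s0)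
  moreover have "dens H l * (pi * (x + x)) * void_prob l x * outer_laplace H l x (\<sigma> x) + K * (pi * (x + x))\<^sup>2 * (x - x) =
      serving_density l x * outer_laplace H l x (\<sigma> x)"
    by (simp add: serving_density_def)
  ultimately have hi: "(hi \<longlongrightarrow> serving_density l x * outer_laplace H l x (\<sigma> x)) (at x)" by (simp only:)
  have bounds: "lo y \<le> q y \<and> q y \<le> hi y" if y: "0 < y" "y \<noteq> x" for y
  proof -
    have ab: "0 < a y" "a y < b y" using y x by (auto simp: a_def b_def)
    then have d: "0 < b y - a y" by simp
    have sq: "(b y)\<^sup>2 - (a y)\<^sup>2 = (b y + a y) * (b y - a y)" by (simp add: power2_eq_square algebra_simps)
    have "lo y * (b y - a y) \<le> serving_tail l \<sigma> (a y) - serving_tail l \<sigma> (b y)"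
      using serving_tail_sandwich(1)[OF ab] unfolding sq lo_def by (simp add: mult_ac)
    moreover have "serving_tail l \<sigma> (a y) - serving_tail l \<sigma> (b y) \<le> hi y * (b y - a y)"
      using serving_tail_sandwich(2)[OF ab] unfolding sq hi_def K_def[symmetric]
      by (simp add: power2_eq_square algebra_simps)
    ultimately show ?thesis unfolding q_def using d by (simp add: pos_le_divide_eq pos_divide_le_eq)
  qed
  have "(q \<longlongrightarrow> serving_density l x * outer_laplace H l x (\<sigma> x)) (at x)"
  proof (rule tendsto_sandwich[OF _ _ lo hi])
    show "\<forall>\<^sub>F y in at x. lo y \<le> q y" using ev by eventually_elim (use bounds in auto)
    show "\<forall>\<^sub>F y in at x. q y \<le> hi y" using ev by eventually_elim (use bounds in auto)
  qed
  then have "((\<lambda>y. - q y) \<longlongrightarrow> - (serving_density l x * outer_laplace H l x (\<sigma> x))) (at x)" by (rule tendsto_minus)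
  moreover have "- q y = (serving_tail l \<sigma> y - serving_tail l \<sigma> x) / (y - x)" for y
    by (cases "y \<le> x") (auto simp: q_def a_def b_def divide_simps algebra_simps)
  ultimately show ?thesis unfolding has_field_derivative_iff by simp
qed

lemma measurable_serving_laplace:
  "(\<lambda>r. indicator {0<..} r * (serving_density l r * outer_laplace H l r (\<sigma> r))) \<in> borel_measurable borel"
proof -
  have "continuous_on {0<..} (\<lambda>r. serving_density l r * outer_laplace H l r (\<sigma> r))"
  proof (rule continuous_at_imp_continuous_on, rule ballI)
    fix x :: real assume "x \<in> {0<..}"
    then have x: "0 < x" by simp
    have ev: "\<forall>\<^sub>F y in at x. 0 \<le> \<sigma> y"
      using order_tendstoD(1)[OF tendsto_ident_at x] by eventually_elim (rule \<sigma>0)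
    show "isCont (\<lambda>r. serving_density l r * outer_laplace H l r (\<sigma> r)) x"
      unfolding isCont_def serving_density_def
      by (intro tendsto_intros tendsto_void_prob tendsto_outer_laplace[OF valid _ _ x \<sigma>0[OF x] ev] isCont_tendsto_compose[OF \<sigma>cont[OF x]])
  qed
  then have "(\<lambda>r. indicator {0<..} r *\<^sub>R (serving_density l r * outer_laplace H l r (\<sigma> r))) \<in> borel_measurable borel"
    by (intro borel_measurable_continuous_on_indicator) auto
  then show ?thesis by simp
qed

lemma serving_tail_eq_integral:
  assumes a: "0 < a"
  shows "(\<integral>\<^sup>+r. ennreal (indicator {0<..} r * (serving_density l r * outer_laplace H l r (\<sigma> r))) * indicator {a..} r \<partial>lborel) =
    ennreal (serving_tail l \<sigma> a)"
proof -
  have "(\<integral>\<^sup>+r. ennreal (indicator {0<..} r * (serving_density l r * outer_laplace H l r (\<sigma> r))) * indicator {a..} r \<partial>lborel) =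
    ennreal (0 - (- serving_tail l \<sigma> a))"
  proof (rule nn_integral_FTC_atLeast[OF measurable_serving_laplace])
    fix x assume "a \<le> x"
    then have x: "0 < x" using a by simp
    show "((\<lambda>a. - serving_tail l \<sigma> a) has_real_derivative indicator {0<..} x * (serving_density l x * outer_laplace H l x (\<sigma> x))) (at x)"
      using DERIV_minus[OF serving_tail_has_derivative[OF x]] x by simp
    show "0 \<le> indicator {0<..} x * (serving_density l x * outer_laplace H l x (\<sigma> x))"
      using x hetnet_pos(1)[OF valid, of l] outer_laplace_bounds(1)[OF valid x \<sigma>0[OF x], of l]
      by (simp add: serving_density_def void_prob_def)
  next
    have "((\<lambda>a. expectation (\<lambda>\<omega>. of_bool (serving_tier H X \<omega> = l \<and> a < serving_dist H X \<omega>) *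
        exp (- \<sigma> (serving_dist H X \<omega>) * interference H X g \<omega>))) \<longlongrightarrow> expectation (\<lambda>\<omega>. 0)) at_top"
    proof (rule integral_dominated_convergence_at_top[where w="\<lambda>_. 1"])
      show "\<forall>\<^sub>F a in at_top. AE \<omega> in M. norm (of_bool (serving_tier H X \<omega> = l \<and> a < serving_dist H X \<omega>) *
        exp (- \<sigma> (serving_dist H X \<omega>) * interference H X g \<omega>)) \<le> 1"
      proof (rule always_eventually, rule allI)
        fix a
        show "AE \<omega> in M. norm (of_bool (serving_tier H X \<omega> = l \<and> a < serving_dist H X \<omega>) *
          exp (- \<sigma> (serving_dist H X \<omega>) * interference H X g \<omega>)) \<le> 1"
          using AE_regular_config by eventually_elim (auto simp: interference_nonneg serving_dist_pos \<sigma>0)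
      qed
      show "AE \<omega> in M. ((\<lambda>a. of_bool (serving_tier H X \<omega> = l \<and> a < serving_dist H X \<omega>) *
        exp (- \<sigma> (serving_dist H X \<omega>) * interference H X g \<omega>)) \<longlongrightarrow> 0) at_top"
      proof (rule AE_I2)
        fix \<omega>
        have "\<forall>\<^sub>F a in at_top. of_bool (serving_tier H X \<omega> = l \<and> a < serving_dist H X \<omega>) *
          exp (- \<sigma> (serving_dist H X \<omega>) * interference H X g \<omega>) = 0"
          using eventually_ge_at_top[of "serving_dist H X \<omega>"] by eventually_elim auto
        then show "((\<lambda>a. of_bool (serving_tier H X \<omega> = l \<and> a < serving_dist H X \<omega>) *
          exp (- \<sigma> (serving_dist H X \<omega>) * interference H X g \<omega>)) \<longlongrightarrow> 0) at_top"
          by (rule tendsto_eventually)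
      qed
    qed measurable
    then show "((\<lambda>a. - serving_tail l \<sigma> a) \<longlongrightarrow> 0) at_top"
      using tendsto_minus by (fastforce simp: serving_tail_def)
  qed
  then show ?thesis by simp
qed

text \<open>Two measures on the line are compared by their tails: the law of the serving distance
  weighted by the exponential, and the one with the claimed density. The test function
  \<open>\<phi>\<close> then comes for free.\<close>

lemma serving_disintegration:
  assumes [measurable]: "\<phi> \<in> borel_measurable borel"
  shows "(\<integral>\<^sup>+\<omega>. ennreal (of_bool (serving_tier H X \<omega> = l) * exp (- \<sigma> (serving_dist H X \<omega>) * interference H X g \<omega>)) *
      \<phi> (serving_dist H X \<omega>) \<partial>M) =
    (\<integral>\<^sup>+r. ennreal (indicator {0<..} r * (serving_density l r * outer_laplace H l r (\<sigma> r))) * \<phi> r \<partial>lborel)"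
proof -
  let ?w = "\<lambda>\<omega>. of_bool (serving_tier H X \<omega> = l) * exp (- \<sigma> (serving_dist H X \<omega>) * interference H X g \<omega>)"
  let ?f = "\<lambda>r. indicator {0<..} r * (serving_density l r * outer_laplace H l r (\<sigma> r))"
  note [measurable] = measurable_serving_laplace
  have mf: "(\<lambda>r. ennreal (?f r)) \<in> borel_measurable lborel" using measurable_serving_laplace by measurable
  define A where "A = distr (density M (\<lambda>\<omega>. ennreal (?w \<omega>))) borel (serving_dist H X)"
  define B where "B = density lborel (\<lambda>r. ennreal (?f r))"
  have A_eq: "emeasure A S = (\<integral>\<^sup>+\<omega>. ennreal (?w \<omega>) * indicator S (serving_dist H X \<omega>) \<partial>M)" if [measurable]: "S \<in> sets borel" for S
    unfolding A_def by (subst emeasure_distr, simp, simp, subst emeasure_density)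
      (auto intro!: nn_integral_cong simp: indicator_def)
  have "A = B"
  proof (rule measure_eqI_greaterThan_pos)
    show "sets A = sets borel" "sets B = sets borel" by (simp_all add: A_def B_def)
    have "emeasure A {..0} = (\<integral>\<^sup>+\<omega>. 0 \<partial>M)"
      by (subst A_eq, simp, rule nn_integral_cong_AE)
         (use AE_regular_config in eventually_elim, use serving_dist_pos in \<open>force simp: indicator_def\<close>)
    then show "emeasure A {..0} = 0" by simp
    have "emeasure B {..0} = (\<integral>\<^sup>+r. 0 \<partial>(lborel :: real measure))"
      unfolding B_def
      by (subst emeasure_density[OF mf], simp, rule nn_integral_cong) (auto simp: indicator_def)
    then show "emeasure B {..0} = 0" by simp
    fix x :: real assume x: "0 < x"
    have "emeasure A {x<..} = (\<integral>\<^sup>+\<omega>. ennreal (of_bool (serving_tier H X \<omega> = l \<and> x < serving_dist H X \<omega>) *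
        exp (- \<sigma> (serving_dist H X \<omega>) * interference H X g \<omega>)) \<partial>M)"
      by (subst A_eq, simp, rule nn_integral_cong) (auto simp: indicator_def)
    also have "\<dots> = ennreal (serving_tail l \<sigma> x)"
      unfolding serving_tail_def by (rule nn_integral_eq_integral[OF integrable_serving]) auto
    also have "\<dots> = (\<integral>\<^sup>+r. ennreal (?f r) * indicator {x..} r \<partial>lborel)"
      by (rule serving_tail_eq_integral[OF x, symmetric])
    also have "\<dots> = (\<integral>\<^sup>+r. ennreal (?f r) * indicator {x<..} r \<partial>lborel)"
      by (rule nn_integral_cong_AE) (use AE_lborel_singleton[of x] in eventually_elim, auto simp: indicator_def)
    also have "\<dots> = emeasure B {x<..}" unfolding B_def by (subst emeasure_density[OF mf]) auto
    finally show "emeasure A {x<..} = emeasure B {x<..}" .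
  next
    have "emeasure A UNIV \<le> (\<integral>\<^sup>+\<omega>. 1 \<partial>M)"
      by (subst A_eq, simp, rule nn_integral_mono_AE)
         (use AE_regular_config in eventually_elim, auto simp: interference_nonneg serving_dist_pos \<sigma>0)
    also have "\<dots> < \<infinity>" by (simp add: emeasure_space_1)
    finally show "emeasure A UNIV < \<infinity>" .
  qed
  moreover have "(\<integral>\<^sup>+r. \<phi> r \<partial>A) = (\<integral>\<^sup>+\<omega>. ennreal (?w \<omega>) * \<phi> (serving_dist H X \<omega>) \<partial>M)"
    unfolding A_def by (subst nn_integral_distr, simp, simp, subst nn_integral_density) auto
  moreover have "(\<integral>\<^sup>+r. \<phi> r \<partial>B) = (\<integral>\<^sup>+r. ennreal (?f r) * \<phi> r \<partial>lborel)"
    unfolding B_def by (subst nn_integral_density[OF mf]) auto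
  ultimately show ?thesis by simp
qed

end
end

section \<open>Coverage\<close>

text \<open>A single term of the exponential series is at most its sum. The bound does not depend on
  \<open>y\<close> and gives the domination for derivatives of Laplace transforms.\<close>

lemma power_mult_exp_neg_le:
  fixes y c :: real
  assumes "0 \<le> y" "0 < c"
  shows "y ^ n * exp (- c * y) \<le> fact n / c ^ n"
proof -
  have s: "(\<lambda>n. (c * y) ^ n / fact n) sums exp (c * y)"
    using exp_converges[of "c * y"] by (simp add: divide_inverse mult.commute)
  have "(\<Sum>i\<in>{n}. (c * y) ^ i / fact i) \<le> (\<Sum>i. (c * y) ^ i / fact i)"
    by (rule sum_le_suminf) (use assms sums_summable[OF s] in auto)
  then have "(c * y) ^ n / fact n \<le> exp (c * y)" using sums_unique[OF s] by simp
  then have "c ^ n * y ^ n * exp (- c * y) \<le> fact n * (exp (c * y) * exp (- c * y))"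
    by (simp add: divide_le_eq power_mult_distrib exp_minus field_simps)
  also have "exp (c * y) * exp (- c * y) = 1" by (simp add: exp_minus)
  finally show ?thesis using assms by (simp add: field_simps)
qed

text \<open>\<open>F\<close> is any function that agrees with the transform for positive arguments,
  so the lemma applies to closed forms as well as to integrals; the measure is merely finite because
  association has probability below 1.\<close>

lemma (in finite_measure) deriv_pow_laplace_transform:
  fixes Y :: "'a \<Rightarrow> real"
  assumes [measurable]: "Y \<in> borel_measurable M" and Y: "\<And>x. 0 \<le> Y x"
    and F: "\<And>\<theta>. 0 < \<theta> \<Longrightarrow> F \<theta> = (\<integral>x. exp (- \<theta> * Y x) \<partial>M)" and "0 < \<theta>"
  shows "(deriv ^^ k) F \<theta> = (\<integral>x. (- Y x) ^ k * exp (- \<theta> * Y x) \<partial>M)"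
    and "integrable M (\<lambda>x. (- Y x) ^ k * exp (- \<theta> * Y x))"
proof -
  have int: "integrable M (\<lambda>x. (- Y x) ^ k * exp (- \<theta> * Y x))" if "0 < \<theta>" for k \<theta>
  proof (rule integrable_const_bound[where B="fact k / \<theta> ^ k"])
    show "AE x in M. norm ((- Y x) ^ k * exp (- \<theta> * Y x)) \<le> fact k / \<theta> ^ k"
      using power_mult_exp_neg_le[OF Y that] Y by (simp add: abs_mult power_abs)
  qed measurable
  then show "integrable M (\<lambda>x. (- Y x) ^ k * exp (- \<theta> * Y x))" using \<open>0 < \<theta>\<close> .
  have "\<forall>\<theta>>0. (deriv ^^ k) F \<theta> = (\<integral>x. (- Y x) ^ k * exp (- \<theta> * Y x) \<partial>M)"
  proof (induction k)
    case 0
    then show ?case using F by simp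
  next
    case (Suc k)
    show ?case
    proof (intro allI impI)
      fix \<theta> :: real assume \<theta>: "0 < \<theta>"
      have "((\<lambda>\<theta>. \<integral>x. (- Y x) ^ k * exp (- \<theta> * Y x) \<partial>M) has_real_derivative
          (\<integral>x. (- Y x) ^ Suc k * exp (- \<theta> * Y x) \<partial>M)) (at \<theta>)"
      \<comment> \<open>Half the argument is kept as exponential decay, which absorbs the additional
        power of \<open>Y\<close>.\<close>
      proof (rule has_real_derivative_integral_dominated[where a="\<theta>/2" and b="\<theta>+1"
            and w="\<lambda>x. Y x ^ Suc k * exp (- (\<theta>/2) * Y x)" and f'="\<lambda>\<theta> x. (- Y x) ^ Suc k * exp (- \<theta> * Y x)"])
        show "\<theta> \<in> {\<theta>/2<..<\<theta>+1}" using \<theta> by simp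
        show "integrable M (\<lambda>x. Y x ^ Suc k * exp (- (\<theta>/2) * Y x))"
        proof (rule integrable_const_bound[where B="fact (Suc k) / (\<theta>/2) ^ Suc k"])
          show "AE x in M. norm (Y x ^ Suc k * exp (- (\<theta>/2) * Y x)) \<le> fact (Suc k) / (\<theta>/2) ^ Suc k"
          proof (rule AE_I2)
            fix x
            have "\<bar>Y x ^ Suc k * exp (- (\<theta>/2) * Y x)\<bar> = Y x ^ Suc k * exp (- (\<theta>/2) * Y x)"
              by (rule abs_of_nonneg) (use Y in simp)
            then show "norm (Y x ^ Suc k * exp (- (\<theta>/2) * Y x)) \<le> fact (Suc k) / (\<theta>/2) ^ Suc k"
              using power_mult_exp_neg_le[OF Y half_gt_zero[OF \<theta>], of x "Suc k"] by (simp only: real_norm_def)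
          qed
        qed measurable
        fix t x assume t: "t \<in> {\<theta>/2<..<\<theta>+1}"
        have "((\<lambda>\<theta>. exp (- \<theta> * Y x)) has_real_derivative - Y x * exp (- t * Y x)) (at t)"
          by (auto intro!: derivative_eq_intros)
        from DERIV_cmult[OF this, of "(- Y x) ^ k"]
        show "((\<lambda>\<theta>. (- Y x) ^ k * exp (- \<theta> * Y x)) has_real_derivative (- Y x) ^ Suc k * exp (- t * Y x)) (at t)"
          by (simp add: mult_ac)
        have "\<bar>(- Y x) ^ Suc k * exp (- t * Y x)\<bar> = Y x ^ Suc k * exp (- t * Y x)"
          using Y by (simp add: abs_mult power_abs)
        also have "\<dots> \<le> Y x ^ Suc k * exp (- (\<theta>/2) * Y x)"
        proof -
          have "\<theta> / 2 * Y x \<le> t * Y x" using t Y by (intro mult_right_mono) auto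
          then show ?thesis using Y by (intro mult_left_mono zero_le_power) auto
        qed
        finally show "\<bar>(- Y x) ^ Suc k * exp (- t * Y x)\<bar> \<le> Y x ^ Suc k * exp (- (\<theta>/2) * Y x)" .
      next
        fix t assume "t \<in> {\<theta>/2<..<\<theta>+1}"
        then show "integrable M (\<lambda>x. (- Y x) ^ k * exp (- t * Y x))" using \<theta> by (intro int) auto
      qed measurable
      then have "((deriv ^^ k) F has_real_derivative (\<integral>x. (- Y x) ^ Suc k * exp (- \<theta> * Y x) \<partial>M)) (at \<theta>)"
        by (rule has_field_derivative_transform_within_open[of _ _ _ "{0<..}"]) (use \<theta> Suc in auto)
      then show "(deriv ^^ Suc k) F \<theta> = (\<integral>x. (- Y x) ^ Suc k * exp (- \<theta> * Y x) \<partial>M)"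
        by (simp add: DERIV_imp_deriv)
    qed
  qed
  then show "(deriv ^^ k) F \<theta> = (\<integral>x. (- Y x) ^ k * exp (- \<theta> * Y x) \<partial>M)" using \<open>0 < \<theta>\<close> by blast
qed

text \<open>For \<open>n\<close> at least 1 and nonnegative \<open>y\<close>, the probability that a
  Gamma variable of shape \<open>n\<close> and scale 1 exceeds \<open>y\<close>, equivalently that a
  Poisson variable of mean \<open>y\<close> is below \<open>n\<close>.\<close>

definition erlang_tail :: "nat \<Rightarrow> real \<Rightarrow> real" where
  "erlang_tail n y = (\<Sum>k<n. y ^ k / fact k * exp (- y))"

lemma measurable_erlang_tail [measurable]: "erlang_tail n \<in> borel_measurable borel"
  unfolding erlang_tail_def[abs_def] by measurable

lemma emeasure_erlang_greaterThan:
  assumes "0 \<le> y" "0 < n"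
  shows "emeasure (density lborel (\<lambda>x. ennreal (erlang_density (n - 1) 1 x))) {y<..} = ennreal (erlang_tail n y)"
    and "0 \<le> erlang_tail n y" "erlang_tail n y \<le> 1"
proof -
  let ?E = "density lborel (\<lambda>x. ennreal (erlang_density (n - 1) 1 x))"
  interpret E: prob_space ?E by (rule prob_space_erlang_density) simp
  have 0: "0 \<le> erlang_tail n y" unfolding erlang_tail_def using assms by (intro sum_nonneg) auto
  then show "0 \<le> erlang_tail n y" .
  have cdf: "erlang_CDF (n - 1) 1 y = 1 - erlang_tail n y"
  proof -
    have "{..n - 1} = {..<n}" using assms by auto
    then show ?thesis using assms by (simp add: erlang_CDF_def erlang_tail_def)
  qed
  have compl: "{y<..} = space ?E - {..y}" by auto
  have "emeasure ?E {y<..} = emeasure ?E (space ?E - {..y})" by (rule arg_cong[OF compl])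
  also have "\<dots> = emeasure ?E (space ?E) - emeasure ?E {..y}"
    by (rule emeasure_compl) (use E.emeasure_finite in \<open>auto simp del: One_nat_def\<close>)
  also have "emeasure ?E {..y} = ennreal (1 - erlang_tail n y)"
    unfolding cdf[symmetric] by (rule emeasure_erlang_density) (use assms in auto)
  also have "emeasure ?E (space ?E) = 1" by (rule E.emeasure_space_1)
  finally have *: "emeasure ?E {y<..} = 1 - ennreal (1 - erlang_tail n y)" .
  have "erlang_CDF (n - 1) 1 y \<ge> 0" by (rule erlang_CDF_nonneg) simp
  then show le1: "erlang_tail n y \<le> 1" unfolding cdf by simp
  have "1 - ennreal (1 - erlang_tail n y) = ennreal 1 - ennreal (1 - erlang_tail n y)" by simp
  also have "\<dots> = ennreal (1 - (1 - erlang_tail n y))" using le1 0 by (subst ennreal_minus[symmetric]) auto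
  finally show "emeasure ?E {y<..} = ennreal (erlang_tail n y)" unfolding * by simp
qed

section \<open>Laplace transforms at a fixed distance, association probabilities and the distance
  law\<close>

context hetnet_sources begin

lemma outer_interference_nonneg: "0 < r \<Longrightarrow> AE \<omega> in M. 0 \<le> outer_interference l r \<omega>"
proof -
  assume r: "0 < r"
  have "AE \<omega> in M. 0 \<le> outer_shot j (guard_dist H l j r) \<omega>" for j
    by (rule outer_shot_nonneg[OF guard_dist_pos[OF valid r]])
  then have "AE \<omega> in M. \<forall>j. 0 \<le> outer_shot j (guard_dist H l j r) \<omega>" by (rule AE_all_tiers)
  then show ?thesis by eventually_elim (auto simp: outer_interference_def intro!: sum_nonneg)
qed

lemma expectation_exp_outer_interference:
  assumes r: "0 < r" and s: "0 \<le> s"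
  shows "expectation (\<lambda>\<omega>. exp (- s * outer_interference l r \<omega>)) = outer_laplace H l r s"
proof -
  let ?o = "other_tier l"
  let ?U = "\<lambda>j \<omega>. exp (- s * outer_shot j (guard_dist H l j r) \<omega>)"
  have "expectation (\<lambda>\<omega>. exp (- s * outer_interference l r \<omega>)) = expectation (\<lambda>\<omega>. ?U l \<omega> * ?U ?o \<omega>)"
    by (simp add: outer_interference_def UNIV_tier_other[of l] exp_add[symmetric] algebra_simps)
  also have "\<dots> = expectation (?U l) * expectation (?U ?o)"
  proof (rule expectation_mult_source_sigma)
    note [measurable] = measurable_outer_shot_sources[OF order_refl]
    show "?U l \<in> borel_measurable (source_sigma (tier_sources l))" by measurable
    show "?U ?o \<in> borel_measurable (source_sigma (tier_sources ?o))" by measurable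
    show "tier_sources l \<inter> tier_sources ?o = {}" by (auto simp: tier_sources_def)
  qed auto
  finally have prod: "expectation (\<lambda>\<omega>. exp (- s * outer_interference l r \<omega>)) = expectation (?U l) * expectation (?U ?o)" .
  have "expectation (?U j) = exp (- tier_exponent H l j r s)" for j
  proof -
    interpret P: ppp M "X j" "dens H j" by (rule ppp_points)
    have "\<P>(\<omega> in M. count_in (X j) {} \<omega> = 0) = 1" by (simp add: count_in_def prob_space)
    then show ?thesis
      using tier_laplace[OF guard_dist_pos[OF valid r, of l j] s, where B="{}" and C="{}" and j=j and k=0 and l=0]
      by (simp add: count_in_def tier_exponent_def prob_space)
  qed
  then show ?thesis unfolding prod outer_laplace_def UNIV_tier_other[of l] by (simp add: exp_add[symmetric])
qed

text \<open>For fixed \<open>r\<close> the closed form is the Laplace transform of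
  \<open>outer_interference l r\<close> plus noise, so its derivatives are expectations of powers;
  the signs of \<open>- s\<close> and \<open>- Y\<close> cancel, leaving the Poisson sum.\<close>

lemma erlang_tail_expectation:
  assumes r: "0 < r" and s: "0 < s"
  shows "(\<Sum>k<n. 1 / fact k * (- s) ^ k * (deriv ^^ k) (noisy_laplace H l r) s) =
    expectation (\<lambda>\<omega>. erlang_tail n (max 0 (s * (outer_interference l r \<omega> + noise H))))"
proof -
  \<comment> \<open>The outer interference is nonnegative only almost surely; the maximum makes
    \<open>Y\<close> nonnegative everywhere.\<close>
  define Y where "Y \<omega> = max 0 (outer_interference l r \<omega> + noise H)" for \<omega>
  have [measurable]: "Y \<in> borel_measurable M" unfolding Y_def[abs_def] by measurable
  have Y0: "0 \<le> Y \<omega>" for \<omega> by (simp add: Y_def)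
  have F: "noisy_laplace H l r \<theta> = expectation (\<lambda>\<omega>. exp (- \<theta> * Y \<omega>))" if "0 < \<theta>" for \<theta>
  proof -
    have "expectation (\<lambda>\<omega>. exp (- \<theta> * Y \<omega>)) = expectation (\<lambda>\<omega>. exp (- \<theta> * noise H) * exp (- \<theta> * outer_interference l r \<omega>))"
    proof (rule integral_cong_AE)
      show "AE \<omega> in M. exp (- \<theta> * Y \<omega>) = exp (- \<theta> * noise H) * exp (- \<theta> * outer_interference l r \<omega>)"
        using outer_interference_nonneg[OF r, of l]
        by eventually_elim (use hetnet_pos(6)[OF valid] in \<open>simp add: Y_def exp_add[symmetric] algebra_simps\<close>)
    qed measurable
    also have "\<dots> = noisy_laplace H l r \<theta>"
      using expectation_exp_outer_interference[OF r, of \<theta> l] that noisy_laplace_eq[OF valid r that]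
      by simp
    finally show ?thesis ..
  qed
  note D = deriv_pow_laplace_transform[OF _ Y0 F s]
  have mx: "max 0 (s * (outer_interference l r \<omega> + noise H)) = s * Y \<omega>" for \<omega>
    using s by (simp add: Y_def max_def zero_le_mult_iff mult_le_0_iff)
  have "(\<Sum>k<n. 1 / fact k * (- s) ^ k * (deriv ^^ k) (noisy_laplace H l r) s) =
      (\<Sum>k<n. expectation (\<lambda>\<omega>. 1 / fact k * (- s) ^ k * ((- Y \<omega>) ^ k * exp (- s * Y \<omega>))))"
    by (simp add: D(1))
  also have "\<dots> = expectation (\<lambda>\<omega>. \<Sum>k<n. 1 / fact k * (- s) ^ k * ((- Y \<omega>) ^ k * exp (- s * Y \<omega>)))"
    by (rule Bochner_Integration.integral_sum[symmetric]) (intro integrable_mult_right D(2), simp)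
  also have "\<dots> = expectation (\<lambda>\<omega>. erlang_tail n (s * Y \<omega>))"
    by (rule Bochner_Integration.integral_cong)
       (auto intro!: sum.cong simp: erlang_tail_def power_mult_distrib[symmetric])
  finally show ?thesis unfolding mx .
qed

text \<open>With zero noise the SINR would otherwise risk division by zero. The non-serving tier
  loses no station, and half its nearest distance is a cut-off that excludes none of its points, so
  its share is a convergent sum of positive terms.\<close>

lemma interference_pos:
  assumes reg: "regular_config \<omega>"
  shows "0 < interference H X g \<omega>"
proof -
  let ?l = "serving_tier H X \<omega>" 
  let ?o = "other_tier ?l"
  let ?c = "nearest_dist X ?o \<omega> / 2"
  let ?I = "\<lambda>j. \<Sum>\<^sub>\<infinity>n\<in>interferers H X j \<omega>. tx_power H j * g j n \<omega> * norm (X j n \<omega>) powr (- pathloss H)"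
  have c: "0 < ?c" "?c < norm (X ?o n \<omega>)" for n
    using nearest_dist_pos[OF reg, of ?o] nearest_dist_le[of ?o \<omega> n] by auto
  have "?I ?o = outer_shot ?o ?c \<omega>"
    by (rule infsum_eq_outer_shot[OF reg c(1)]) (use c in \<open>auto simp: interferers_def\<close>)
  also have "\<dots> > 0"
  proof -
    have "0 < g ?o n \<omega> * kernel ?o ?c (X ?o n \<omega>)" for n
      using reg c(1) c(2)[of n] hetnet_pos(2)[OF valid] by (simp add: regular_config_def kernel_def)
    then show ?thesis
      unfolding outer_shot_def using reg c by (intro suminf_pos) (auto simp: regular_config_def)
  qed
  finally have "0 < ?I ?o" .
  moreover have "0 \<le> ?I ?l"
    using reg hetnet_pos(2)[OF valid] by (intro infsum_nonneg) (auto simp: regular_config_def less_imp_le)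
  moreover have "interference H X g \<omega> = ?I ?l + ?I ?o"
  proof -
    have "{MBS, SBS} = {?l, ?o}" using UNIV_tier UNIV_tier_other by metis
    then show ?thesis by (simp add: interference_def)
  qed
  ultimately show ?thesis by simp
qed

text \<open>The mean number of points within the guard distances for \<open>r\<close>, over both
  tiers, is \<open>pi * r\<^sup>2\<close> times this constant.\<close>

definition total_intensity :: "tier \<Rightarrow> real" where
  "total_intensity l = (\<Sum>j\<in>UNIV. dens H j * (guard_dist H l j 1)\<^sup>2)"

lemma void_prob_eq: "void_prob l r = exp (- pi * r\<^sup>2 * total_intensity l)"
proof -
  have "guard_dist H l j r = guard_dist H l j 1 * r" for j by (simp add: guard_dist_def)
  then have "dens H j * (pi * (guard_dist H l j r)\<^sup>2) = pi * r\<^sup>2 * (dens H j * (guard_dist H l j 1)\<^sup>2)" for j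
    by (simp add: power_mult_distrib mult_ac)
  then show ?thesis
    unfolding void_prob_def total_intensity_def by (simp only: sum_distrib_left mult_minus_left sum_negf)
qed

lemma total_intensity_eq:
  "total_intensity MBS = dens H MBS + dens H SBS * bias_ratio H powr (2 / pathloss H)"
  "total_intensity SBS = dens H SBS + dens H MBS * bias_ratio H powr (- (2 / pathloss H))"
  by (simp_all add: total_intensity_def UNIV_tier guard_dist_def power2_eq_square powr_add[symmetric])

lemma total_intensity_pos: "0 < total_intensity l"
  unfolding total_intensity_def
  using hetnet_pos(1)[OF valid] guard_dist_pos[OF valid, of 1]
  by (intro sum_pos mult_pos_pos zero_less_power) (auto simp: UNIV_tier)

lemma serving_density_nonneg: "0 \<le> r \<Longrightarrow> 0 \<le> serving_density l r"
  using hetnet_pos(1)[OF valid, of l] by (simp add: serving_density_def void_prob_def)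

lemma measurable_serving_density [measurable]: "serving_density l \<in> borel_measurable borel"
  unfolding serving_density_def[abs_def] void_prob_eq by measurable

lemma outer_laplace_0 [simp]: "outer_laplace H l r 0 = 1"
  by (simp add: outer_laplace_def tier_exponent_def shot_exponent_def)

lemma serving_law:
  assumes [measurable]: "\<phi> \<in> borel_measurable borel"
  shows "(\<integral>\<^sup>+\<omega>. ennreal (of_bool (serving_tier H X \<omega> = l)) * \<phi> (serving_dist H X \<omega>) \<partial>M) =
    (\<integral>\<^sup>+r. ennreal (indicator {0<..} r * serving_density l r) * \<phi> r \<partial>lborel)"
  using serving_disintegration[of "\<lambda>_. 0" \<phi> l] by simp

lemma assoc_event_sets [measurable]: "assoc_event M H X l \<in> sets M"
  unfolding assoc_event_def by measurable

text \<open>The density of the distance on the association event has an explicit antiderivative, a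
  multiple of \<open>exp (- pi * r\<^sup>2 * total_intensity l)\<close>, which vanishes at
  infinity.\<close>

lemma prob_assoc_event: "prob (assoc_event M H X l) = dens H l / total_intensity l"
proof -
  let ?\<Lambda> = "total_intensity l"
  have L: "0 < ?\<Lambda>" by (rule total_intensity_pos)
  have "emeasure M (assoc_event M H X l) = (\<integral>\<^sup>+\<omega>. ennreal (of_bool (serving_tier H X \<omega> = l)) * 1 \<partial>M)"
    by (subst nn_integral_indicator[symmetric, OF assoc_event_sets], rule nn_integral_cong)
       (auto simp: assoc_event_def)
  also have "\<dots> = (\<integral>\<^sup>+r. ennreal (indicator {0<..} r * serving_density l r) * 1 \<partial>lborel)"
    by (rule serving_law) simp
  also have "\<dots> = (\<integral>\<^sup>+r. ennreal (serving_density l r) * indicator {0..} r \<partial>lborel)"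
    by (rule nn_integral_cong_AE) (use AE_lborel_singleton[of "0::real"] in eventually_elim, auto simp: indicator_def)
  also have "\<dots> = ennreal (0 - (- (dens H l / ?\<Lambda>) * exp (- pi * 0\<^sup>2 * ?\<Lambda>)))"
  proof (rule nn_integral_FTC_atLeast)
    show "((\<lambda>r. - (dens H l / ?\<Lambda>) * exp (- pi * r\<^sup>2 * ?\<Lambda>)) has_real_derivative serving_density l r) (at r)" for r
      unfolding serving_density_def void_prob_eq using L
      by (auto intro!: derivative_eq_intros simp: field_simps)
    have "filterlim (\<lambda>r::real. (pi * ?\<Lambda>) * r\<^sup>2) at_top at_top"
      using L by (intro filterlim_tendsto_pos_mult_at_top[OF tendsto_const] filterlim_pow_at_top filterlim_ident) auto
    then have "filterlim (\<lambda>r::real. - ((pi * ?\<Lambda>) * r\<^sup>2)) at_bot at_top"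
      by (simp add: filterlim_uminus_at_bot)
    then have "((\<lambda>r::real. exp (- ((pi * ?\<Lambda>) * r\<^sup>2))) \<longlongrightarrow> 0) at_top"
      by (rule filterlim_compose[OF exp_at_bot])
    from tendsto_mult_right_zero[OF this, of "- (dens H l / ?\<Lambda>)"]
    show "((\<lambda>r. - (dens H l / ?\<Lambda>) * exp (- pi * r\<^sup>2 * ?\<Lambda>)) \<longlongrightarrow> 0) at_top"
      by (simp add: mult_ac)
  qed (auto simp: serving_density_nonneg)
  finally show ?thesis using L hetnet_pos(1)[OF valid, of l] by (simp add: measure_def)
qed

lemma prob_assoc_event_pos: "0 < prob (assoc_event M H X l)"
  unfolding prob_assoc_event using total_intensity_pos hetnet_pos(1)[OF valid] by simp

lemma sbs_assoc_prob_eq: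
  "sbs_assoc_prob M H X = 1 / (1 + dens H MBS / dens H SBS * (1 / bias_ratio H powr (2 / pathloss H)))"
proof -
  have "0 < bias_ratio H powr (2 / pathloss H)" using bias_ratio_pos[OF valid] by simp
  then show ?thesis
    unfolding sbs_assoc_prob_def prob_assoc_event total_intensity_eq powr_minus
    using hetnet_pos(1)[OF valid, of SBS] hetnet_pos(1)[OF valid, of MBS] by (simp add: divide_simps)
qed

lemma prob_assoc_event_MBS: "prob (assoc_event M H X MBS) = 1 - sbs_assoc_prob M H X"
proof -
  have "assoc_event M H X MBS = space M - assoc_event M H X SBS"
    by (auto simp: assoc_event_def intro: tier.exhaust)
  then show ?thesis by (simp add: sbs_assoc_prob_def prob_compl)
qed

lemma serving_dist_density_eq:
  "serving_dist_density M H X l r = serving_density l r / prob (assoc_event M H X l)"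
  unfolding serving_dist_density_def serving_density_def void_prob_eq
  by (cases l) (simp_all add: prob_assoc_event_MBS sbs_assoc_prob_def[symmetric] total_intensity_eq)

lemma nn_integral_assoc:
  assumes [measurable]: "f \<in> borel_measurable M"
  shows "(\<integral>\<^sup>+\<omega>. f \<omega> \<partial>uniform_measure M (assoc_event M H X l)) =
    (\<integral>\<^sup>+\<omega>. ennreal (of_bool (serving_tier H X \<omega> = l)) * f \<omega> \<partial>M) / emeasure M (assoc_event M H X l)"
proof -
  have "(\<integral>\<^sup>+\<omega>. f \<omega> * indicator (assoc_event M H X l) \<omega> \<partial>M) = (\<integral>\<^sup>+\<omega>. ennreal (of_bool (serving_tier H X \<omega> = l)) * f \<omega> \<partial>M)"
    by (rule nn_integral_cong) (auto simp: assoc_event_def indicator_def)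
  then show ?thesis by (simp add: nn_integral_uniform_measure)
qed

lemma distributed_serving_dist:
  "distributed (uniform_measure M (assoc_event M H X l)) lborel (serving_dist H X)
    (\<lambda>r. ennreal (serving_dist_density M H X l r * indicator {0<..} r))"
proof -
  let ?P = "prob (assoc_event M H X l)"
  let ?U = "uniform_measure M (assoc_event M H X l)"
  have P: "0 < ?P" by (rule prob_assoc_event_pos)
  have [measurable]: "serving_dist_density M H X l \<in> borel_measurable borel"
    unfolding serving_dist_density_eq[abs_def] by measurable
  have "distr ?U lborel (serving_dist H X) = density lborel (\<lambda>r. ennreal (serving_dist_density M H X l r * indicator {0<..} r))"
  proof (rule measure_eqI)
    fix S assume "S \<in> sets (distr ?U lborel (serving_dist H X))"
    then have [measurable]: "S \<in> sets borel" by simp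
    have "emeasure (distr ?U lborel (serving_dist H X)) S = (\<integral>\<^sup>+\<omega>. indicator S (serving_dist H X \<omega>) \<partial>?U)"
      by (subst nn_integral_indicator[symmetric], simp, subst nn_integral_distr) auto
    also have "\<dots> = (\<integral>\<^sup>+r. ennreal (indicator {0<..} r * serving_density l r) * indicator S r \<partial>lborel) / emeasure M (assoc_event M H X l)"
      by (subst nn_integral_assoc) (simp_all add: serving_law)
    also have "\<dots> = (\<integral>\<^sup>+r. ennreal (indicator {0<..} r * serving_density l r) * indicator S r / ennreal ?P \<partial>lborel)"
      unfolding emeasure_eq_measure by (rule nn_integral_divide[symmetric]) measurable
    also have "\<dots> = (\<integral>\<^sup>+r. ennreal (serving_dist_density M H X l r * indicator {0<..} r) * indicator S r \<partial>lborel)"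
    proof (rule nn_integral_cong)
      fix r
      show "ennreal (indicator {0<..} r * serving_density l r) * indicator S r / ennreal ?P =
        ennreal (serving_dist_density M H X l r * indicator {0<..} r) * indicator S r"
        unfolding serving_dist_density_eq
        using P serving_density_nonneg[of r l] by (auto simp: indicator_def divide_ennreal)
    qed
    also have "\<dots> = emeasure (density lborel (\<lambda>r. ennreal (serving_dist_density M H X l r * indicator {0<..} r))) S"
      by (subst emeasure_density) auto
    finally show "emeasure (distr ?U lborel (serving_dist H X)) S = \<dots>" .
  qed simp
  then show ?thesis by (simp add: distributed_def)
qed

lemma measurable_outer_laplace_const:
  assumes s: "0 \<le> s"
  shows "(\<lambda>r. indicator {0<..} r * outer_laplace H l r s) \<in> borel_measurable borel"
proof -
  have "continuous_on {0<..} (\<lambda>r. outer_laplace H l r s)"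
    by (rule continuous_at_imp_continuous_on, rule ballI, unfold isCont_def)
       (intro tendsto_outer_laplace[OF valid] tendsto_intros, use s in auto)
  then have "(\<lambda>r. indicator {0<..} r *\<^sub>R outer_laplace H l r s) \<in> borel_measurable borel"
    by (intro borel_measurable_continuous_on_indicator) auto
  then show ?thesis by simp
qed

text \<open>Every event of the conditioning sigma-algebra has the form that the serving distance
  lies in a Borel set \<open>S\<close>. Disintegration with constant \<open>\<sigma> = s\<close>
  reduces both sides of the defining identity to the same integral over \<open>S\<close>.\<close>

lemma conditional_laplace_interference: "conditional_laplace M H X g l (interference_laplace H l)"
  unfolding conditional_laplace_def Let_def
proof (intro allI impI)
  fix s :: real assume s: "0 < s"
  let ?A = "assoc_event M H X l"
  let ?U = "uniform_measure M ?A"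
  let ?F = "vimage_algebra (space M) (serving_dist H X) borel"
  \<comment> \<open>A bounded Borel version: closed form and \<open>outer_laplace\<close> are
    related only at positive distances, where the serving distance almost surely lies.\<close>
  define L where "L r = indicator {0<..} r * outer_laplace H l r s" for r
  have [measurable]: "L \<in> borel_measurable borel" unfolding L_def using s by (intro measurable_outer_laplace_const) simp
  have L: "0 \<le> L r" "L r \<le> 1" for r
    using outer_laplace_bounds[OF valid _ less_imp_le[OF s], of r l] by (auto simp: L_def indicator_def less_imp_le)
  have eP: "emeasure M ?A \<noteq> 0" using prob_assoc_event_pos[of l] by (simp add: emeasure_eq_measure)
  interpret U: prob_space ?U by (rule prob_space_uniform_measure) (use eP in auto)
  have ac: "AE \<omega> in ?U. P \<omega>" if "AE \<omega> in M. P \<omega>" for P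
    by (rule AE_uniform_measureI[OF assoc_event_sets]) (use that in eventually_elim, simp)
  have regU: "AE \<omega> in ?U. regular_config \<omega>" by (rule ac[OF AE_regular_config])
  have mU [simp]: "f \<in> measurable ?U N \<longleftrightarrow> f \<in> measurable M N" for f :: "'w \<Rightarrow> 'b" and N
    by (rule arg_cong2[where f="(\<in>)", OF refl], rule measurable_cong_sets) auto
  have sub: "subalgebra ?U ?F"
    unfolding subalgebra_def using measurable_serving(2) by (auto simp: sets_vimage_algebra2 measurable_sets)
  interpret F: finite_measure_subalgebra ?U ?F by unfold_locales (rule sub)
  have Rm: "serving_dist H X \<in> borel_measurable ?F" by (rule measurable_vimage_algebra1) auto
  have e1: "AE \<omega> in ?U. norm (exp (- s * interference H X g \<omega>)) \<le> 1"
    using regU by eventually_elim (use s interference_nonneg in simp)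
  have "AE \<omega> in ?U. real_cond_exp ?U ?F (\<lambda>\<omega>. exp (- s * interference H X g \<omega>)) \<omega> = L (serving_dist H X \<omega>)"
  proof (rule F.real_cond_exp_charact)
    show "integrable ?U (\<lambda>\<omega>. exp (- s * interference H X g \<omega>))"
      by (rule U.integrable_const_bound[OF e1]) simp
    show "integrable ?U (\<lambda>\<omega>. L (serving_dist H X \<omega>))"
      by (rule U.integrable_const_bound[where B=1]) (use L in auto)
    show "(\<lambda>\<omega>. L (serving_dist H X \<omega>)) \<in> borel_measurable ?F" using Rm by measurable
    fix B assume "B \<in> sets ?F"
    then obtain S where S: "S \<in> sets borel" "B = serving_dist H X -` S \<inter> space M"
      by (auto simp: sets_vimage_algebra2)
    note [measurable] = S(1)
    have nn: "(\<integral>\<^sup>+\<omega>. ennreal (indicator S (serving_dist H X \<omega>) * exp (- s * interference H X g \<omega>)) \<partial>?U) =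
        (\<integral>\<^sup>+\<omega>. ennreal (indicator S (serving_dist H X \<omega>) * L (serving_dist H X \<omega>)) \<partial>?U)"
    proof -
      have "(\<integral>\<^sup>+\<omega>. ennreal (of_bool (serving_tier H X \<omega> = l)) *
          ennreal (indicator S (serving_dist H X \<omega>) * exp (- s * interference H X g \<omega>)) \<partial>M) =
        (\<integral>\<^sup>+\<omega>. ennreal (of_bool (serving_tier H X \<omega> = l) * exp (- s * interference H X g \<omega>)) *
          indicator S (serving_dist H X \<omega>) \<partial>M)"
        by (rule nn_integral_cong) (auto simp: indicator_def)
      also have "\<dots> = (\<integral>\<^sup>+r. ennreal (indicator {0<..} r * (serving_density l r * outer_laplace H l r s)) * indicator S r \<partial>lborel)"
        using serving_disintegration[of "\<lambda>_. s" "indicator S" l] s by simp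
      also have "\<dots> = (\<integral>\<^sup>+r. ennreal (indicator {0<..} r * serving_density l r) * ennreal (indicator S r * L r) \<partial>lborel)"
      proof (rule nn_integral_cong)
        fix r
        show "ennreal (indicator {0<..} r * (serving_density l r * outer_laplace H l r s)) * indicator S r =
          ennreal (indicator {0<..} r * serving_density l r) * ennreal (indicator S r * L r)"
          using serving_density_nonneg[of r l] by (auto simp: L_def indicator_def ennreal_mult')
      qed
      also have "\<dots> = (\<integral>\<^sup>+\<omega>. ennreal (of_bool (serving_tier H X \<omega> = l)) *
          ennreal (indicator S (serving_dist H X \<omega>) * L (serving_dist H X \<omega>)) \<partial>M)"
        by (rule serving_law[symmetric]) measurable
      finally show ?thesis by (subst (1 2) nn_integral_assoc) auto
    qed
    have eq: "set_lebesgue_integral ?U B f = (\<integral>\<omega>. indicator S (serving_dist H X \<omega>) * f \<omega> \<partial>?U)" for f :: "'w \<Rightarrow> real"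
      unfolding set_lebesgue_integral_def
      by (rule Bochner_Integration.integral_cong) (auto simp: S(2) indicator_def)
    show "set_lebesgue_integral ?U B (\<lambda>\<omega>. exp (- s * interference H X g \<omega>)) = set_lebesgue_integral ?U B (\<lambda>\<omega>. L (serving_dist H X \<omega>))"
      unfolding eq
      by (subst (1 2) integral_eq_nn_integral) (use L nn in \<open>auto intro!: AE_I2\<close>)
  qed
  with regU show "AE \<omega> in ?U. real_cond_exp ?U ?F (\<lambda>\<omega>. exp (- s * interference H X g \<omega>)) \<omega> =
      interference_laplace H l s (serving_dist H X \<omega>)"
    by eventually_elim (use interference_laplace_eq[OF valid serving_dist_pos s] serving_dist_pos in \<open>simp add: L_def\<close>)
qed

lemma distr_signal: "distr M borel (h l) = density lborel (\<lambda>x. ennreal (erlang_density (dof H l - 1) 1 x))"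
  using distributed_distr_eq_density[OF distributed_signal] by (simp cong: distr_cong)

text \<open>Joint measurability in distance and outcome, required for Fubini on the product of the
  distance law with \<open>M\<close>.\<close>

lemma measurable_outer_interference_pair [measurable]:
  "(\<lambda>(r, \<omega>). outer_interference l r \<omega>) \<in> borel_measurable (borel \<Otimes>\<^sub>M M)"
proof -
  have [measurable]: "guard_dist H l j \<in> borel_measurable borel" for j
    unfolding guard_dist_def[abs_def] by measurable
  have ind: "indicator {guard_dist H l j (fst z)<..} (norm (X j n (snd z))) =
      (if guard_dist H l j (fst z) < norm (X j n (snd z)) then 1 else 0 :: real)" for j n and z :: "real \<times> 'w"
    by simp
  show ?thesis
    unfolding outer_interference_def outer_shot_def kernel_def case_prod_beta ind by measurable
qed

lemma measurable_sinr [measurable]: "sinr H X g h \<in> borel_measurable M"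
proof -
  have "sinr H X g h = (\<lambda>\<omega>. (if serving_tier H X \<omega> = MBS then tx_power H MBS * h MBS \<omega> else tx_power H SBS * h SBS \<omega>) *
      serving_dist H X \<omega> powr (- pathloss H) / (interference H X g \<omega> + noise H))"
  proof
    fix \<omega>
    show "sinr H X g h \<omega> = (if serving_tier H X \<omega> = MBS then tx_power H MBS * h MBS \<omega> else tx_power H SBS * h SBS \<omega>) *
      serving_dist H X \<omega> powr (- pathloss H) / (interference H X g \<omega> + noise H)"
      by (cases "serving_tier H X \<omega>") (simp_all add: sinr_def)
  qed
  then show ?thesis by simp
qed

section \<open>Coverage at a fixed threshold and serving tier\<close>

context
  fixes T :: real and l :: tier
  assumes T: "0 < T"
begin

definition laplace_arg :: "real \<Rightarrow> real" where
  "laplace_arg r = T * r powr pathloss H / tx_power H l"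

lemma measurable_laplace_arg [measurable]: "laplace_arg \<in> borel_measurable borel"
  unfolding laplace_arg_def[abs_def] by measurable

lemma laplace_arg_pos: "0 < r \<Longrightarrow> 0 < laplace_arg r"
  using T hetnet_pos(2)[OF valid] by (simp add: laplace_arg_def)

text \<open>Coverage means that the serving channel power exceeds this value. The maximum with 0
  changes it at most on a null set and makes it nonnegative everywhere.\<close>

definition signal_threshold :: "'w \<Rightarrow> real" where
  "signal_threshold \<omega> = max 0 (laplace_arg (serving_dist H X \<omega>) * (interference H X g \<omega> + noise H))"

text \<open>The decoupled counterpart of \<open>signal_threshold\<close>: distance and outcome are
  separate coordinates of a product space.\<close>

definition outer_threshold :: "real \<times> 'w \<Rightarrow> real" where
  "outer_threshold z = max 0 (laplace_arg (fst z) * (outer_interference l (fst z) (snd z) + noise H))"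

lemma measurable_signal_threshold [measurable]: "signal_threshold \<in> borel_measurable M"
  unfolding signal_threshold_def[abs_def] by measurable

lemma measurable_outer_threshold [measurable]: "outer_threshold \<in> borel_measurable (borel \<Otimes>\<^sub>M M)"
  using measurable_outer_interference_pair[of l]
  unfolding outer_threshold_def[abs_def] case_prod_beta by measurable

lemma nn_integral_exp_outer_threshold:
  assumes r: "0 < r" and \<theta>: "0 < \<theta>"
  shows "(\<integral>\<^sup>+\<omega>. ennreal (exp (- \<theta> * outer_threshold (r, \<omega>))) \<partial>M) =
    ennreal (exp (- \<theta> * laplace_arg r * noise H) * outer_laplace H l r (\<theta> * laplace_arg r))"
proof -
  let ?s = "\<theta> * laplace_arg r"
  have s: "0 < ?s" using \<theta> laplace_arg_pos[OF r] by simp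
  have int: "integrable M (\<lambda>\<omega>. exp (- ?s * outer_interference l r \<omega>))"
  proof (rule integrable_const_bound[where B=1])
    show "AE \<omega> in M. norm (exp (- ?s * outer_interference l r \<omega>)) \<le> 1"
      using outer_interference_nonneg[OF r, of l] by eventually_elim (use s in simp)
  qed measurable
  have "(\<integral>\<^sup>+\<omega>. ennreal (exp (- \<theta> * outer_threshold (r, \<omega>))) \<partial>M) =
      (\<integral>\<^sup>+\<omega>. ennreal (exp (- ?s * noise H) * exp (- ?s * outer_interference l r \<omega>)) \<partial>M)"
  proof (rule nn_integral_cong_AE)
    show "AE \<omega> in M. ennreal (exp (- \<theta> * outer_threshold (r, \<omega>))) =
        ennreal (exp (- ?s * noise H) * exp (- ?s * outer_interference l r \<omega>))"
      using outer_interference_nonneg[OF r, of l]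
    proof eventually_elim
      case (elim \<omega>)
      have "outer_threshold (r, \<omega>) = laplace_arg r * (outer_interference l r \<omega> + noise H)"
        using elim hetnet_pos(6)[OF valid] laplace_arg_pos[OF r] by (simp add: outer_threshold_def)
      then show ?case by (simp add: exp_add[symmetric] algebra_simps)
    qed
  qed
  also have "\<dots> = ennreal (expectation (\<lambda>\<omega>. exp (- ?s * noise H) * exp (- ?s * outer_interference l r \<omega>)))"
    by (rule nn_integral_eq_integral) (use int in auto)
  also have "expectation (\<lambda>\<omega>. exp (- ?s * noise H) * exp (- ?s * outer_interference l r \<omega>)) =
      exp (- ?s * noise H) * outer_laplace H l r ?s"
    using expectation_exp_outer_interference[OF r, of ?s l] s by simp
  finally show ?thesis by (simp add: mult.assoc)
qed

text \<open>Disintegration with \<open>\<sigma> r = \<theta> * laplace_arg r\<close> gives the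
  transform of the true threshold; for each \<open>r\<close> the factor obtained is the transform of
  the decoupled one, and Fubini reassembles it.\<close>

lemma laplace_threshold_eq:
  assumes \<theta>: "0 < \<theta>"
  defines "D \<equiv> density lborel (\<lambda>r. ennreal (indicator {0<..} r * serving_density l r))"
  shows "(\<integral>\<omega>. exp (- \<theta> * signal_threshold \<omega>) \<partial>density M (\<lambda>\<omega>. ennreal (of_bool (serving_tier H X \<omega> = l)))) =
    (\<integral>z. exp (- \<theta> * outer_threshold z) \<partial>(D \<Otimes>\<^sub>M M))"
proof -
  let ?P = "density M (\<lambda>\<omega>. ennreal (of_bool (serving_tier H X \<omega> = l)))"
  let ?\<sigma> = "\<lambda>r. \<theta> * laplace_arg r"
  have [measurable_cong]: "sets D = sets borel" by (simp add: D_def)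
  have "(\<integral>\<^sup>+\<omega>. ennreal (exp (- \<theta> * signal_threshold \<omega>)) \<partial>?P) =
      (\<integral>\<^sup>+\<omega>. ennreal (of_bool (serving_tier H X \<omega> = l)) * ennreal (exp (- \<theta> * signal_threshold \<omega>)) \<partial>M)"
    by (rule nn_integral_density) measurable
  also have "\<dots> = (\<integral>\<^sup>+\<omega>. ennreal (of_bool (serving_tier H X \<omega> = l) * exp (- ?\<sigma> (serving_dist H X \<omega>) * interference H X g \<omega>)) *
      ennreal (exp (- ?\<sigma> (serving_dist H X \<omega>) * noise H)) \<partial>M)"
  proof (rule nn_integral_cong_AE)
    show "AE \<omega> in M. ennreal (of_bool (serving_tier H X \<omega> = l)) * ennreal (exp (- \<theta> * signal_threshold \<omega>)) =
      ennreal (of_bool (serving_tier H X \<omega> = l) * exp (- ?\<sigma> (serving_dist H X \<omega>) * interference H X g \<omega>)) *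
      ennreal (exp (- ?\<sigma> (serving_dist H X \<omega>) * noise H))"
      using AE_regular_config
    proof eventually_elim
      case (elim \<omega>)
      have "signal_threshold \<omega> = laplace_arg (serving_dist H X \<omega>) * (interference H X g \<omega> + noise H)"
        using interference_nonneg[OF elim] hetnet_pos(6)[OF valid] laplace_arg_pos[OF serving_dist_pos[OF elim]]
        by (simp add: signal_threshold_def)
      then show ?case by (auto simp: ennreal_mult'[symmetric] exp_add[symmetric] algebra_simps)
    qed
  qed
  also have "\<dots> = (\<integral>\<^sup>+r. ennreal (indicator {0<..} r * (serving_density l r * outer_laplace H l r (?\<sigma> r))) * ennreal (exp (- ?\<sigma> r * noise H)) \<partial>lborel)"
  proof (rule serving_disintegration[of ?\<sigma> "\<lambda>r. ennreal (exp (- ?\<sigma> r * noise H))" l])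
    show "0 \<le> ?\<sigma> r" if "0 < r" for r using \<theta> laplace_arg_pos[OF that] by simp
    show "?\<sigma> a \<le> ?\<sigma> b" if "0 < a" "a \<le> b" for a b
    proof -
      have "a powr pathloss H \<le> b powr pathloss H" using that hetnet_pos(5)[OF valid] by (intro powr_mono2) auto
      then show ?thesis
        using \<theta> T hetnet_pos(2)[OF valid, of l] by (simp add: laplace_arg_def divide_right_mono)
    qed
    show "isCont ?\<sigma> r" if "0 < r" for r
      unfolding laplace_arg_def[abs_def] using that hetnet_pos(2)[OF valid, of l]
      by (intro continuous_intros) auto
  qed measurable
  also have "\<dots> = (\<integral>\<^sup>+r. ennreal (indicator {0<..} r * serving_density l r) * (\<integral>\<^sup>+\<omega>. ennreal (exp (- \<theta> * outer_threshold (r, \<omega>))) \<partial>M) \<partial>lborel)"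
  proof (rule nn_integral_cong)
    fix r
    show "ennreal (indicator {0<..} r * (serving_density l r * outer_laplace H l r (?\<sigma> r))) * ennreal (exp (- ?\<sigma> r * noise H)) =
      ennreal (indicator {0<..} r * serving_density l r) * (\<integral>\<^sup>+\<omega>. ennreal (exp (- \<theta> * outer_threshold (r, \<omega>))) \<partial>M)"
    proof (cases "0 < r")
      case True
      have "0 \<le> serving_density l r" "0 < outer_laplace H l r (?\<sigma> r)"
        using serving_density_nonneg[of r l] outer_laplace_bounds(1)[OF valid True] \<theta> laplace_arg_pos[OF True] True
        by (auto simp: less_imp_le)
      then show ?thesis unfolding nn_integral_exp_outer_threshold[OF True \<theta>]
        using True by (simp add: ennreal_mult'[symmetric] mult_ac)
    qed simp
  qed
  also have "\<dots> = (\<integral>\<^sup>+r. (\<integral>\<^sup>+\<omega>. ennreal (exp (- \<theta> * outer_threshold (r, \<omega>))) \<partial>M) \<partial>D)"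
    unfolding D_def by (rule nn_integral_density[symmetric]) measurable
  also have "\<dots> = (\<integral>\<^sup>+z. ennreal (exp (- \<theta> * outer_threshold z)) \<partial>(D \<Otimes>\<^sub>M M))"
    by (rule nn_integral_fst) measurable
  finally have "(\<integral>\<^sup>+\<omega>. ennreal (exp (- \<theta> * signal_threshold \<omega>)) \<partial>?P) = (\<integral>\<^sup>+z. ennreal (exp (- \<theta> * outer_threshold z)) \<partial>(D \<Otimes>\<^sub>M M))" .
  then show ?thesis
    by (subst (1 2) integral_eq_nn_integral) auto
qed

text \<open>The tail is a finite combination of \<open>y ^ k * exp (- y)\<close>, whose integrals
  are derivatives at \<open>\<theta> = 1\<close> of Laplace transforms. The transforms of both
  thresholds agree for all positive \<open>\<theta>\<close>, hence so do these derivatives.\<close>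

lemma nn_integral_erlang_tail_threshold:
  "(\<integral>\<^sup>+\<omega>. ennreal (of_bool (serving_tier H X \<omega> = l)) * ennreal (erlang_tail n (signal_threshold \<omega>)) \<partial>M) =
    (\<integral>\<^sup>+r. ennreal (indicator {0<..} r * serving_density l r) * (\<integral>\<^sup>+\<omega>. ennreal (erlang_tail n (outer_threshold (r, \<omega>))) \<partial>M) \<partial>lborel)"
proof -
  define D where "D = density lborel (\<lambda>r. ennreal (indicator {0<..} r * serving_density l r))"
  let ?P = "density M (\<lambda>\<omega>. ennreal (of_bool (serving_tier H X \<omega> = l)))"
  have sD [measurable_cong]: "sets D = sets borel" by (simp add: D_def)
  have "emeasure D UNIV = (\<integral>\<^sup>+r. ennreal (indicator {0<..} r * serving_density l r) * 1 \<partial>lborel)"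
    unfolding D_def by (subst emeasure_density) auto
  also have "\<dots> = (\<integral>\<^sup>+\<omega>. ennreal (of_bool (serving_tier H X \<omega> = l)) * 1 \<partial>M)"
    by (rule serving_law[symmetric]) simp
  also have "\<dots> \<le> (\<integral>\<^sup>+\<omega>. 1 \<partial>M)" by (rule nn_integral_mono) auto
  finally have "emeasure D UNIV \<le> 1" by (simp add: emeasure_space_1)
  from order_le_less_trans[OF this ennreal_one_less_top]
  have "emeasure D UNIV \<noteq> \<infinity>" by simp
  then interpret D: finite_measure D by (intro finite_measureI) (simp add: D_def)
  interpret DM: finite_measure "D \<Otimes>\<^sub>M M" by (rule finite_measure_pair_measure) unfold_locales
  have "emeasure ?P (space ?P) = (\<integral>\<^sup>+\<omega>. ennreal (of_bool (serving_tier H X \<omega> = l)) * indicator (space M) \<omega> \<partial>M)"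
    by (subst emeasure_density) auto
  also have "\<dots> \<le> (\<integral>\<^sup>+\<omega>. 1 \<partial>M)" by (rule nn_integral_mono) (auto simp: indicator_def)
  finally have "emeasure ?P (space ?P) \<le> 1" by (simp add: emeasure_space_1)
  from order_le_less_trans[OF this ennreal_one_less_top]
  interpret P: finite_measure ?P by (intro finite_measureI) simp
  have Y0: "0 \<le> signal_threshold \<omega>" "0 \<le> outer_threshold z" for \<omega> z
    by (simp_all add: signal_threshold_def outer_threshold_def)
  have mY: "signal_threshold \<in> borel_measurable ?P" "outer_threshold \<in> borel_measurable (D \<Otimes>\<^sub>M M)" by measurable
  \<comment> \<open>One function read as two Laplace transforms: by definition over
    \<open>?P\<close>, and through \<open>laplace_threshold_eq\<close> over the product.\<close>
  let ?F = "\<lambda>\<theta>. \<integral>\<omega>. exp (- \<theta> * signal_threshold \<omega>) \<partial>?P"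
  note d1 = P.deriv_pow_laplace_transform[OF mY(1) Y0(1) refl zero_less_one]
  note d2 = DM.deriv_pow_laplace_transform[OF mY(2) Y0(2) _ zero_less_one, of ?F]
  have F: "?F \<theta> = (\<integral>z. exp (- \<theta> * outer_threshold z) \<partial>(D \<Otimes>\<^sub>M M))" if "0 < \<theta>" for \<theta>
    unfolding D_def by (rule laplace_threshold_eq[OF that])
  have tail: "erlang_tail n y = (\<Sum>k<n. (- 1) ^ k / fact k * ((- y) ^ k * exp (- 1 * y)))" for y
    unfolding erlang_tail_def
  proof (rule sum.cong[OF refl])
    fix k
    have "(- y) ^ k = (- 1) ^ k * y ^ k" by (rule power_minus)
    then show "y ^ k / fact k * exp (- y) = (- 1) ^ k / fact k * ((- y) ^ k * exp (- 1 * y))"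
      by (simp add: power_mult_distrib[symmetric])
  qed
  have i1: "integrable ?P (\<lambda>\<omega>. erlang_tail n (signal_threshold \<omega>))"
    unfolding tail by (intro Bochner_Integration.integrable_sum integrable_mult_right d1(2))
  have i2: "integrable (D \<Otimes>\<^sub>M M) (\<lambda>z. erlang_tail n (outer_threshold z))"
    unfolding tail by (intro Bochner_Integration.integrable_sum integrable_mult_right d2(2) F)
  have "(\<integral>\<omega>. erlang_tail n (signal_threshold \<omega>) \<partial>?P) = (\<Sum>k<n. (- 1) ^ k / fact k * (deriv ^^ k) ?F 1)"
    unfolding tail d1(1) by (subst Bochner_Integration.integral_sum) (auto intro!: integrable_mult_right d1(2)[simplified])
  also have "\<dots> = (\<Sum>k<n. (- 1) ^ k / fact k * (\<integral>z. (- outer_threshold z) ^ k * exp (- 1 * outer_threshold z) \<partial>(D \<Otimes>\<^sub>M M)))"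
  proof (rule sum.cong[OF refl])
    fix k
    have "(deriv ^^ k) ?F 1 = (\<integral>z. (- outer_threshold z) ^ k * exp (- 1 * outer_threshold z) \<partial>(D \<Otimes>\<^sub>M M))"
      by (rule d2(1)) (rule F)
    then show "(- 1) ^ k / fact k * (deriv ^^ k) ?F 1 =
        (- 1) ^ k / fact k * (\<integral>z. (- outer_threshold z) ^ k * exp (- 1 * outer_threshold z) \<partial>(D \<Otimes>\<^sub>M M))"
      by (rule arg_cong)
  qed
  also have "\<dots> = (\<integral>z. erlang_tail n (outer_threshold z) \<partial>(D \<Otimes>\<^sub>M M))"
    unfolding tail by (subst Bochner_Integration.integral_sum) (auto intro!: integrable_mult_right d2(2)[OF F, simplified])
  finally have eq: "(\<integral>\<omega>. erlang_tail n (signal_threshold \<omega>) \<partial>?P) = (\<integral>z. erlang_tail n (outer_threshold z) \<partial>(D \<Otimes>\<^sub>M M))" .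
  have t0: "0 \<le> erlang_tail n y" if "0 \<le> y" for y
    unfolding erlang_tail_def using that by (intro sum_nonneg) auto
  have "(\<integral>\<^sup>+\<omega>. ennreal (of_bool (serving_tier H X \<omega> = l)) * ennreal (erlang_tail n (signal_threshold \<omega>)) \<partial>M) =
      (\<integral>\<^sup>+\<omega>. ennreal (erlang_tail n (signal_threshold \<omega>)) \<partial>?P)"
    by (rule nn_integral_density[symmetric]) measurable
  also have "\<dots> = ennreal (\<integral>\<omega>. erlang_tail n (signal_threshold \<omega>) \<partial>?P)"
    by (rule nn_integral_eq_integral[OF i1]) (use t0 Y0 in auto)
  also have "\<dots> = (\<integral>\<^sup>+z. ennreal (erlang_tail n (outer_threshold z)) \<partial>(D \<Otimes>\<^sub>M M))"
    unfolding eq by (rule nn_integral_eq_integral[OF i2, symmetric]) (use t0 Y0 in auto)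
  also have "\<dots> = (\<integral>\<^sup>+r. (\<integral>\<^sup>+\<omega>. ennreal (erlang_tail n (outer_threshold (r, \<omega>))) \<partial>M) \<partial>D)"
    by (rule nn_integral_fst[symmetric]) measurable
  also have "\<dots> = (\<integral>\<^sup>+r. ennreal (indicator {0<..} r * serving_density l r) * (\<integral>\<^sup>+\<omega>. ennreal (erlang_tail n (outer_threshold (r, \<omega>))) \<partial>M) \<partial>lborel)"
    unfolding D_def by (rule nn_integral_density) measurable
  finally show ?thesis .
qed

lemma sinr_gt_iff:
  assumes reg: "regular_config \<omega>" and st: "serving_tier H X \<omega> = l"
  shows "T < sinr H X g h \<omega> \<longleftrightarrow> signal_threshold \<omega> < h l \<omega>"
proof -
  define R where "R = serving_dist H X \<omega> powr pathloss H"
  have R: "0 < R" using serving_dist_pos[OF reg] by (simp add: R_def)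
  have p: "0 < tx_power H l" by (rule hetnet_pos(2)[OF valid])
  have J: "0 < interference H X g \<omega> + noise H"
    using interference_pos[OF reg] hetnet_pos(6)[OF valid] by simp
  have "T < sinr H X g h \<omega> \<longleftrightarrow> T < tx_power H l * h l \<omega> / R / (interference H X g \<omega> + noise H)"
    by (simp add: sinr_def st R_def powr_minus divide_inverse)
  also have "\<dots> \<longleftrightarrow> T * R / tx_power H l * (interference H X g \<omega> + noise H) < h l \<omega>"
    by (simp add: pos_less_divide_eq[OF mult_pos_pos[OF R J]] pos_divide_less_eq[OF p] mult_ac)
  also have "T * R / tx_power H l * (interference H X g \<omega> + noise H) = signal_threshold \<omega>"
    using R p J T by (simp add: signal_threshold_def laplace_arg_def R_def[symmetric])
  finally show ?thesis .
qed

text \<open>On the association event only \<open>h l\<close> enters as signal power. It is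
  independent of all other sources, in particular of the threshold and of the association, and is
  integrated out to its tail function.\<close>

lemma emeasure_coverage:
  "emeasure M {\<omega>\<in>space M. T < sinr H X g h \<omega> \<and> \<omega> \<in> assoc_event M H X l} =
    (\<integral>\<^sup>+\<omega>. ennreal (of_bool (serving_tier H X \<omega> = l)) * ennreal (erlang_tail (dof H l) (signal_threshold \<omega>)) \<partial>M)"
proof -
  let ?J = "UNIV - {Signal l}"
  let ?U = "\<lambda>\<omega>. (of_bool (serving_tier H X \<omega> = l) :: real, signal_threshold \<omega>)"
  let ?f = "\<lambda>z :: (real \<times> real) \<times> real. ennreal (fst (fst z)) * indicator {z. snd (fst z) < snd z} z"
  have [measurable]: "X j n \<in> borel_measurable (source_sigma ?J)" "g j n \<in> borel_measurable (source_sigma ?J)" for j n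
    by (auto intro!: measurable_points measurable_interf)
  have [measurable]: "serving_tier H X \<in> source_sigma ?J \<rightarrow>\<^sub>M count_space UNIV"
    "serving_dist H X \<in> borel_measurable (source_sigma ?J)" "interference H X g \<in> borel_measurable (source_sigma ?J)"
    by (rule measurable_serving_tier measurable_serving_dist measurable_interference; measurable)+
  have [measurable]: "signal_threshold \<in> borel_measurable (source_sigma ?J)"
    unfolding signal_threshold_def[abs_def] by measurable
  have U: "?U \<in> source_sigma ?J \<rightarrow>\<^sub>M borel \<Otimes>\<^sub>M borel" by measurable
  have V: "h l \<in> source_sigma {Signal l} \<rightarrow>\<^sub>M borel" by (rule measurable_signal) simp
  have dof: "0 < dof H l" by (simp add: dof_def)
  have "emeasure M {\<omega>\<in>space M. T < sinr H X g h \<omega> \<and> \<omega> \<in> assoc_event M H X l} =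
      (\<integral>\<^sup>+\<omega>. indicator {\<omega>\<in>space M. T < sinr H X g h \<omega> \<and> \<omega> \<in> assoc_event M H X l} \<omega> \<partial>M)"
    by (rule nn_integral_indicator[symmetric]) measurable
  also have "\<dots> = (\<integral>\<^sup>+\<omega>. ?f (?U \<omega>, h l \<omega>) \<partial>M)"
  proof (rule nn_integral_cong_AE)
    show "AE \<omega> in M. indicator {\<omega>\<in>space M. T < sinr H X g h \<omega> \<and> \<omega> \<in> assoc_event M H X l} \<omega> = ?f (?U \<omega>, h l \<omega>)"
      using AE_regular_config AE_space
      by eventually_elim (auto simp: assoc_event_def indicator_def sinr_gt_iff)
  qed
  also have "\<dots> = (\<integral>\<^sup>+\<omega>. (\<integral>\<^sup>+v. ?f (?U \<omega>, v) \<partial>distr M borel (h l)) \<partial>M)"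
    by (rule nn_integral_source_sigma[OF U V]) auto
  also have "\<dots> = (\<integral>\<^sup>+\<omega>. ennreal (of_bool (serving_tier H X \<omega> = l)) * ennreal (erlang_tail (dof H l) (signal_threshold \<omega>)) \<partial>M)"
  proof (rule nn_integral_cong)
    fix \<omega>
    have "(\<integral>\<^sup>+v. ?f (?U \<omega>, v) \<partial>distr M borel (h l)) =
        (\<integral>\<^sup>+v. ennreal (of_bool (serving_tier H X \<omega> = l)) * indicator {signal_threshold \<omega><..} v \<partial>distr M borel (h l))"
      by (rule nn_integral_cong) (auto simp: indicator_def)
    also have "\<dots> = ennreal (of_bool (serving_tier H X \<omega> = l)) * emeasure (distr M borel (h l)) {signal_threshold \<omega><..}"
      by (rule nn_integral_cmult_indicator) simp
    also have "emeasure (distr M borel (h l)) {signal_threshold \<omega><..} = ennreal (erlang_tail (dof H l) (signal_threshold \<omega>))"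
      unfolding distr_signal by (rule emeasure_erlang_greaterThan(1)[OF _ dof]) (simp add: signal_threshold_def)
    finally show "(\<integral>\<^sup>+v. ?f (?U \<omega>, v) \<partial>distr M borel (h l)) =
      ennreal (of_bool (serving_tier H X \<omega> = l)) * ennreal (erlang_tail (dof H l) (signal_threshold \<omega>))" .
  qed
  finally show ?thesis .
qed

lemma coverage_prob_given_eq:
  "set_integrable lborel {0<..} (coverage_integrand M H X T l)"
  "coverage_prob_given M H X g h T l = (LBINT r:{0<..}. coverage_integrand M H X T l r)"
proof -
  let ?A = "assoc_event M H X l"
  let ?C = "{\<omega>\<in>space M. T < sinr H X g h \<omega> \<and> \<omega> \<in> ?A}"
  define Q where "Q r = expectation (\<lambda>\<omega>. erlang_tail (dof H l) (outer_threshold (r, \<omega>)))" for r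
  define q where "q r = indicator {0<..} r * (serving_density l r * Q r)" for r
  have P: "0 < prob ?A" by (rule prob_assoc_event_pos)
  have dof: "0 < dof H l" by (simp add: dof_def)
  have b: "0 \<le> erlang_tail (dof H l) (outer_threshold z)" "erlang_tail (dof H l) (outer_threshold z) \<le> 1" for z
    by (rule emeasure_erlang_greaterThan(2,3)[OF _ dof]; simp add: outer_threshold_def)+
  have Q0: "0 \<le> Q r" for r unfolding Q_def using b by (intro integral_nonneg_AE) auto
  have [measurable]: "Q \<in> borel_measurable borel"
    unfolding Q_def[abs_def] by (rule borel_measurable_lebesgue_integral) measurable
  have [measurable]: "q \<in> borel_measurable borel" unfolding q_def[abs_def] by measurable
  have q0: "0 \<le> q r" for r using serving_density_nonneg[of r l] Q0 by (auto simp: q_def indicator_def)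
  \<comment> \<open>The derivatives in the integrand become an expectation at the fixed distance
    \<open>r\<close>; division by \<open>prob ?A\<close> turns \<open>serving_density\<close> into
    the conditional density of the distance.\<close>
  have qc: "indicator {0<..} r *\<^sub>R coverage_integrand M H X T l r = q r / prob ?A" for r
  proof (cases "0 < r")
    case True
    then show ?thesis
      unfolding coverage_integrand_def Let_def serving_dist_density_eq laplace_arg_def[symmetric]
        erlang_tail_expectation[OF True laplace_arg_pos[OF True]]
      by (simp add: q_def Q_def outer_threshold_def)
  qed (simp add: q_def)
  have "emeasure M ?C = (\<integral>\<^sup>+r. ennreal (indicator {0<..} r * serving_density l r) *
      (\<integral>\<^sup>+\<omega>. ennreal (erlang_tail (dof H l) (outer_threshold (r, \<omega>))) \<partial>M) \<partial>lborel)"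
    unfolding emeasure_coverage nn_integral_erlang_tail_threshold ..
  also have "\<dots> = (\<integral>\<^sup>+r. ennreal (q r) \<partial>lborel)"
  proof (rule nn_integral_cong)
    fix r
    have int: "integrable M (\<lambda>\<omega>. erlang_tail (dof H l) (outer_threshold (r, \<omega>)))"
      by (rule integrable_const_bound[where B=1]) (use b in \<open>auto simp: abs_of_nonneg\<close>)
    have "(\<integral>\<^sup>+\<omega>. ennreal (erlang_tail (dof H l) (outer_threshold (r, \<omega>))) \<partial>M) = ennreal (Q r)"
      unfolding Q_def by (rule nn_integral_eq_integral[OF int]) (use b in auto)
    then show "ennreal (indicator {0<..} r * serving_density l r) *
        (\<integral>\<^sup>+\<omega>. ennreal (erlang_tail (dof H l) (outer_threshold (r, \<omega>))) \<partial>M) = ennreal (q r)"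
      using Q0[of r] serving_density_nonneg[of r l] by (auto simp: q_def indicator_def ennreal_mult')
  qed
  finally have nnq: "(\<integral>\<^sup>+r. ennreal (q r) \<partial>lborel) = ennreal (prob ?C)" by (simp add: emeasure_eq_measure)
  have "integrable lborel q"
    by (rule integrableI_nonneg) (use q0 nnq in auto)
  then show "set_integrable lborel {0<..} (coverage_integrand M H X T l)"
    unfolding set_integrable_def qc by simp
  have "(\<integral>r. q r \<partial>lborel) = prob ?C"
    using q0 nnq by (subst integral_eq_nn_integral) auto
  then have "(LBINT r:{0<..}. coverage_integrand M H X T l r) = prob ?C / prob ?A"
    unfolding set_lebesgue_integral_def qc by simp
  moreover have "coverage_prob_given M H X g h T l = prob ?C / prob ?A"
  proof -
    have "{\<omega>\<in>space M. \<omega> \<in> ?A} = ?A" by (auto simp: assoc_event_def)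
    then show ?thesis by (simp add: coverage_prob_given_def cond_prob_def)
  qed
  ultimately show "coverage_prob_given M H X g h T l = (LBINT r:{0<..}. coverage_integrand M H X T l r)" by simp
qed

end

lemma total_coverage:
  "coverage_prob M H X g h T =
    (1 - sbs_assoc_prob M H X) * coverage_prob_given M H X g h T MBS +
    sbs_assoc_prob M H X * coverage_prob_given M H X g h T SBS"
proof -
  let ?C = "\<lambda>l. {\<omega>\<in>space M. T < sinr H X g h \<omega> \<and> \<omega> \<in> assoc_event M H X l}"
  have c: "prob (assoc_event M H X l) * coverage_prob_given M H X g h T l = prob (?C l)" for l
  proof -
    have "{\<omega>\<in>space M. \<omega> \<in> assoc_event M H X l} = assoc_event M H X l" by (auto simp: assoc_event_def)
    then show ?thesis
      using prob_assoc_event_pos[of l] by (simp add: coverage_prob_given_def cond_prob_def)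
  qed
  have "{\<omega>\<in>space M. T < sinr H X g h \<omega>} = ?C MBS \<union> ?C SBS"
    by (auto simp: assoc_event_def intro: tier.exhaust)
  then have "coverage_prob M H X g h T = prob (?C MBS \<union> ?C SBS)" by (simp add: coverage_prob_def)
  also have "\<dots> = prob (?C MBS) + prob (?C SBS)"
    by (rule finite_measure_Union) (measurable, measurable, auto simp: assoc_event_def)
  finally show ?thesis
    using c[of MBS] c[of SBS] by (simp add: prob_assoc_event_MBS sbs_assoc_prob_def[symmetric])
qed

end

theorem theorem1:
  fixes M :: "'w measure" and H :: hetnet
    and X :: "tier \<Rightarrow> nat \<Rightarrow> 'w \<Rightarrow> real^2"
    and g :: "tier \<Rightarrow> nat \<Rightarrow> 'w \<Rightarrow> real" and h :: "tier \<Rightarrow> 'w \<Rightarrow> real"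
    and T :: real
  assumes "valid_hetnet H" and "hetnet_model M H X g h" and "0 < T"
  shows "(\<forall>l. set_integrable lborel {0<..} (coverage_integrand M H X T l) \<and>
              coverage_prob_given M H X g h T l = (LBINT r:{0<..}. coverage_integrand M H X T l r)) \<and>
         (\<forall>l. distributed (uniform_measure M (assoc_event M H X l)) lborel (serving_dist H X)
                (\<lambda>r. ennreal (serving_dist_density M H X l r * indicator {0<..} r))) \<and>
         sbs_assoc_prob M H X =
           1 / (1 + dens H MBS / dens H SBS * (1 / bias_ratio H powr (2 / pathloss H))) \<and>
         (\<forall>l. conditional_laplace M H X g l (interference_laplace H l)) \<and>
         (\<forall>l k r s. 1 \<le> k \<and> 0 < r \<and> 0 < s \<longrightarrow>
            (deriv ^^ (k - 1)) (noisy_laplace H l r) differentiable (at s) \<and>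
            (deriv ^^ k) (noisy_laplace H l r) s = noisy_laplace_deriv H l k r s) \<and>
         coverage_prob M H X g h T =
           (1 - sbs_assoc_prob M H X) * coverage_prob_given M H X g h T MBS +
           sbs_assoc_prob M H X * coverage_prob_given M H X g h T SBS"
proof -
  interpret hetnet_sources M H X g h
    using assms by unfold_locales
  have "(deriv ^^ (k - 1)) (noisy_laplace H l r) differentiable (at s)" if "0 < r" "0 < s" for l k r s
    using higher_deriv_noisy_laplace(1)[OF assms(1) that] by (auto simp: real_differentiable_def)
  then show ?thesis
    using coverage_prob_given_eq[OF assms(3)] distributed_serving_dist sbs_assoc_prob_eq
      conditional_laplace_interference higher_deriv_noisy_laplace(2)[OF assms(1)] total_coverage
    by blast
qed

end
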